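(* Let $\mathcal{X}=(X,\mathcal{U})$ be a locally standard torus orbifold of dimension $2n$ with action of the $n$-dimensional torus $T$, let $Q=X/T$ be its orbit space with orbit map $\pi\colon X\to Q$, and suppose that $H^2(Q;\mathbb{Z}^n)$ is trivial. Let $\lambda\colon\mathcal{F}(Q)\to\mathbb{Z}^n\cong H_2(BT)$ be the characteristic function defined by $\lambda(F_i)=\lambda_i$, where $\lambda_i\in H_2(BT)\cong\mathrm{Hom}(S^1,T)$ is such that $\lambda_i(S^1)\subset T$ is the isotropy subgroup of $\pi^{-1}(F_i)$ for each facet $F_i$ of $Q$. Then there is an equivariant homeomorphism $f\colon X(Q,\lambda)\to X$ such that $\pi\circ f=pr_1$, where $pr_1\colon X(Q,\lambda)\to Q$ is the projection onto the first factor.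
   Context: $T=T^n$ is an $n$-dimensional compact torus; $H_2(BT)=\mathrm{Hom}(S^1,T)\cong\mathbb{Z}^n$. Torus orbifold: a closed oriented $2n$-dimensional orbifold $\mathcal{X}=(X,\mathcal{U})$ ($X$ the underlying space, $\mathcal{U}$ the orbifold atlas) with an action of $T$ (possibly with finite kernel) with nonempty fixed point set, having finitely many fixed points and finitely many connected components of $1$-dimensional orbits, and whose tangential weights at each fixed point are pairwise linearly independent (i.e. a GKM-orbifold with half-dimensional torus action). It is locally standard if for each point $p\in X$ there exist an orbifold chart $(\tilde U,G,\phi\colon\tilde U\to U)$ of a $T$-invariant neighbourhood $U$ of $p$, an equivariant diffeomorphism $\psi$ from an open subset $W$ of $\mathbb{C}^n$ to $\tilde U$ and a surjective covering homomorphism $\xi\colon(S^1)^n\to T$ with $\ker\xi\cong G$ such that $\phi(\psi(s\cdot w))=\xi(s)\cdot\phi(\psi(w))$ for $s\in(S^1)^n$, $w\in W$, where $(S^1)^n$ acts on $W$ in the standard way; a preferred orientation on each $T$-invariant suborbifold of (complex) codimension one is part of the structure. Then $Q=X/T$ is a manifold with faces (a manifold with corners in which every face of codimension $k$ is a connected component of an intersection of $k$ distinct facets); facets are the codimension-one faces and $\mathcal{F}(Q)=\{F_1,\dots,F_m\}$ is the set of facets. $Q$ is always assumed to be a CW-complex. Characteristic function: a function $\lambda\colon\mathcal{F}(Q)\to H_2(BT)$ such that $\lambda(F_{i_1}),\dots,\lambda(F_{i_k})$ are linearly independent whenever $F_{i_1}\cap\dots\cap F_{i_k}\neq\emptyset$.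 The isotropy subgroup of $\pi^{-1}(F_i)$ is the isotropy group of points over the relative interior of $F_i$. Quotient construction: $X(Q,\lambda)=(Q\times T)/\!\sim$, where $(x,t)\sim(y,s)$ iff $x=y$ and $t^{-1}s\in T_{F(x)}$. Here $F(x)$ is the face of $Q$ containing $x$ in its relative interior and $T_{F(x)}$ is the subtorus of $T$ generated by the circle subgroups $\lambda(F_{i_1})(S^1),\dots,\lambda(F_{i_k})(S^1)$, where $F_{i_1},\dots,F_{i_k}$ are the facets containing $F(x)$. $T$ acts on $X(Q,\lambda)$ by multiplication on the second factor. *)

theory Defs
  imports
    "HOL-Analysis.Analysis"
    "HOL-Homology.Homology"
    "HOL-Algebra.Group_Action"
    "HOL-Algebra.Generated_Groups"
begin

section \<open>The torus\<close>

text \<open>The \<open>n\<close>-dimensional compact torus is realised as \<open>(S\<^sup>1)\<^sup>n \<subseteq> \<complex>\<^sup>n\<close>, with \<open>n = CARD('n)\<close>.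
  Multiplication on \<^typ>\<open>complex ^ 'n\<close> is componentwise, so \<open>t * w\<close> is at the same time the group
  operation of the torus and its standard action on \<open>\<complex>\<^sup>n\<close>.\<close>

definition torus :: "(complex ^ 'n) set" where
  "torus = {t. \<forall>i. norm (t $ i) = 1}"

definition torus_group :: "(complex ^ 'n) monoid" where
  "torus_group = \<lparr>carrier = torus, monoid.mult = (*), one = 1\<rparr>"

definition torus_exp :: "real ^ 'n \<Rightarrow> complex ^ 'n" where
  "torus_exp \<theta> = (\<chi> i. cis (\<theta> $ i))"

text \<open>The identification \<open>\<int>\<^sup>n \<cong> Hom(S\<^sup>1, T) = H\<^sub>2(BT)\<close>.\<close>

definition one_param :: "int ^ 'n \<Rightarrow> complex \<Rightarrow> complex ^ 'n" where
  "one_param a z = (\<chi> i. z powi (a $ i))"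

definition circle_subgroup :: "int ^ 'n \<Rightarrow> (complex ^ 'n) set" where
  "circle_subgroup a = one_param a ` sphere 0 1"

section \<open>Quotient topology\<close>

definition quotient_topology :: "'a topology \<Rightarrow> ('a \<Rightarrow> 'b) \<Rightarrow> 'b topology" where
  "quotient_topology X q =
     topology (\<lambda>U. U \<subseteq> q ` topspace X \<and> openin X {x \<in> topspace X. q x \<in> U})"

lemma openin_quotient_topology:
  "openin (quotient_topology X q) U \<longleftrightarrow>
     U \<subseteq> q ` topspace X \<and> openin X {x \<in> topspace X. q x \<in> U}"
proof -
  have "istopology (\<lambda>U. U \<subseteq> q ` topspace X \<and> openin X {x \<in> topspace X. q x \<in> U})"
    unfolding istopology_def
  proof (rule conjI; intro allI impI)
    fix S U
    assume S: "S \<subseteq> q ` topspace X \<and> openin X {x \<in> topspace X. q x \<in> S}"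
      and U: "U \<subseteq> q ` topspace X \<and> openin X {x \<in> topspace X. q x \<in> U}"
    have "{x \<in> topspace X. q x \<in> S \<inter> U} = {x \<in> topspace X. q x \<in> S} \<inter> {x \<in> topspace X. q x \<in> U}"
      by blast
    then show "S \<inter> U \<subseteq> q ` topspace X \<and> openin X {x \<in> topspace X. q x \<in> S \<inter> U}"
      using S U by (auto intro: openin_Int)
  next
    fix \<K>
    assume K: "\<forall>U\<in>\<K>. U \<subseteq> q ` topspace X \<and> openin X {x \<in> topspace X. q x \<in> U}"
    have "{x \<in> topspace X. q x \<in> \<Union>\<K>} = (\<Union>U\<in>\<K>. {x \<in> topspace X. q x \<in> U})"
      by blast
    then show "\<Union>\<K> \<subseteq> q ` topspace X \<and> openin X {x \<in> topspace X. q x \<in> \<Union>\<K>}"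
      using K by (auto intro!: openin_Union)
  qed
  then show ?thesis
    by (simp add: quotient_topology_def topology_inverse')
qed

lemma topspace_quotient_topology: "topspace (quotient_topology X q) = q ` topspace X"
proof
  show "topspace (quotient_topology X q) \<subseteq> q ` topspace X"
    using openin_quotient_topology[of X q] openin_topspace by blast
  have "{x \<in> topspace X. q x \<in> q ` topspace X} = topspace X"
    by blast
  then have "openin (quotient_topology X q) (q ` topspace X)"
    by (simp add: openin_quotient_topology)
  then show "q ` topspace X \<subseteq> topspace (quotient_topology X q)"
    by (rule openin_subset)
qed

lemma quotient_map_quotient_topology: "quotient_map X (quotient_topology X q) q"
  by (auto simp: quotient_map_def topspace_quotient_topology openin_quotient_topology)

section \<open>Smooth maps between Euclidean spaces\<close>

text \<open>For open \<open>S\<close> in a finite-dimensional space, \<open>Ck_on k S f\<close> says that \<open>f\<close> is of class \<open>C\<^sup>k\<close>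
  on \<open>S\<close>: all directional derivatives are of class \<open>C\<^sup>k\<^sup>-\<^sup>1\<close>.\<close>

primrec Ck_on :: "nat \<Rightarrow> 'a::real_normed_vector set \<Rightarrow> ('a \<Rightarrow> 'b::real_normed_vector) \<Rightarrow> bool" where
  "Ck_on 0 S f \<longleftrightarrow> continuous_on S f"
| "Ck_on (Suc k) S f \<longleftrightarrow>
     (\<forall>x\<in>S. f differentiable (at x)) \<and>
     (\<forall>v. Ck_on k S (\<lambda>x. frechet_derivative f (at x) v))"

definition smooth_on :: "'a::real_normed_vector set \<Rightarrow> ('a \<Rightarrow> 'b::real_normed_vector) \<Rightarrow> bool" where
  "smooth_on S f \<longleftrightarrow> (\<forall>k. Ck_on k S f)"

definition diffeo :: "'a::real_normed_vector set \<Rightarrow> 'b::real_normed_vector set \<Rightarrow> ('a \<Rightarrow> 'b) \<Rightarrow> bool" where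
  "diffeo V W f \<longleftrightarrow> open V \<and> open W \<and> bij_betw f V W \<and> smooth_on V f \<and> smooth_on W (inv_into V f)"

text \<open>Determinant of an endomorphism of a Euclidean space (Leibniz formula in the standard
  orthonormal basis; \<^const>\<open>det\<close> is only available for matrices).\<close>

definition endo_det :: "('v::euclidean_space \<Rightarrow> 'v) \<Rightarrow> real" where
  "endo_det L = (\<Sum>p | p permutes (Basis :: 'v set). of_int (sign p) * (\<Prod>b\<in>Basis. L b \<bullet> p b))"

section \<open>Orbifolds\<close>

text \<open>A chart \<open>(\<tilde>U, G, \<phi>)\<close>. The finite group \<open>G\<close> is a set of self-maps of \<open>\<tilde>U\<close> (so it acts
  effectively); the dimension of the orbifold is \<open>DIM('v)\<close>.\<close>

record ('v, 'x) orb_chart =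
  chart_dom :: "'v set"
  chart_grp :: "('v \<Rightarrow> 'v) set"
  chart_map :: "'v \<Rightarrow> 'x"

abbreviation chart_image :: "('v, 'x) orb_chart \<Rightarrow> 'x set" where
  "chart_image c \<equiv> chart_map c ` chart_dom c"

definition orbifold_chart :: "'x topology \<Rightarrow> ('v::euclidean_space, 'x) orb_chart \<Rightarrow> bool" where
  "orbifold_chart X c \<longleftrightarrow>
     open (chart_dom c) \<and> connected (chart_dom c) \<and>
     finite (chart_grp c) \<and> subgroup (chart_grp c) (BijGroup (chart_dom c)) \<and>
     (\<forall>g\<in>chart_grp c. smooth_on (chart_dom c) g) \<and>
     openin X (chart_image c) \<and>
     quotient_map (top_of_set (chart_dom c)) (subtopology X (chart_image c)) (chart_map c) \<and>
     (\<forall>x\<in>chart_dom c. \<forall>y\<in>chart_dom c.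
        chart_map c x = chart_map c y \<longleftrightarrow> (\<exists>g\<in>chart_grp c. g x = y))"

text \<open>\<open>f\<close> is a smooth open embedding of \<open>V\<close> covering the self-map \<open>h\<close> of the underlying space.\<close>

definition local_lift ::
  "('v::euclidean_space, 'x) orb_chart \<Rightarrow> ('v, 'x) orb_chart \<Rightarrow> 'v set \<Rightarrow> ('x \<Rightarrow> 'x) \<Rightarrow> ('v \<Rightarrow> 'v) \<Rightarrow> bool"
  where
  "local_lift c d V h f \<longleftrightarrow>
     V \<subseteq> chart_dom c \<and> f ` V \<subseteq> chart_dom d \<and> diffeo V (f ` V) f \<and>
     (\<forall>v\<in>V. chart_map d (f v) = h (chart_map c v))"

abbreviation chart_embedding ::
  "('v::euclidean_space, 'x) orb_chart \<Rightarrow> ('v, 'x) orb_chart \<Rightarrow> ('v \<Rightarrow> 'v) \<Rightarrow> bool" where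
  "chart_embedding c d \<equiv> local_lift c d (chart_dom c) id"

definition compatible_charts ::
  "'x topology \<Rightarrow> ('v::euclidean_space, 'x) orb_chart \<Rightarrow> ('v, 'x) orb_chart \<Rightarrow> bool" where
  "compatible_charts X c d \<longleftrightarrow>
     (\<forall>p \<in> chart_image c \<inter> chart_image d. \<exists>e f g.
        orbifold_chart X e \<and> p \<in> chart_image e \<and> chart_embedding e c f \<and> chart_embedding e d g)"

definition orbifold_atlas :: "'x topology \<Rightarrow> ('v::euclidean_space, 'x) orb_chart set \<Rightarrow> bool" where
  "orbifold_atlas X \<U> \<longleftrightarrow>
     (\<forall>c\<in>\<U>. orbifold_chart X c) \<and> (\<Union>c\<in>\<U>. chart_image c) = topspace X \<and>
     (\<forall>c\<in>\<U>. \<forall>d\<in>\<U>. compatible_charts X c d)"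

text \<open>The charts of the orbifold \<open>(X, \<U>)\<close>, i.e. the maximal atlas containing \<open>\<U>\<close>.\<close>

definition orbifold_charts ::
  "'x topology \<Rightarrow> ('v::euclidean_space, 'x) orb_chart set \<Rightarrow> ('v, 'x) orb_chart set" where
  "orbifold_charts X \<U> = {c. orbifold_chart X c \<and> (\<forall>d\<in>\<U>. compatible_charts X c d)}"

text \<open>An orientation is given by an atlas whose chart domains, with their standard orientation, are
  glued by orientation preserving maps. Taking \<open>c = d\<close> includes the local groups.\<close>

definition oriented_atlas :: "('v::euclidean_space, 'x) orb_chart set \<Rightarrow> bool" where
  "oriented_atlas \<U> \<longleftrightarrow>
     (\<forall>c\<in>\<U>. \<forall>d\<in>\<U>. \<forall>V f. local_lift c d V id f \<longrightarrow>
        (\<forall>x\<in>V. endo_det (frechet_derivative f (at x)) > 0))"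

definition closed_oriented_orbifold ::
  "'x topology \<Rightarrow> ('v::euclidean_space, 'x) orb_chart set \<Rightarrow> bool" where
  "closed_oriented_orbifold X \<U> \<longleftrightarrow>
     compact_space X \<and> Hausdorff_space X \<and> orbifold_atlas X \<U> \<and> oriented_atlas \<U>"

section \<open>Torus actions on orbifolds\<close>

text \<open>A smooth action lifts locally, and smoothly in the group variable, to the charts. Smoothness
  in the group variable is expressed in the coordinates \<^const>\<open>torus_exp\<close> on the torus.\<close>

definition smooth_torus_action ::
  "'x topology \<Rightarrow> ('v::euclidean_space, 'x) orb_chart set \<Rightarrow> (complex ^ 'n \<Rightarrow> 'x \<Rightarrow> 'x) \<Rightarrow> bool" where
  "smooth_torus_action X \<U> act \<longleftrightarrow>
     group_action torus_group (topspace X) act \<and>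
     continuous_map (prod_topology (top_of_set torus) X) X (\<lambda>(t, x). act t x) \<and>
     (\<forall>c\<in>orbifold_charts X \<U>. \<forall>d\<in>orbifold_charts X \<U>.
        \<forall>x\<in>chart_dom c. \<forall>y\<in>chart_dom d. \<forall>\<theta>0 :: real ^ 'n.
          act (torus_exp \<theta>0) (chart_map c x) = chart_map d y \<longrightarrow>
          (\<exists>A V f. open A \<and> \<theta>0 \<in> A \<and> open V \<and> x \<in> V \<and>
             smooth_on (A \<times> V) (\<lambda>(\<theta>, v). f \<theta> v) \<and>
             (\<forall>\<theta>\<in>A. local_lift c d V (act (torus_exp \<theta>)) (f \<theta>)) \<and>
             f \<theta>0 x = y))"

definition fixed_points :: "'x topology \<Rightarrow> (complex ^ 'n \<Rightarrow> 'x \<Rightarrow> 'x) \<Rightarrow> 'x set" where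
  "fixed_points X act = {x \<in> topspace X. \<forall>t\<in>torus. act t x = x}"

text \<open>Dimension of the orbit \<open>T\<cdot>x \<cong> T/T\<^sub>x\<close>; the subtracted term is the dimension of the Lie algebra
  of the closed subgroup \<open>T\<^sub>x\<close>.\<close>

definition orbit_dim :: "(complex ^ 'n \<Rightarrow> 'x \<Rightarrow> 'x) \<Rightarrow> 'x \<Rightarrow> nat" where
  "orbit_dim act x =
     CARD('n) - dim {v :: real ^ 'n. \<forall>s. torus_exp (s *\<^sub>R v) \<in> stabilizer torus_group act x}"

text \<open>\<open>\<alpha>\<close> is a list of tangential weights at the fixed point \<open>p\<close>, in the dual of the Lie algebra of
  \<open>T\<close>, identified with \<open>\<real>\<^sup>n\<close> by the inner product: the action of the Lie algebra on a chart around
  \<open>p\<close>, obtained by lifting the \<open>T\<close>-action, is linearised at the preimage \<open>x\<close> of \<open>p\<close>. (Equivalently,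
  it is the tangential representation of the finite covering torus of \<open>T\<close> acting on the chart;
  hence the weights are rational multiples of integral ones.) They are well defined up to order
  and sign.\<close>

definition tangential_weights ::
  "'x topology \<Rightarrow> (complex ^ 'n, 'x) orb_chart set \<Rightarrow> (complex ^ 'n \<Rightarrow> 'x \<Rightarrow> 'x) \<Rightarrow> 'x
    \<Rightarrow> (real ^ 'n) ^ 'n \<Rightarrow> bool" where
  "tangential_weights X \<U> act p \<alpha> \<longleftrightarrow>
     (\<exists>c\<in>orbifold_charts X \<U>. \<exists>x\<in>chart_dom c. \<exists>A V f L.
        chart_map c x = p \<and> open A \<and> connected A \<and> 0 \<in> A \<and> open V \<and> x \<in> V \<and>
        smooth_on (A \<times> V) (\<lambda>(\<theta>, v). f \<theta> v) \<and>
        (\<forall>\<theta>\<in>A. local_lift c c V (act (torus_exp \<theta>)) (f \<theta>)) \<and>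
        (\<forall>v\<in>V. f 0 v = v) \<and>
        linear L \<and> bij L \<and>
        (\<forall>\<theta>\<in>A. \<forall>z. frechet_derivative (f \<theta>) (at x) (L z) = L (\<chi> j. cis (\<theta> \<bullet> \<alpha> $ j) * z $ j)))"

definition torus_orbifold ::
  "'x topology \<Rightarrow> (complex ^ 'n, 'x) orb_chart set \<Rightarrow> (complex ^ 'n \<Rightarrow> 'x \<Rightarrow> 'x) \<Rightarrow> bool" where
  "torus_orbifold X \<U> act \<longleftrightarrow>
     closed_oriented_orbifold X \<U> \<and>
     smooth_torus_action X \<U> act \<and>
     finite {t \<in> torus. \<forall>x\<in>topspace X. act t x = x} \<and>
     fixed_points X act \<noteq> {} \<and> finite (fixed_points X act) \<and>
     finite (connected_components_of (subtopology X {x \<in> topspace X. orbit_dim act x = 1})) \<and>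
     (\<forall>p\<in>fixed_points X act. \<exists>\<alpha>. tangential_weights X \<U> act p \<alpha> \<and>
        (\<forall>i j. i \<noteq> j \<longrightarrow>
           (\<forall>a b :: real. a *\<^sub>R \<alpha> $ i + b *\<^sub>R \<alpha> $ j = 0 \<longrightarrow> a = 0 \<and> b = 0)))"

section \<open>Locally standard charts\<close>

text \<open>\<open>\<rho>\<close> is the action of \<open>(S\<^sup>1)\<^sup>n\<close> on \<open>\<tilde>U\<close> for which \<open>\<psi>\<close> is equivariant.\<close>

definition standard_chart ::
  "'x topology \<Rightarrow> (complex ^ 'n, 'x) orb_chart set \<Rightarrow> (complex ^ 'n \<Rightarrow> 'x \<Rightarrow> 'x)
    \<Rightarrow> (complex ^ 'n, 'x) orb_chart \<Rightarrow> (complex ^ 'n) set \<Rightarrow> (complex ^ 'n \<Rightarrow> complex ^ 'n)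
    \<Rightarrow> (complex ^ 'n \<Rightarrow> complex ^ 'n) \<Rightarrow> bool" where
  "standard_chart X \<U> act c W \<psi> \<xi> \<longleftrightarrow>
     c \<in> orbifold_charts X \<U> \<and>
     (\<forall>t\<in>torus. act t ` chart_image c \<subseteq> chart_image c) \<and>
     open W \<and> (\<forall>s\<in>torus. \<forall>w\<in>W. s * w \<in> W) \<and>
     diffeo W (chart_dom c) \<psi> \<and>
     (\<exists>\<rho>. group_action torus_group (chart_dom c) \<rho> \<and>
        (\<forall>s\<in>torus. \<forall>w\<in>W. \<psi> (s * w) = \<rho> s (\<psi> w))) \<and>
     \<xi> \<in> hom torus_group torus_group \<and> covering_space torus \<xi> torus \<and>
     torus_group\<lparr>carrier := kernel torus_group torus_group \<xi>\<rparr>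
       \<cong> (BijGroup (chart_dom c))\<lparr>carrier := chart_grp c\<rparr> \<and>
     (\<forall>s\<in>torus. \<forall>w\<in>W. chart_map c (\<psi> (s * w)) = act (\<xi> s) (chart_map c (\<psi> w)))"

section \<open>Orbit space and faces\<close>

definition orbit_space :: "'x topology \<Rightarrow> (complex ^ 'n \<Rightarrow> 'x \<Rightarrow> 'x) \<Rightarrow> 'x set topology" where
  "orbit_space X act = quotient_topology X (orbit torus_group act)"

text \<open>Corner charts of a manifold with corners \<open>Q\<close> are pairs \<open>(V, \<kappa>)\<close> of an open set \<open>V\<close> of \<open>Q\<close> and
  a map \<open>\<kappa>\<close> from \<open>V\<close> to the orthant \<open>\<real>\<^sub>\<ge>\<^sub>0\<^sup>n\<close>. The codimension of a point is the number of its
  vanishing coordinates, and a face of codimension \<open>k\<close> is the closure of a connected component of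
  the set of points of codimension \<open>k\<close>.\<close>

definition stratum :: "('q set \<times> ('q \<Rightarrow> real ^ 'n)) set \<Rightarrow> nat \<Rightarrow> 'q set" where
  "stratum \<A> k = {q. \<exists>(V, \<kappa>)\<in>\<A>. q \<in> V \<and> card {i. \<kappa> q $ i = 0} = k}"

definition faces :: "'q topology \<Rightarrow> ('q set \<times> ('q \<Rightarrow> real ^ 'n)) set \<Rightarrow> nat \<Rightarrow> 'q set set" where
  "faces Q \<A> k = (\<lambda>C. Q closure_of C) ` connected_components_of (subtopology Q (stratum \<A> k))"

abbreviation facets :: "'q topology \<Rightarrow> ('q set \<times> ('q \<Rightarrow> real ^ 'n)) set \<Rightarrow> 'q set set" where
  "facets Q \<A> \<equiv> faces Q \<A> 1"

definition rel_int_face :: "('q set \<times> ('q \<Rightarrow> real ^ 'n)) set \<Rightarrow> nat \<Rightarrow> 'q set \<Rightarrow> 'q set" where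
  "rel_int_face \<A> k F = F \<inter> stratum \<A> k"

definition face_of_point ::
  "'q topology \<Rightarrow> ('q set \<times> ('q \<Rightarrow> real ^ 'n)) set \<Rightarrow> 'q \<Rightarrow> 'q set" where
  "face_of_point Q \<A> x = (THE F. \<exists>k. F \<in> faces Q \<A> k \<and> x \<in> rel_int_face \<A> k F)"

text \<open>The corner charts which a locally standard action induces on the orbit space,
  using \<open>\<complex>\<^sup>n / (S\<^sup>1)\<^sup>n \<cong> \<real>\<^sub>\<ge>\<^sub>0\<^sup>n\<close> via \<open>w \<mapsto> (\<bar>w\<^sub>i\<bar>\<^sup>2)\<^sub>i\<close>.\<close>

definition orbit_corner_charts ::
  "'x topology \<Rightarrow> (complex ^ 'n, 'x) orb_chart set \<Rightarrow> (complex ^ 'n \<Rightarrow> 'x \<Rightarrow> 'x)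
    \<Rightarrow> ('x set set \<times> ('x set \<Rightarrow> real ^ 'n)) set" where
  "orbit_corner_charts X \<U> act =
     {(V, \<kappa>). \<exists>c W \<psi> \<xi>. standard_chart X \<U> act c W \<psi> \<xi> \<and>
        V = orbit torus_group act ` chart_image c \<and>
        (\<forall>w\<in>W. \<kappa> (orbit torus_group act (chart_map c (\<psi> w))) = (\<chi> i. (norm (w $ i))\<^sup>2))}"

abbreviation orbit_facets ::
  "'x topology \<Rightarrow> (complex ^ 'n, 'x) orb_chart set \<Rightarrow> (complex ^ 'n \<Rightarrow> 'x \<Rightarrow> 'x) \<Rightarrow> 'x set set set" where
  "orbit_facets X \<U> act \<equiv> facets (orbit_space X act) (orbit_corner_charts X \<U> act)"

section \<open>Orientations of suborbifolds\<close>

definition frame_of :: "'v::euclidean_space set \<Rightarrow> 'v list \<Rightarrow> bool" where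
  "frame_of H b \<longleftrightarrow> distinct b \<and> independent (set b) \<and> span (set b) = H"

text \<open>An orientation of a linear subspace \<open>H\<close>, as a sign for every ordered basis. Automorphisms of
  \<open>H\<close> are extended by the identity on the orthogonal complement to compute their determinant.\<close>

definition is_orientation :: "'v::euclidean_space set \<Rightarrow> ('v list \<Rightarrow> real) \<Rightarrow> bool" where
  "is_orientation H \<omega> \<longleftrightarrow>
     (\<forall>b. frame_of H b \<longrightarrow> \<omega> b \<in> {1, - 1}) \<and>
     (\<forall>b L. frame_of H b \<and> linear L \<and> L ` H = H \<and> (\<forall>v. (\<forall>h\<in>H. v \<bullet> h = 0) \<longrightarrow> L v = v) \<longrightarrow>
        \<omega> (map L b) = sgn (endo_det L) * \<omega> b)"

definition tangent_space_at :: "'v::euclidean_space set \<Rightarrow> 'v \<Rightarrow> 'v set" where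
  "tangent_space_at M x =
     {v. \<exists>\<gamma> :: real \<Rightarrow> 'v. \<gamma> 0 = x \<and> (\<forall>s. \<gamma> s \<in> M) \<and> (\<gamma> has_vector_derivative v) (at 0)}"

definition chart_preimage :: "('v, 'x) orb_chart \<Rightarrow> 'x set \<Rightarrow> 'v set" where
  "chart_preimage c Y = {x \<in> chart_dom c. chart_map c x \<in> Y}"

text \<open>An orientation of the suborbifold with underlying set \<open>Y\<close>: orientations of the tangent spaces
  of its preimages in all charts, continuous and compatible with changes of charts.\<close>

definition suborbifold_orientation ::
  "'x topology \<Rightarrow> ('v::euclidean_space, 'x) orb_chart set \<Rightarrow> 'x set
    \<Rightarrow> (('v, 'x) orb_chart \<Rightarrow> 'v \<Rightarrow> 'v list \<Rightarrow> real) \<Rightarrow> bool" where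
  "suborbifold_orientation X \<U> Y ori \<longleftrightarrow>
     (\<forall>c\<in>orbifold_charts X \<U>. \<forall>x\<in>chart_preimage c Y.
        is_orientation (tangent_space_at (chart_preimage c Y) x) (ori c x)) \<and>
     (\<forall>c\<in>orbifold_charts X \<U>. \<forall>V m. \<forall>b :: nat \<Rightarrow> 'v \<Rightarrow> 'v. open V \<and>
        (\<forall>j<m. continuous_on (chart_preimage c Y \<inter> V) (b j)) \<and>
        (\<forall>x\<in>chart_preimage c Y \<inter> V.
           frame_of (tangent_space_at (chart_preimage c Y) x) (map (\<lambda>j. b j x) [0..<m]))
        \<longrightarrow> continuous_on (chart_preimage c Y \<inter> V) (\<lambda>x. ori c x (map (\<lambda>j. b j x) [0..<m]))) \<and>
     (\<forall>c\<in>orbifold_charts X \<U>. \<forall>d\<in>orbifold_charts X \<U>. \<forall>V f. local_lift c d V id f \<longrightarrow>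
        (\<forall>x\<in>chart_preimage c Y \<inter> V. \<forall>b.
           frame_of (tangent_space_at (chart_preimage c Y) x) b \<longrightarrow>
           ori d (f x) (map (frechet_derivative f (at x)) b) = ori c x b))"

section \<open>Locally standard torus orbifolds\<close>

text \<open>The chosen orientations \<open>ori F\<close> of the suborbifolds \<open>\<pi>\<^sup>-\<^sup>1(F)\<close>, one for every facet \<open>F\<close>, are part
  of the structure.\<close>

definition locally_standard_torus_orbifold ::
  "'x topology \<Rightarrow> (complex ^ 'n, 'x) orb_chart set \<Rightarrow> (complex ^ 'n \<Rightarrow> 'x \<Rightarrow> 'x)
    \<Rightarrow> ('x set set \<Rightarrow> (complex ^ 'n, 'x) orb_chart \<Rightarrow> complex ^ 'n \<Rightarrow> (complex ^ 'n) list \<Rightarrow> real)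
    \<Rightarrow> bool" where
  "locally_standard_torus_orbifold X \<U> act ori \<longleftrightarrow>
     torus_orbifold X \<U> act \<and>
     (\<forall>p\<in>topspace X. \<exists>c W \<psi> \<xi>. standard_chart X \<U> act c W \<psi> \<xi> \<and> p \<in> chart_image c) \<and>
     (\<forall>F\<in>orbit_facets X \<U> act.
        suborbifold_orientation X \<U> {x \<in> topspace X. orbit torus_group act x \<in> F} (ori F))"

section \<open>CW complexes\<close>

definition disk_top :: "nat \<Rightarrow> (nat \<Rightarrow> real) topology" where
  "disk_top k = subtopology (Euclidean_space k) {x. (\<Sum>i<k. (x i)\<^sup>2) \<le> 1}"

text \<open>Whitehead's definition: \<open>E\<close> is the set of open cells, \<open>d e\<close> the dimension and \<open>\<Phi> e\<close> the
  characteristic map of the cell \<open>e\<close>.\<close>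

definition CW_complex :: "'a topology \<Rightarrow> bool" where
  "CW_complex Q \<longleftrightarrow>
     Hausdorff_space Q \<and>
     (\<exists>(E :: 'a set set) (d :: 'a set \<Rightarrow> nat) (\<Phi> :: 'a set \<Rightarrow> (nat \<Rightarrow> real) \<Rightarrow> 'a).
        \<Union>E = topspace Q \<and> disjoint E \<and>
        (\<forall>e\<in>E.
           continuous_map (disk_top (d e)) Q (\<Phi> e) \<and>
           homeomorphic_map (subtopology (disk_top (d e)) {x. (\<Sum>i<d e. (x i)\<^sup>2) < 1})
             (subtopology Q e) (\<Phi> e) \<and>
           (\<exists>E'. finite E' \<and> E' \<subseteq> E \<and> (\<forall>e'\<in>E'. d e' < d e) \<and>
              \<Phi> e ` {x \<in> topspace (disk_top (d e)). (\<Sum>i<d e. (x i)\<^sup>2) = 1} \<subseteq> \<Union>E')) \<and>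
        (\<forall>A\<subseteq>topspace Q. (\<forall>e\<in>E. closedin Q (A \<inter> Q closure_of e)) \<longrightarrow> closedin Q A))"

section \<open>Singular cohomology\<close>

definition cochain_group :: "nat \<Rightarrow> 'a topology \<Rightarrow> 'g monoid \<Rightarrow> ('a chain \<Rightarrow> 'g) monoid" where
  "cochain_group p X A =
     \<lparr>carrier = hom (chain_group p X) A \<inter> extensional (carrier (chain_group p X)),
      monoid.mult = (\<lambda>u v. \<lambda>c\<in>carrier (chain_group p X). u c \<otimes>\<^bsub>A\<^esub> v c),
      one = (\<lambda>c\<in>carrier (chain_group p X). \<one>\<^bsub>A\<^esub>)\<rparr>"

definition coboundary :: "nat \<Rightarrow> 'a topology \<Rightarrow> ('a chain \<Rightarrow> 'g) \<Rightarrow> ('a chain \<Rightarrow> 'g)" where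
  "coboundary p X u = (\<lambda>c\<in>carrier (chain_group (Suc p) X). u (chain_boundary (Suc p) c))"

definition cohomology_group ::
  "nat \<Rightarrow> 'a topology \<Rightarrow> 'g monoid \<Rightarrow> ('a chain \<Rightarrow> 'g) set monoid" where
  "cohomology_group p X A =
     (cochain_group p X A)
       \<lparr>carrier := kernel (cochain_group p X A) (cochain_group (Suc p) X A) (coboundary p X)\<rparr>
     Mod (if p = 0 then {\<one>\<^bsub>cochain_group p X A\<^esub>}
          else coboundary (p - 1) X ` carrier (cochain_group (p - 1) X A))"

definition int_vec_group :: "(int ^ 'n) monoid" where
  "int_vec_group = \<lparr>carrier = UNIV, monoid.mult = (+), one = 0\<rparr>"

section \<open>Characteristic functions and the quotient construction\<close>

definition characteristic_function ::
  "'q topology \<Rightarrow> ('q set \<times> ('q \<Rightarrow> real ^ 'n)) set \<Rightarrow> ('q set \<Rightarrow> int ^ 'n) \<Rightarrow> bool" where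
  "characteristic_function Q \<A> \<Lambda> \<longleftrightarrow>
     (\<forall>S. finite S \<and> S \<noteq> {} \<and> S \<subseteq> facets Q \<A> \<and> \<Inter>S \<noteq> {} \<longrightarrow>
        (\<forall>a :: 'q set \<Rightarrow> int. (\<Sum>F\<in>S. a F *s \<Lambda> F) = 0 \<longrightarrow> (\<forall>F\<in>S. a F = 0)))"

definition face_torus ::
  "'q topology \<Rightarrow> ('q set \<times> ('q \<Rightarrow> real ^ 'n)) set \<Rightarrow> ('q set \<Rightarrow> int ^ 'n) \<Rightarrow> 'q set
    \<Rightarrow> (complex ^ 'n) set" where
  "face_torus Q \<A> \<Lambda> G =
     generate torus_group (\<Union>F\<in>{F \<in> facets Q \<A>. G \<subseteq> F}. circle_subgroup (\<Lambda> F))"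

definition model_rel ::
  "'q topology \<Rightarrow> ('q set \<times> ('q \<Rightarrow> real ^ 'n)) set \<Rightarrow> ('q set \<Rightarrow> int ^ 'n)
    \<Rightarrow> (('q \<times> (complex ^ 'n)) \<times> ('q \<times> (complex ^ 'n))) set" where
  "model_rel Q \<A> \<Lambda> =
     {((x, t), (y, s)). x \<in> topspace Q \<and> y \<in> topspace Q \<and> t \<in> torus \<and> s \<in> torus \<and> x = y \<and>
        inv\<^bsub>torus_group\<^esub> t * s \<in> face_torus Q \<A> \<Lambda> (face_of_point Q \<A> x)}"

definition model_space ::
  "'q topology \<Rightarrow> ('q set \<times> ('q \<Rightarrow> real ^ 'n)) set \<Rightarrow> ('q set \<Rightarrow> int ^ 'n)
    \<Rightarrow> ('q \<times> (complex ^ 'n)) set topology" where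
  "model_space Q \<A> \<Lambda> =
     quotient_topology (prod_topology Q (top_of_set torus)) (\<lambda>z. model_rel Q \<A> \<Lambda> `` {z})"

definition model_act :: "complex ^ 'n \<Rightarrow> ('q \<times> (complex ^ 'n)) set \<Rightarrow> ('q \<times> (complex ^ 'n)) set" where
  "model_act s C = (\<lambda>(x, t). (x, s * t)) ` C"

definition model_pr1 :: "('q \<times> (complex ^ 'n)) set \<Rightarrow> 'q" where
  "model_pr1 C = the_elem (fst ` C)"

end

theory Submission
  imports Defs
begin

text \<open>A global section \<open>\<sigma>\<close> of the orbit map gives the homeomorphism \<open>[x, t] \<mapsto> t \<cdot> \<sigma> x\<close>: it is well
  defined and injective because the isotropy group of a point is the face torus of its orbit, and its
  inverse is continuous because the model is compact and \<open>X\<close> is Hausdorff.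

  Locally, sections come from the section \<open>w \<mapsto> \<bar>w\<bar>\<close> of \<open>\<complex>\<^sup>n \<rightarrow> [0, \<infinity>)\<^sup>n\<close>. Two of them differ by
  a torus valued function, which is smooth over the free orbits and extends continuously to the boundary
  by Hadamard's lemma; it is unique since the free orbits are dense. It remains to trivialise, coordinate
  by coordinate, a cocycle of circle valued functions over contractible sets. Choosing lifts of the angle
  along all singular edges, the failure on triangles is an integral \<open>2\<close>-cocycle. Since \<open>H\<^sup>2\<close> is
  trivial, it is a coboundary and the lifts can be corrected; then the angle functions, although still
  discontinuous, have real valued continuous differences, which a partition of unity splits.\<close>

section \<open>Obstruction theory for cocycles of circle valued functions\<close>

section \<open>Circle-valued functions\<close>

text \<open>Over the boundary the action is not free, but transition functions that are determined
  over the free orbits still form a cocycle, as for a principal \<open>T\<close>-bundle over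
  \<open>Q\<close>. Each coordinate belongs to a circle bundle, whose Euler class, up to sign, is
  the integral 2-cocycle. The difficulty is that the transition functions live on an open cover
  while the hypothesis concerns singular cochains. The bridge is one trivialisation along every
  singular edge, chosen with no continuity in the edge. Such a choice acts like a connection: once
  its winding around triangles vanishes, it is flat, and angles can be integrated along paths in
  contractible sets. These angles inherit the discontinuity of the choice, but all of them use the
  same choice, so it cancels in their differences.

  Smoothness is essential at the boundary: the map \<open>cis (1 / norm w) * w\<close> is an
  equivariant homeomorphism of the complex plane fixing 0, yet its phase on the positive reals has
  no limit at 0. Hadamard's lemma excludes this spinning.\<close>

lemma continuous_cis_lift:
  fixes v :: "'a::real_normed_vector \<Rightarrow> complex"
  assumes "continuous_on S v" "contractible S" "\<And>x. x \<in> S \<Longrightarrow> norm (v x) = 1"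
  obtains g :: "'a \<Rightarrow> real" where "continuous_on S g" "\<And>x. x \<in> S \<Longrightarrow> v x = cis (g x)"
proof -
  have "v z \<noteq> 0" if "z \<in> S" for z
    using assms(3)[OF that] by auto
  then obtain h where h: "continuous_on S h" "\<And>x. x \<in> S \<Longrightarrow> v x = exp (h x)"
    using continuous_logarithm_on_contractible[OF assms(1,2)] by blast
  have "v x = cis (Im (h x))" if "x \<in> S" for x
  proof -
    have "exp (Re (h x)) = 1"
      using h(2)[OF that] assms(3)[OF that] by simp
    then show ?thesis
      using h(2)[OF that] by (simp add: exp_eq_polar)
  qed
  then show ?thesis
    using that[of "\<lambda>x. Im (h x)"] h(1) by (simp add: continuous_on_Im)
qed

lemma cis_eq_cis_iff: "cis a = cis b \<longleftrightarrow> (\<exists>k::int. a - b = 2 * pi * k)"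
proof -
  have "cis a = cis b \<longleftrightarrow> cis (a - b) = 1"
    by (simp flip: cis_divide)
  also have "\<dots> \<longleftrightarrow> (\<exists>k::int. a - b = 2 * pi * k)"
    by (auto simp: complex_eq_iff cos_one_2pi_int sin_zero_iff_int2 mult_ac intro: exI[of _ "2 * _"])
  finally show ?thesis .
qed

text \<open>Two angles of the same function differ by integral multiples of 2 pi. Distinct values of
  this continuous difference are at least 2 pi apart, so it is constant on a connected set.\<close>

lemma cis_lift_unique:
  fixes g h :: "'a::topological_space \<Rightarrow> real"
  assumes "connected S" "continuous_on S g" "continuous_on S h"
    and eq: "\<And>x. x \<in> S \<Longrightarrow> cis (g x) = cis (h x)" and "x \<in> S" "y \<in> S"
  shows "g y - g x = h y - h x"
proof -
  have "(\<lambda>x. g x - h x) constant_on S"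
  proof (rule continuous_discrete_range_constant[OF \<open>connected S\<close>])
    show "continuous_on S (\<lambda>x. g x - h x)"
      using assms by (intro continuous_intros)
    fix x assume x: "x \<in> S"
    show "\<exists>e>0. \<forall>y. y \<in> S \<and> g y - h y \<noteq> g x - h x \<longrightarrow> e \<le> norm (g y - h y - (g x - h x))"
    proof (intro exI[of _ "2 * pi"] conjI allI impI)
      fix y assume y: "y \<in> S \<and> g y - h y \<noteq> g x - h x"
      obtain k l :: int where k: "g x - h x = 2 * pi * k" and l: "g y - h y = 2 * pi * l"
        using eq x y cis_eq_cis_iff by blast
      then have "k \<noteq> l" using y by auto
      then have "1 \<le> \<bar>real_of_int (l - k)\<bar>" by linarith
      then have "2 * pi * 1 \<le> 2 * pi * \<bar>real_of_int (l - k)\<bar>"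
        by (intro mult_left_mono) auto
      also have "\<dots> = norm (g y - h y - (g x - h x))"
        unfolding k l by (simp add: abs_mult flip: right_diff_distrib)
      finally show "2 * pi \<le> norm (g y - h y - (g x - h x))" by simp
    qed simp
  qed
  then show ?thesis
    using assms(5,6) unfolding constant_on_def by (metis add_diff_cancel_left' diff_add_cancel diff_diff_eq2 diff_right_commute)
qed

definition circle_path :: "(real \<Rightarrow> complex) \<Rightarrow> bool" where
  "circle_path v \<longleftrightarrow> continuous_on {0..1} v \<and> (\<forall>s\<in>{0..1}. norm (v s) = 1)"

text \<open>Not reduced modulo \<open>2\<pi>\<close>: the change of the angle along a path in the unit circle.\<close>

definition angle_change :: "(real \<Rightarrow> complex) \<Rightarrow> real" where
  "angle_change v = (THE d. \<exists>g. continuous_on {0..1} g \<and> (\<forall>s\<in>{0..1}. v s = cis (g s)) \<and> d = g 1 - g 0)"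

lemma angle_change_eqI:
  assumes "continuous_on {0..1} g" "\<And>s. s \<in> {0..1} \<Longrightarrow> v s = cis (g s)"
  shows "angle_change v = g 1 - g 0"
  unfolding angle_change_def
proof (rule the_equality)
  show "\<exists>ga. continuous_on {0..1} ga \<and> (\<forall>s\<in>{0..1}. v s = cis (ga s)) \<and> g 1 - g 0 = ga 1 - ga 0"
    using assms by blast
next
  fix d assume "\<exists>g. continuous_on {0..1} g \<and> (\<forall>s\<in>{0..1}. v s = cis (g s)) \<and> d = g 1 - g 0"
  then obtain h where h: "continuous_on {0..1} h" "\<forall>s\<in>{0..1}. v s = cis (h s)" "d = h 1 - h 0"
    by blast
  show "d = g 1 - g 0"
    unfolding h(3)
    by (rule cis_lift_unique[of "{0..1}"]) (use assms h in auto)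
qed

lemma circle_path_lift:
  assumes "circle_path v"
  obtains g where "continuous_on {0..1} g" "\<And>s. s \<in> {0..1} \<Longrightarrow> v s = cis (g s)"
    "angle_change v = g 1 - g 0"
proof -
  obtain g :: "real \<Rightarrow> real" where "continuous_on {0..1} g" "\<And>s. s \<in> {0..1} \<Longrightarrow> v s = cis (g s)"
    using continuous_cis_lift[of "{0..1::real}" v] assms
    by (auto simp: circle_path_def convex_imp_contractible)
  then show ?thesis
    using that angle_change_eqI by metis
qed

lemma circle_path_cis: "continuous_on {0..1} g \<Longrightarrow> circle_path (\<lambda>s. cis (g s))"
  by (auto simp: circle_path_def intro!: continuous_intros)

lemma angle_change_cong:
  assumes "\<And>s. s \<in> {0..1} \<Longrightarrow> u s = v s"
  shows "angle_change u = angle_change v"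
  using assms by (simp add: angle_change_def)

lemma angle_change_cis: "continuous_on {0..1} g \<Longrightarrow> angle_change (\<lambda>s. cis (g s)) = g 1 - g 0"
  by (simp add: angle_change_eqI)

lemma angle_change_mult:
  assumes "circle_path u" "circle_path v"
  shows "angle_change (\<lambda>s. u s * v s) = angle_change u + angle_change v"
proof -
  obtain g where g: "continuous_on {0..1} g" "\<And>s. s \<in> {0..1} \<Longrightarrow> u s = cis (g s)" "angle_change u = g 1 - g 0"
    using circle_path_lift[OF assms(1)] by blast
  obtain h where h: "continuous_on {0..1} h" "\<And>s. s \<in> {0..1} \<Longrightarrow> v s = cis (h s)" "angle_change v = h 1 - h 0"
    using circle_path_lift[OF assms(2)] by blast
  have "angle_change (\<lambda>s. u s * v s) = (g 1 + h 1) - (g 0 + h 0)"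
    by (rule angle_change_eqI) (use g h in \<open>auto simp: cis_mult intro!: continuous_intros\<close>)
  then show ?thesis using g h by simp
qed

lemma cis_angle_change:
  assumes "circle_path v"
  shows "cis (angle_change v) = v 1 / v 0"
  using circle_path_lift[OF assms] by (metis atLeastAtMost_iff cis_divide order_refl zero_le_one)

lemma continuous_map_locally:
  assumes "\<And>x. x \<in> topspace X \<Longrightarrow> \<exists>T. openin X T \<and> x \<in> T \<and> continuous_map (subtopology X T) Y g"
  shows "continuous_map X Y g"
  by (rule pasting_lemma[where I = "{T. openin X T \<and> continuous_map (subtopology X T) Y g}"
        and T = id and f = "\<lambda>_. g"]) (use assms in auto)

section \<open>Trivialisations of circle cocycles\<close>

text \<open>A cocycle of transition functions is given as the quotients of a family of (discontinuous)
  functions \<open>\<theta> i\<close>. A trivialisation over \<open>f\<close> is then a single function \<open>w\<close> which makes all the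
  products with the \<open>\<theta> i\<close> continuous.\<close>

locale circle_cocycle =
  fixes Q :: "'q topology" and I :: "'i set" and U :: "'i \<Rightarrow> 'q set" and \<theta> :: "'i \<Rightarrow> 'q \<Rightarrow> complex"
  assumes openin_U: "i \<in> I \<Longrightarrow> openin Q (U i)"
    and U_cover: "topspace Q \<subseteq> (\<Union>i\<in>I. U i)"
    and norm_\<theta>: "i \<in> I \<Longrightarrow> q \<in> U i \<Longrightarrow> norm (\<theta> i q) = 1"
    and continuous_quotient: "i \<in> I \<Longrightarrow> j \<in> I \<Longrightarrow>
          continuous_map (subtopology Q (U i \<inter> U j)) euclidean (\<lambda>q. \<theta> i q / \<theta> j q)"
begin

definition triv :: "'a::euclidean_space set \<Rightarrow> ('a \<Rightarrow> 'q) \<Rightarrow> ('a \<Rightarrow> complex) \<Rightarrow> bool" where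
  "triv K f w \<longleftrightarrow> (\<forall>x\<in>K. norm (w x) = 1) \<and>
     (\<forall>i\<in>I. continuous_on {x \<in> K. f x \<in> U i} (\<lambda>x. w x * \<theta> i (f x)))"

lemma triv_compose:
  assumes "triv K f w" "continuous_on K' g" "g ` K' \<subseteq> K"
  shows "triv K' (\<lambda>x. f (g x)) (\<lambda>x. w (g x))"
proof -
  have "continuous_on {x \<in> K'. f (g x) \<in> U i} (\<lambda>x. w (g x) * \<theta> i (f (g x)))" if "i \<in> I" for i
  proof (rule continuous_on_compose2[where f = g and s = "{x \<in> K'. f (g x) \<in> U i}"])
    show "continuous_on {x \<in> K. f x \<in> U i} (\<lambda>x. w x * \<theta> i (f x))"
      using assms(1) that by (simp add: triv_def)
  qed (use assms in \<open>auto intro: continuous_on_subset\<close>)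
  then show ?thesis
    using assms unfolding triv_def by auto
qed

lemma triv_subset: "triv K f w \<Longrightarrow> K' \<subseteq> K \<Longrightarrow> triv K' f w"
  using triv_compose[of K f w K' "\<lambda>x. x"] by auto

lemma triv_cong:
  assumes "\<And>x. x \<in> K \<Longrightarrow> f x = f' x" "\<And>x. x \<in> K \<Longrightarrow> w x = w' x"
  shows "triv K f w \<longleftrightarrow> triv K f' w'"
proof -
  have "{x \<in> K. f x \<in> U i} = {x \<in> K. f' x \<in> U i}" for i
    using assms by auto
  moreover have "continuous_on {x \<in> K. f' x \<in> U i} (\<lambda>x. w x * \<theta> i (f x)) \<longleftrightarrow>
      continuous_on {x \<in> K. f' x \<in> U i} (\<lambda>x. w' x * \<theta> i (f' x))" for i
    by (rule continuous_on_cong) (use assms in auto)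
  ultimately show ?thesis
    using assms(2) unfolding triv_def by simp
qed

lemma triv_mult:
  assumes "triv K f w" "continuous_on K z" "\<And>x. x \<in> K \<Longrightarrow> norm (z x) = 1"
  shows "triv K f (\<lambda>x. z x * w x)"
proof -
  have "continuous_on {x \<in> K. f x \<in> U i} (\<lambda>x. z x * (w x * \<theta> i (f x)))" if "i \<in> I" for i
  proof (rule continuous_on_mult)
    show "continuous_on {x \<in> K. f x \<in> U i} z"
      by (rule continuous_on_subset[OF assms(2)]) auto
  qed (use assms that in \<open>auto simp: triv_def\<close>)
  then show ?thesis
    using assms by (auto simp: triv_def norm_mult mult.assoc)
qed

lemma openin_triv_piece:
  assumes "continuous_map (top_of_set K) Q f" "i \<in> I"
  shows "openin (top_of_set K) {x \<in> K. f x \<in> U i}"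
  using openin_continuous_map_preimage[OF assms(1) openin_U[OF assms(2)]] by simp

text \<open>Near a point both trivialisations may be multiplied by the same
  \<open>\<theta> i (f x)\<close>. The products are continuous, and the discontinuous factor cancels
  in the quotient.\<close>

lemma triv_divide_continuous:
  assumes f: "continuous_map (top_of_set K) Q f" and w: "triv K f w" "triv K f w'"
  shows "continuous_on K (\<lambda>x. w x / w' x)"
proof -
  have "continuous_map (top_of_set K) euclidean (\<lambda>x. w x / w' x)"
  proof (rule continuous_map_locally)
    fix x assume "x \<in> topspace (top_of_set K)"
    then have x: "x \<in> K" "f x \<in> topspace Q"
      using f by (auto simp: continuous_map_def)
    then obtain i where i: "i \<in> I" "f x \<in> U i"
      using U_cover by auto
    let ?T = "{x \<in> K. f x \<in> U i}"
    have nz: "w' y \<noteq> 0" "\<theta> i (f y) \<noteq> 0" if "y \<in> ?T" for y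
      using that w(2) norm_\<theta>[OF i(1), of "f y"] by (auto simp: triv_def)
    have "continuous_on ?T (\<lambda>x. (w x * \<theta> i (f x)) / (w' x * \<theta> i (f x)))"
      using w i nz by (intro continuous_on_divide) (auto simp: triv_def)
    then have "continuous_on ?T (\<lambda>x. w x / w' x)"
      by (rule continuous_on_eq) (use nz in auto)
    moreover have "subtopology (top_of_set K) ?T = top_of_set ?T"
      by (simp add: subtopology_subtopology Collect_conj_eq inf_assoc)
    ultimately show "\<exists>T. openin (top_of_set K) T \<and> x \<in> T \<and>
        continuous_map (subtopology (top_of_set K) T) euclidean (\<lambda>x. w x / w' x)"
      using openin_triv_piece[OF f i(1)] x i(2) by (intro exI[of _ ?T]) auto
  qed
  then show ?thesis by simp
qed

text \<open>Multiplying \<open>1 / \<theta> j\<close> by \<open>\<theta> i\<close> gives a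
  transition function, which is continuous.\<close>

lemma triv_local:
  assumes f: "continuous_map (top_of_set K) Q f" and "f ` K \<subseteq> U j" "j \<in> I"
  shows "triv K f (\<lambda>x. 1 / \<theta> j (f x))"
  unfolding triv_def
proof (intro conjI ballI)
  fix x assume "x \<in> K"
  then show "norm (1 / \<theta> j (f x)) = 1"
    using norm_\<theta>[OF assms(3), of "f x"] assms(2) by (auto simp: norm_divide)
next
  fix i assume i: "i \<in> I"
  let ?T = "{x \<in> K. f x \<in> U i}"
  have "continuous_map (top_of_set ?T) (subtopology Q (U i \<inter> U j)) f"
    using continuous_map_from_subtopology[OF f, of ?T] assms
    by (auto simp: continuous_map_in_subtopology subtopology_subtopology image_subset_iff Int_absorb1)
  from continuous_map_compose[OF this continuous_quotient[OF i assms(3)]]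
  show "continuous_on ?T (\<lambda>x. 1 / \<theta> j (f x) * \<theta> i (f x))"
    by (simp add: o_def)
qed

text \<open>On the intersection the two trivialisations differ by a continuous circle valued factor.
  Since \<open>A \<inter> B\<close> is closed and convex, the nearest point map retracts the whole
  space onto it and extends this factor, by which \<open>v\<close> is then corrected.\<close>

lemma triv_glue:
  fixes A B :: "'a::euclidean_space set"
  assumes "closed A" "closed B" "convex (A \<inter> B)" "continuous_map (top_of_set (A \<union> B)) Q f"
    and u: "triv A f u" and v: "triv B f v"
  shows "\<exists>w. triv (A \<union> B) f w"
proof -
  define r where "r = closest_point (A \<inter> B)"
  define c where "c x = (if A \<inter> B = {} then 1 else u (r x) / v (r x))" for x
  have f: "continuous_map (top_of_set (A \<inter> B)) Q f"
    using continuous_map_from_subtopology_mono[OF assms(4), of "A \<inter> B"] by blast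
  have rin: "r x \<in> A \<inter> B" if "A \<inter> B \<noteq> {}" for x
    using closest_point_in_set that assms(1,2) closed_Int unfolding r_def by blast
  have ccont: "continuous_on S c" for S
  proof (cases "A \<inter> B = {}")
    case False
    have "continuous_on (A \<inter> B) (\<lambda>x. u x / v x)"
      by (rule triv_divide_continuous[OF f]) (use triv_subset[OF u] triv_subset[OF v] in auto)
    moreover have "continuous_on S r"
      unfolding r_def using assms(1-3) False by (intro continuous_on_closest_point) auto
    ultimately have "continuous_on S (\<lambda>x. u (r x) / v (r x))"
      using rin[OF False] by (rule_tac continuous_on_compose2) auto
    then show ?thesis
      using False by (simp add: c_def[abs_def])
  qed (simp add: c_def[abs_def])
  have cnorm: "norm (c x) = 1" for x
    using rin[of x] u v by (auto simp: c_def triv_def norm_divide)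
  have ceq: "u x = c x * v x" if "x \<in> A \<inter> B" for x
  proof -
    have "r x = x" unfolding r_def using that by (rule closest_point_self)
    moreover have "v x \<noteq> 0" using that v by (auto simp: triv_def)
    ultimately show ?thesis using that by (auto simp: c_def)
  qed
  have v': "triv B f (\<lambda>x. c x * v x)"
    by (rule triv_mult[OF v ccont cnorm])
  have "triv (A \<union> B) f (\<lambda>x. if x \<in> A then u x else c x * v x)"
    unfolding triv_def
  proof (intro conjI ballI)
    fix x assume "x \<in> A \<union> B"
    then show "norm (if x \<in> A then u x else c x * v x) = 1"
      using u v' by (auto simp: triv_def)
  next
    fix i assume i: "i \<in> I"
    let ?A = "{x \<in> A. f x \<in> U i}" and ?B = "{x \<in> B. f x \<in> U i}"
    have eq: "{x \<in> A \<union> B. f x \<in> U i} = ?A \<union> ?B" by auto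
    have "closedin (top_of_set (?A \<union> ?B)) ?A" "closedin (top_of_set (?A \<union> ?B)) ?B"
      unfolding closedin_closed using assms(1,2)
      by blast+
    then have "continuous_on (?A \<union> ?B)
        (\<lambda>x. if x \<in> A then u x * \<theta> i (f x) else (c x * v x) * \<theta> i (f x))"
      by (rule continuous_on_cases_local) (use u v' i ceq in \<open>auto simp: triv_def\<close>)
    then show "continuous_on {x \<in> A \<union> B. f x \<in> U i}
        (\<lambda>x. (if x \<in> A then u x else c x * v x) * \<theta> i (f x))"
      unfolding eq by (rule continuous_on_eq) auto
  qed
  then show ?thesis by blast
qed

text \<open>Subdivision: slabs in one coordinate direction after the other are glued together.\<close>

lemma triv_exists:
  fixes K :: "'a::euclidean_space set"
  assumes K: "compact K" "convex K" and f: "continuous_map (top_of_set K) Q f"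
  shows "\<exists>w. triv K f w"
proof -
  define \<G> where "\<G> = {G. open G \<and> (\<exists>i\<in>I. \<forall>x\<in>K \<inter> G. f x \<in> U i)}"
  have cov: "K \<subseteq> \<Union>\<G>"
  proof
    fix x assume x: "x \<in> K"
    then have "f x \<in> topspace Q" using f by (auto simp: continuous_map_def)
    then obtain i where i: "i \<in> I" "f x \<in> U i" using U_cover by auto
    obtain G where G: "open G" "{x \<in> K. f x \<in> U i} = K \<inter> G"
      using openin_triv_piece[OF f i(1)] unfolding openin_open by blast
    then have "G \<in> \<G>" using i by (auto simp: \<G>_def)
    moreover have "x \<in> G" using G x i by auto
    ultimately show "x \<in> \<Union>\<G>" by blast
  qed
  obtain e where e: "0 < e" "\<And>x. x \<in> K \<Longrightarrow> \<exists>G\<in>\<G>. ball x e \<subseteq> G"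
    using Heine_Borel_lemma[OF K(1) cov] by (auto simp: \<G>_def)
  \<comment> \<open>If all coordinates vary by at most \<open>\<epsilon>\<close> on a set, two of
    its points are at most \<open>e / 2\<close> apart in the sum norm, so the set lies in one
    Lebesgue ball.\<close>
  define \<epsilon> where "\<epsilon> = e / (2 * real DIM('a))"
  have \<epsilon>: "\<epsilon> > 0" using e by (simp add: \<epsilon>_def)
  \<comment> \<open>Induction on the set \<open>S\<close> of directions in which \<open>C\<close>
    may still be wide; in all other directions its extent is at most
    \<open>\<epsilon>\<close>.\<close>
  have main: "\<exists>w. triv (K \<inter> C) f w"
    if "finite S" "S \<subseteq> Basis" "closed C" "convex C"
      "\<forall>b\<in>Basis - S. \<forall>x\<in>C. \<forall>y\<in>C. \<bar>x \<bullet> b - y \<bullet> b\<bar> \<le> \<epsilon>" for S C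
    using that
  proof (induction S arbitrary: C rule: finite_induct)
    case empty
    show ?case
    proof (cases "K \<inter> C = {}")
      case True
      then show ?thesis by (simp add: triv_def)
    next
      case False
      then obtain x where x: "x \<in> K" "x \<in> C" by blast
      have "C \<subseteq> ball x e"
      proof
        fix y assume y: "y \<in> C"
        have "norm (x - y) \<le> (\<Sum>b\<in>Basis. \<bar>(x - y) \<bullet> b\<bar>)" by (rule norm_le_l1)
        also have "\<dots> \<le> (\<Sum>b\<in>(Basis :: 'a set). \<epsilon>)"
          using empty x y by (intro sum_mono) (auto simp: inner_diff_left)
        also have "\<dots> < e" using e by (simp add: \<epsilon>_def)
        finally show "y \<in> ball x e" by (simp add: dist_norm)
      qed
      with e(2)[OF x(1)] obtain G where "G \<in> \<G>" "C \<subseteq> G" by blast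
      then obtain i where "i \<in> I" "f ` (K \<inter> C) \<subseteq> U i" by (auto simp: \<G>_def)
      then show ?thesis
        using triv_local[OF continuous_map_from_subtopology_mono[OF f]] by blast
    qed
  next
    case (insert b S)
    obtain M where M: "\<And>x. x \<in> K \<Longrightarrow> norm x \<le> M" "M > 0"
      using compact_imp_bounded[OF K(1)] unfolding bounded_pos by blast
    define sl where "sl c d = C \<inter> {x. c \<le> x \<bullet> b} \<inter> {x. x \<bullet> b \<le> d}" for c d
    have clo: "closed (sl c d)" "convex (sl c d)" for c d
    proof -
      have *: "closed {x. c \<le> x \<bullet> b}" "closed {x. x \<bullet> b \<le> d}"
        using closed_halfspace_ge[of c b] closed_halfspace_le[of b d] by (simp_all add: inner_commute)
      have **: "convex {x. c \<le> x \<bullet> b}" "convex {x. x \<bullet> b \<le> d}"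
        using convex_halfspace_ge[of c b] convex_halfspace_le[of b d] by (simp_all add: inner_commute)
      show "closed (sl c d)" "convex (sl c d)"
        unfolding sl_def using insert.prems * ** by (auto intro!: closed_Int convex_Int)
    qed
    have "- M \<le> M" using M by simp
    \<comment> \<open>Bisection in the direction \<open>b\<close>: solvability passes from two
      adjacent slabs to their union, as they meet in a convex slice, and it holds on slabs thinner
      than \<open>\<epsilon>\<close> by the induction hypothesis.\<close>
    then have "\<exists>w. triv (K \<inter> sl (- M) M) f w"
    proof (induction rule: Bolzano)
      case (trans c d d')
      have eq: "K \<inter> sl c d' = (K \<inter> sl c d) \<union> (K \<inter> sl d d')"
        using trans by (auto simp: sl_def)
      have eq2: "(K \<inter> sl c d) \<inter> (K \<inter> sl d d') = K \<inter> sl d d"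
        using trans by (auto simp: sl_def)
      have "\<exists>w. triv ((K \<inter> sl c d) \<union> (K \<inter> sl d d')) f w"
      proof -
        obtain u v where "triv (K \<inter> sl c d) f u" "triv (K \<inter> sl d d') f v" using trans by blast
        moreover have "convex ((K \<inter> sl c d) \<inter> (K \<inter> sl d d'))"
          unfolding eq2 using K clo by (auto intro: convex_Int)
        moreover have "continuous_map (top_of_set ((K \<inter> sl c d) \<union> (K \<inter> sl d d'))) Q f"
          by (rule continuous_map_from_subtopology_mono[OF f]) auto
        ultimately show ?thesis
          using K clo by (intro triv_glue) (auto intro: compact_imp_closed)
      qed
      then show ?case unfolding eq .
    next
      case (local x)
      have "\<exists>w. triv (K \<inter> sl c d) f w" if "d - c < \<epsilon>" for c d
      proof (rule insert.IH)
        show "\<forall>b'\<in>Basis - S. \<forall>x\<in>sl c d. \<forall>y\<in>sl c d. \<bar>x \<bullet> b' - y \<bullet> b'\<bar> \<le> \<epsilon>"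
        proof (intro ballI)
          fix b' x y assume b': "b' \<in> Basis - S" and xy: "x \<in> sl c d" "y \<in> sl c d"
          show "\<bar>x \<bullet> b' - y \<bullet> b'\<bar> \<le> \<epsilon>"
          proof (cases "b' = b")
            case True
            then show ?thesis using xy that by (auto simp: sl_def)
          next
            case False
            then show ?thesis using insert.prems b' xy by (auto simp: sl_def)
          qed
        qed
      qed (use insert.prems clo in auto)
      then show ?case using \<epsilon> by blast
    qed
    moreover have "K \<inter> sl (- M) M = K \<inter> C"
    proof -
      have "- M \<le> x \<bullet> b \<and> x \<bullet> b \<le> M" if "x \<in> K" for x
        using Basis_le_norm[of b x] M(1)[OF that] insert.prems(1) by auto
      then show ?thesis by (auto simp: sl_def)
    qed
    ultimately show ?case by simp
  qed
  show ?thesis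
    using main[of Basis UNIV] by auto
qed

end

section \<open>Vanishing of the second singular cohomology\<close>

lemma simplical_face_commute:
  "i < j \<Longrightarrow> simplical_face j (simplical_face i x) = simplical_face i (simplical_face (j - 1) x)"
  by (auto simp: simplical_face_def fun_eq_iff)

text \<open>The simplicial identity behind the vanishing of the double boundary; it is used to
  identify the common edge of two faces of a tetrahedron.\<close>

lemma singular_face_commute:
  assumes "singular_simplex (Suc (Suc p)) X f" "i < j" "j \<le> Suc (Suc p)"
  shows "singular_face (Suc p) i (singular_face (Suc (Suc p)) j f) =
         singular_face (Suc p) (j - 1) (singular_face (Suc (Suc p)) i f)"
proof
  fix x
  have "f (simplical_face j (simplical_face i x)) = f (simplical_face i (simplical_face (j - 1) x))"
    using assms(2) by (simp add: simplical_face_commute)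
  moreover have "simplical_face i x \<in> standard_simplex (Suc p)"
    "simplical_face (j - 1) x \<in> standard_simplex (Suc p)" if "x \<in> standard_simplex p"
    using simplical_face_in_standard_simplex[of "Suc p"] assms that by auto
  ultimately show "singular_face (Suc p) i (singular_face (Suc (Suc p)) j f) x =
        singular_face (Suc p) (j - 1) (singular_face (Suc (Suc p)) i f) x"
    by (simp add: singular_face_def restrict_def)
qed

lemma comm_group_int_vec_group: "comm_group int_vec_group"
proof (rule comm_groupI)
  fix x :: "int ^ 'n" assume "x \<in> carrier int_vec_group"
  show "\<exists>y\<in>carrier int_vec_group. y \<otimes>\<^bsub>int_vec_group\<^esub> x = \<one>\<^bsub>int_vec_group\<^esub>"
    by (rule bexI[of _ "- x"]) (auto simp: int_vec_group_def)
qed (auto simp: int_vec_group_def)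

lemma int_vec_hom_add:
  assumes "h \<in> hom (chain_group p X) int_vec_group" "singular_chain p X a" "singular_chain p X b"
  shows "h (a + b) = h a + h b"
  using hom_mult[OF assms(1), of a b] assms(2,3) by (simp add: int_vec_group_def)

lemma int_vec_hom_0:
  assumes "h \<in> hom (chain_group p X) int_vec_group"
  shows "h 0 = 0"
  using int_vec_hom_add[OF assms, of 0 0] by simp

lemma int_vec_hom_minus:
  assumes "h \<in> hom (chain_group p X) int_vec_group" "singular_chain p X a"
  shows "h (- a) = - h a"
  using int_vec_hom_add[OF assms, of "- a"] assms int_vec_hom_0[OF assms(1)]
  by (simp add: singular_chain_minus eq_neg_iff_add_eq_0 add.commute)

lemma int_vec_hom_diff:
  assumes "h \<in> hom (chain_group p X) int_vec_group" "singular_chain p X a" "singular_chain p X b"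
  shows "h (a - b) = h a - h b"
  using int_vec_hom_add[OF assms(1,2), of "- b"] int_vec_hom_minus[OF assms(1,3)] assms(3)
  by (simp add: singular_chain_minus)

lemma int_vec_hom_boundary_3:
  assumes h: "h \<in> hom (chain_group 2 X) int_vec_group" and s: "singular_simplex 3 X s"
  shows "h (chain_boundary 3 (frag_of s)) =
    h (frag_of (singular_face 3 0 s)) - h (frag_of (singular_face 3 1 s)) +
    h (frag_of (singular_face 3 2 s)) - h (frag_of (singular_face 3 3 s))"
proof -
  have "singular_chain 2 X (frag_of (singular_face 3 k s))" if "k \<le> 3" for k
    using singular_simplex_singular_face[OF s, of k] that by (simp add: singular_chain_of)
  then have "singular_chain 2 X (frag_of (singular_face 3 k s))" if "k \<in> {0,1,2,3}" for k
    using that by auto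
  note ch = this[of 0] this[of 1] this[of 2] this[of 3]
  have "{..3} = {0, 1, 2, 3::nat}" by auto
  then have eq: "chain_boundary 3 (frag_of s) = frag_of (singular_face 3 0 s) + (- frag_of (singular_face 3 1 s)
       + (frag_of (singular_face 3 2 s) + (- frag_of (singular_face 3 3 s))))"
    by (simp add: chain_boundary_of)
  then show ?thesis
    unfolding eq using ch
    by (simp add: int_vec_hom_add[OF h] int_vec_hom_minus[OF h] int_vec_hom_diff[OF h]
        singular_chain_minus singular_chain_add singular_chain_diff)
qed

lemma int_vec_hom_boundary_2:
  assumes h: "h \<in> hom (chain_group 1 X) int_vec_group" and s: "singular_simplex 2 X s"
  shows "h (chain_boundary 2 (frag_of s)) =
    h (frag_of (singular_face 2 0 s)) - h (frag_of (singular_face 2 1 s)) + h (frag_of (singular_face 2 2 s))"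
proof -
  have "singular_chain 1 X (frag_of (singular_face 2 k s))" if "k \<le> 2" for k
    using singular_simplex_singular_face[OF s, of k] that by (simp add: singular_chain_of)
  then have "singular_chain 1 X (frag_of (singular_face 2 k s))" if "k \<in> {0,1,2}" for k
    using that by auto
  note ch = this[of 0] this[of 1] this[of 2]
  have "{..2} = {0, 1, 2::nat}" by auto
  then have eq: "chain_boundary 2 (frag_of s) = frag_of (singular_face 2 0 s) + (- frag_of (singular_face 2 1 s)
       + frag_of (singular_face 2 2 s))"
    by (simp add: chain_boundary_of)
  then show ?thesis
    unfolding eq using ch
    by (simp add: int_vec_hom_add[OF h] int_vec_hom_minus[OF h] int_vec_hom_diff[OF h]
        singular_chain_minus singular_chain_add singular_chain_diff)
qed

lemma group_cochain_group:
  fixes X :: "'q topology" and A :: "'g monoid"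
  assumes "comm_group A"
  shows "group (cochain_group p X A)"
proof -
  interpret A: comm_group A by fact
  let ?C = "carrier (chain_group p X)"
  have grp: "group (chain_group p X)" by (simp add: chain_group_def)
  have ext: "u = v" if "u \<in> extensional ?C" "v \<in> extensional ?C" "\<And>c. c \<in> ?C \<Longrightarrow> u c = v c" for u v :: "'q chain \<Rightarrow> 'g"
    using that extensionalityI by metis
  have car: "u c \<in> carrier A" if "u \<in> hom (chain_group p X) A" "singular_chain p X c" for u c
    using that by (auto simp: hom_def Pi_iff)
  show ?thesis
  proof (rule groupI)
    fix u v assume "u \<in> carrier (cochain_group p X A)" "v \<in> carrier (cochain_group p X A)"
    then show "u \<otimes>\<^bsub>cochain_group p X A\<^esub> v \<in> carrier (cochain_group p X A)"
      by (auto simp: cochain_group_def hom_def Pi_iff singular_chain_add A.m_ac)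
  next
    show "\<one>\<^bsub>cochain_group p X A\<^esub> \<in> carrier (cochain_group p X A)"
      by (auto simp: cochain_group_def hom_def singular_chain_add)
  next
    fix u v w assume "u \<in> carrier (cochain_group p X A)" "v \<in> carrier (cochain_group p X A)"
      "w \<in> carrier (cochain_group p X A)"
    then show "u \<otimes>\<^bsub>cochain_group p X A\<^esub> v \<otimes>\<^bsub>cochain_group p X A\<^esub> w =
      u \<otimes>\<^bsub>cochain_group p X A\<^esub> (v \<otimes>\<^bsub>cochain_group p X A\<^esub> w)"
      by (auto simp: cochain_group_def fun_eq_iff restrict_def A.m_assoc car)
  next
    fix u assume "u \<in> carrier (cochain_group p X A)"
    then show "\<one>\<^bsub>cochain_group p X A\<^esub> \<otimes>\<^bsub>cochain_group p X A\<^esub> u = u"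
      by (intro ext) (auto simp: cochain_group_def car)
  next
    fix u assume "u \<in> carrier (cochain_group p X A)"
    then show "\<exists>v\<in>carrier (cochain_group p X A). v \<otimes>\<^bsub>cochain_group p X A\<^esub> u = \<one>\<^bsub>cochain_group p X A\<^esub>"
      by (intro bexI[of _ "\<lambda>c\<in>?C. inv\<^bsub>A\<^esub> u c"])
        (auto simp: cochain_group_def hom_def Pi_iff singular_chain_add A.inv_mult fun_eq_iff restrict_def extensional_def)
  qed
qed

text \<open>A scalar cocycle is spread over all coordinates of \<open>\<int>\<^sup>n\<close>, and a single coordinate of the
  resulting cochain is kept.\<close>

lemma cocycle_is_coboundary:
  fixes Q :: "'q topology" and c :: "((nat \<Rightarrow> real) \<Rightarrow> 'q) \<Rightarrow> int"
  assumes triv: "trivial_group (cohomology_group 2 Q (int_vec_group :: (int ^ 'n) monoid))"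
    and cocycle: "\<And>s. singular_simplex 3 Q s \<Longrightarrow>
       c (singular_face 3 0 s) - c (singular_face 3 1 s) + c (singular_face 3 2 s) - c (singular_face 3 3 s) = 0"
  shows "\<exists>b. \<forall>s. singular_simplex 2 Q s \<longrightarrow>
       c s = b (singular_face 2 0 s) - b (singular_face 2 1 s) + b (singular_face 2 2 s)"
proof -
  let ?A = "int_vec_group :: (int ^ 'n) monoid"
  interpret A: comm_group ?A by (rule comm_group_int_vec_group)
  interpret C: group "cochain_group 2 Q ?A" by (rule group_cochain_group[OF A.comm_group_axioms])
  obtain h where h: "h \<in> hom (chain_group 2 Q) ?A"
    and h_of: "\<And>s. singular_simplex 2 Q s \<Longrightarrow> h (frag_of s) = (\<chi> i. c s)"
    using A.free_Abelian_group_universal[of "\<lambda>s. \<chi> i. c s" "singular_simplex_set 2 Q"]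
    by (auto simp: chain_group_def int_vec_group_def)
  define u where "u = restrict h (carrier (chain_group 2 Q))"
  have u: "u \<in> carrier (cochain_group 2 Q ?A)"
    using h by (auto simp: u_def cochain_group_def hom_def Pi_iff singular_chain_add)
  have bd: "singular_chain 2 Q (chain_boundary 3 x)" if "singular_chain 3 Q x" for x
    using singular_chain_boundary[OF that] by simp
  \<comment> \<open>The cocycle condition is given on simplices only; these generate the free
    abelian group of chains, and the boundary and \<open>h\<close> are additive.\<close>
  have zero: "h (chain_boundary 3 x) = 0" if "singular_chain 3 Q x" for x
  proof (rule free_Abelian_group_induct[OF that[unfolded singular_chain_def]])
    show "h (chain_boundary 3 0) = 0" by (simp add: int_vec_hom_0[OF h])
  next
    fix x y :: "'q chain"
    assume 2: "Poly_Mapping.keys x \<subseteq> singular_simplex_set 3 Q" "Poly_Mapping.keys y \<subseteq> singular_simplex_set 3 Q"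
      "h (chain_boundary 3 x) = 0" "h (chain_boundary 3 y) = 0"
    then have "singular_chain 2 Q (chain_boundary 3 x)" "singular_chain 2 Q (chain_boundary 3 y)"
      using bd by (auto simp: singular_chain_def)
    then show "h (chain_boundary 3 (x - y)) = 0"
      using 2 int_vec_hom_add[OF h, of "chain_boundary 3 x" "- chain_boundary 3 y"] int_vec_hom_minus[OF h]
      by (simp add: chain_boundary_diff singular_chain_minus)
  next
    fix s assume "s \<in> singular_simplex_set 3 Q"
    then have s: "singular_simplex 3 Q s" by simp
    have "singular_simplex 2 Q (singular_face 3 k s)" if "k \<le> 3" for k
      using singular_simplex_singular_face[OF s, of k] that by simp
    then show "h (chain_boundary 3 (frag_of s)) = 0"
      using cocycle[OF s] by (simp add: int_vec_hom_boundary_3[OF h s] h_of vec_eq_iff)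
  qed
  have "u \<in> kernel (cochain_group 2 Q ?A) (cochain_group (Suc 2) Q ?A) (coboundary 2 Q)"
    using u zero bd
    by (auto simp: kernel_def coboundary_def cochain_group_def u_def int_vec_group_def fun_eq_iff restrict_def
        numeral_3_eq_3[symmetric])
  moreover define K where "K = (cochain_group 2 Q ?A)
       \<lparr>carrier := kernel (cochain_group 2 Q ?A) (cochain_group (Suc 2) Q ?A) (coboundary 2 Q)\<rparr>"
  moreover define B where "B = coboundary 1 Q ` carrier (cochain_group 1 Q ?A)"
  ultimately have uK: "u \<in> carrier K" by simp
  have "trivial_group (K Mod B)"
    using triv by (simp add: cohomology_group_def K_def B_def)
  moreover have "B #>\<^bsub>K\<^esub> u \<in> carrier (K Mod B)"
    using uK by (auto simp: FactGroup_def RCOSETS_def)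
  \<comment> \<open>In the trivial quotient the coset of \<open>u\<close> is \<open>B\<close>
    itself. As \<open>B\<close> contains the neutral cochain, the coset contains \<open>u\<close>,
    so \<open>u\<close> is a coboundary.\<close>
  ultimately have "B #>\<^bsub>K\<^esub> u = B"
    by (auto simp: trivial_group_def FactGroup_def)
  moreover have "\<one>\<^bsub>cochain_group 2 Q ?A\<^esub> \<in> B"
  proof -
    have "(\<lambda>c\<in>carrier (chain_group 1 Q). \<one>\<^bsub>?A\<^esub>) \<in> carrier (cochain_group 1 Q ?A)"
      by (auto simp: cochain_group_def hom_def singular_chain_add)
    moreover have "coboundary 1 Q (\<lambda>c\<in>carrier (chain_group 1 Q). \<one>\<^bsub>?A\<^esub>) = \<one>\<^bsub>cochain_group 2 Q ?A\<^esub>"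
      using singular_chain_boundary[of 2 Q]
      by (auto simp: coboundary_def cochain_group_def fun_eq_iff restrict_def numeral_2_eq_2)
    ultimately show ?thesis unfolding B_def by (metis imageI)
  qed
  ultimately have "\<one>\<^bsub>cochain_group 2 Q ?A\<^esub> \<otimes>\<^bsub>cochain_group 2 Q ?A\<^esub> u \<in> B"
    unfolding r_coset_def K_def by auto
  then have "u \<in> B"
    using u C.l_one by metis
  then obtain v where v: "v \<in> hom (chain_group 1 Q) ?A" and uv: "u = coboundary 1 Q v"
    by (auto simp: B_def cochain_group_def)
  show ?thesis
  \<comment> \<open>Here \<open>undefined\<close> is merely some coordinate: all coordinates of
    \<open>h (frag_of s)\<close> are equal to \<open>c s\<close>.\<close>
  proof (intro exI[of _ "\<lambda>s. v (frag_of s) $ undefined"] allI impI)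
    fix s assume s: "singular_simplex 2 Q s"
    have "c s = u (frag_of s) $ undefined"
      using h_of[OF s] s by (simp add: u_def singular_chain_of)
    also have "u (frag_of s) = v (chain_boundary 2 (frag_of s))"
      using s by (simp add: uv coboundary_def singular_chain_of numeral_2_eq_2)
    finally show "c s = v (frag_of (singular_face 2 0 s)) $ undefined - v (frag_of (singular_face 2 1 s)) $ undefined
       + v (frag_of (singular_face 2 2 s)) $ undefined"
      by (simp add: int_vec_hom_boundary_2[OF v s])
  qed
qed

section \<open>Points of simplices\<close>

definition simplex_pt :: "real list \<Rightarrow> nat \<Rightarrow> real" where
  "simplex_pt xs i = (if i < length xs then xs ! i else 0)"

lemma simplex_pt_in_standard_simplex:
  assumes "length xs = Suc p" "\<And>x. x \<in> set xs \<Longrightarrow> 0 \<le> x" "sum_list xs = 1"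
  shows "simplex_pt xs \<in> standard_simplex p"
proof -
  have "(\<Sum>i\<le>p. simplex_pt xs i) = (\<Sum>i<length xs. xs ! i)"
    unfolding assms(1) lessThan_Suc_atMost by (rule sum.cong) (auto simp: simplex_pt_def assms(1))
  then have "(\<Sum>i\<le>p. simplex_pt xs i) = 1"
    using assms(3) by (simp add: sum_list_sum_nth atLeast0LessThan)
  moreover have nn: "0 \<le> simplex_pt xs i" for i
    using assms(2) by (auto simp: simplex_pt_def)
  moreover have "simplex_pt xs i \<le> 1" for i
  proof (cases "i \<le> p")
    case True
    then have "simplex_pt xs i \<le> (\<Sum>i\<le>p. simplex_pt xs i)"
      using nn by (intro member_le_sum) auto
    then show ?thesis using calculation by simp
  qed (auto simp: simplex_pt_def assms(1))
  ultimately show ?thesis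
    by (auto simp: standard_simplex_def simplex_pt_def assms(1))
qed

lemma continuous_map_simplex_pt:
  assumes "length fs = Suc p" "\<And>f. f \<in> set fs \<Longrightarrow> continuous_on K f"
    "\<And>f x. f \<in> set fs \<Longrightarrow> x \<in> K \<Longrightarrow> 0 \<le> f x" "\<And>x. x \<in> K \<Longrightarrow> (\<Sum>f\<leftarrow>fs. f x) = 1"
  shows "continuous_map (top_of_set K) (subtopology (powertop_real UNIV) (standard_simplex p))
           (\<lambda>x. simplex_pt (map (\<lambda>f. f x) fs))"
proof -
  have "continuous_map (top_of_set K) euclideanreal (\<lambda>x. simplex_pt (map (\<lambda>f. f x) fs) i)" for i
    using assms(2) by (auto simp: simplex_pt_def)
  moreover have "simplex_pt (map (\<lambda>f. f x) fs) \<in> standard_simplex p" if "x \<in> K" for x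
    by (rule simplex_pt_in_standard_simplex) (use assms that in auto)
  ultimately show ?thesis
    by (auto simp: continuous_map_in_subtopology continuous_map_componentwise_UNIV)
qed

lemma simplical_face_simplex_pt:
  assumes "k \<le> length xs"
  shows "simplical_face k (simplex_pt xs) = simplex_pt (take k xs @ 0 # drop k xs)"
  using assms by (auto simp: simplical_face_def simplex_pt_def fun_eq_iff nth_append nth_Cons' min_def)

lemma singular_face_simplex_pt:
  assumes "length xs = Suc p" "\<And>x. x \<in> set xs \<Longrightarrow> 0 \<le> x" "sum_list xs = 1" "k \<le> Suc p"
  shows "singular_face (Suc p) k s (simplex_pt xs) = s (simplex_pt (take k xs @ 0 # drop k xs))"
  using simplex_pt_in_standard_simplex[OF assms(1-3)] assms(1,4)
  by (simp add: singular_face_def simplical_face_simplex_pt)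

lemma singular_simplex_compose_simplex_pt:
  assumes "singular_simplex p X s" "length fs = Suc p" "\<And>f. f \<in> set fs \<Longrightarrow> continuous_on K f"
    "\<And>f x. f \<in> set fs \<Longrightarrow> x \<in> K \<Longrightarrow> 0 \<le> f x" "\<And>x. x \<in> K \<Longrightarrow> (\<Sum>f\<leftarrow>fs. f x) = 1"
  shows "continuous_map (top_of_set K) X (\<lambda>x. s (simplex_pt (map (\<lambda>f. f x) fs)))"
proof -
  have "continuous_map (top_of_set K) (subtopology (powertop_real UNIV) (standard_simplex p))
           (\<lambda>x. simplex_pt (map (\<lambda>f. f x) fs))"
    by (rule continuous_map_simplex_pt) (use assms in auto)
  from continuous_map_compose[OF this] show ?thesis
    using assms(1) by (auto simp: singular_simplex_def o_def)
qed

text \<open>Barycentric coordinates with the zeroth one omitted. Trivialisations are defined over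
  subsets of Euclidean spaces, whereas standard simplices consist of functions on the natural
  numbers; in these coordinates simplices become compact convex sets.\<close>

definition unit_triangle :: "(real \<times> real) set" where
  "unit_triangle = {(a, b). 0 \<le> a \<and> 0 \<le> b \<and> a + b \<le> 1}"

definition unit_tetrahedron :: "(real \<times> real \<times> real) set" where
  "unit_tetrahedron = {(a, b, c). 0 \<le> a \<and> 0 \<le> b \<and> 0 \<le> c \<and> a + b + c \<le> 1}"

lemma unit_triangle: "compact unit_triangle" "convex unit_triangle"
proof -
  have eq: "unit_triangle = {x. (1, 0) \<bullet> x \<ge> 0} \<inter> {x. (0, 1) \<bullet> x \<ge> 0} \<inter> {x. (1, 1) \<bullet> x \<le> 1}"
    by (auto simp: unit_triangle_def)
  have "closed unit_triangle"
    unfolding eq by (intro closed_Int closed_halfspace_ge closed_halfspace_le)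
  moreover have "unit_triangle \<subseteq> {0..1} \<times> {0..1}" by (auto simp: unit_triangle_def)
  then have "bounded unit_triangle"
    using bounded_subset bounded_Times bounded_closed_interval by metis
  ultimately show "compact unit_triangle" by (simp add: compact_eq_bounded_closed)
  show "convex unit_triangle"
    unfolding eq by (intro convex_Int convex_halfspace_ge convex_halfspace_le)
qed

lemma unit_tetrahedron: "compact unit_tetrahedron" "convex unit_tetrahedron"
proof -
  have eq: "unit_tetrahedron = {x. (1, 0, 0) \<bullet> x \<ge> 0} \<inter> {x. (0, 1, 0) \<bullet> x \<ge> 0} \<inter> {x. (0, 0, 1) \<bullet> x \<ge> 0}
      \<inter> {x. (1, 1, 1) \<bullet> x \<le> 1}"
    by (auto simp: unit_tetrahedron_def)
  have "closed unit_tetrahedron"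
    unfolding eq by (intro closed_Int closed_halfspace_ge closed_halfspace_le)
  moreover have "unit_tetrahedron \<subseteq> {0..1} \<times> {0..1} \<times> {0..1}" by (auto simp: unit_tetrahedron_def)
  then have "bounded unit_tetrahedron"
    using bounded_subset bounded_Times bounded_closed_interval by metis
  ultimately show "compact unit_tetrahedron" by (simp add: compact_eq_bounded_closed)
  show "convex unit_tetrahedron"
    unfolding eq by (intro convex_Int convex_halfspace_ge convex_halfspace_le)
qed

definition edge_path :: "((nat \<Rightarrow> real) \<Rightarrow> 'q) \<Rightarrow> real \<Rightarrow> 'q" where
  "edge_path g s = g (simplex_pt [1 - s, s])"

definition triangle_map :: "((nat \<Rightarrow> real) \<Rightarrow> 'q) \<Rightarrow> real \<times> real \<Rightarrow> 'q" where
  "triangle_map g = (\<lambda>(a, b). g (simplex_pt [1 - a - b, a, b]))"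

definition tetra_map :: "((nat \<Rightarrow> real) \<Rightarrow> 'q) \<Rightarrow> real \<times> real \<times> real \<Rightarrow> 'q" where
  "tetra_map g = (\<lambda>(a, b, c). g (simplex_pt [1 - a - b - c, a, b, c]))"

lemma continuous_edge_path:
  "singular_simplex 1 X g \<Longrightarrow> continuous_map (top_of_set {0..1}) X (edge_path g)"
  using singular_simplex_compose_simplex_pt[of 1 X g "[\<lambda>s. 1 - s, \<lambda>s. s]" "{0..1}"]
  by (force simp: edge_path_def[abs_def] intro!: continuous_intros)

lemma continuous_triangle_map:
  "singular_simplex 2 X g \<Longrightarrow> continuous_map (top_of_set unit_triangle) X (triangle_map g)"
  using singular_simplex_compose_simplex_pt[of 2 X g "[\<lambda>x. 1 - fst x - snd x, fst, snd]" unit_triangle]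
  by (force simp: triangle_map_def[abs_def] unit_triangle_def case_prod_beta' intro!: continuous_intros)

lemma continuous_tetra_map:
  "singular_simplex 3 X g \<Longrightarrow> continuous_map (top_of_set unit_tetrahedron) X (tetra_map g)"
  using singular_simplex_compose_simplex_pt[of 3 X g
      "[\<lambda>x. 1 - fst x - fst (snd x) - snd (snd x), fst, \<lambda>x. fst (snd x), \<lambda>x. snd (snd x)]" unit_tetrahedron]
  by (force simp: tetra_map_def[abs_def] unit_tetrahedron_def case_prod_beta' intro!: continuous_intros)

text \<open>In these coordinates the vertices 0, 1, 2 are \<open>(0, 0)\<close>,
  \<open>(1, 0)\<close>, \<open>(0, 1)\<close>. The faces are the sides from 1 to 2, from 0 to 2 and
  from 0 to 1, each run from the lower to the higher vertex.\<close>

lemma edge_path_face: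
  assumes "s \<in> {0..1}"
  shows "edge_path (singular_face 2 0 g) s = triangle_map g (1 - s, s)"
    "edge_path (singular_face 2 1 g) s = triangle_map g (0, s)"
    "edge_path (singular_face 2 2 g) s = triangle_map g (s, 0)"
proof -
  have "0 \<le> x" if "x \<in> set [1 - s, s]" for x
    using assms that by auto
  note * = singular_face_simplex_pt[of "[1 - s, s]" 1 _ g, OF _ this]
  show "edge_path (singular_face 2 0 g) s = triangle_map g (1 - s, s)"
    "edge_path (singular_face 2 1 g) s = triangle_map g (0, s)"
    "edge_path (singular_face 2 2 g) s = triangle_map g (s, 0)"
    using *[of 0] *[of 1] *[of 2] by (simp_all add: edge_path_def triangle_map_def numeral_2_eq_2)
qed

lemma triangle_map_face:
  assumes "(a, b) \<in> unit_triangle"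
  shows "triangle_map (singular_face 3 0 g) (a, b) = tetra_map g (1 - a - b, a, b)"
    "triangle_map (singular_face 3 1 g) (a, b) = tetra_map g (0, a, b)"
    "triangle_map (singular_face 3 2 g) (a, b) = tetra_map g (a, 0, b)"
    "triangle_map (singular_face 3 3 g) (a, b) = tetra_map g (a, b, 0)"
proof -
  have "0 \<le> x" if "x \<in> set [1 - a - b, a, b]" for x
    using assms that by (auto simp: unit_triangle_def)
  note * = singular_face_simplex_pt[of "[1 - a - b, a, b]" 2 _ g, OF _ this]
  show "triangle_map (singular_face 3 0 g) (a, b) = tetra_map g (1 - a - b, a, b)"
    "triangle_map (singular_face 3 1 g) (a, b) = tetra_map g (0, a, b)"
    "triangle_map (singular_face 3 2 g) (a, b) = tetra_map g (a, 0, b)"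
    "triangle_map (singular_face 3 3 g) (a, b) = tetra_map g (a, b, 0)"
    using *[of 0] *[of 1] *[of 2] *[of 3]
    by (simp_all add: tetra_map_def triangle_map_def numeral_3_eq_3 numeral_2_eq_2)
qed

section \<open>The obstruction cocycle\<close>

context circle_cocycle
begin

lemma triv_nonzero: "triv K f w \<Longrightarrow> x \<in> K \<Longrightarrow> w x \<noteq> 0"
  by (auto simp: triv_def)

text \<open>The value 1 at both ends makes the choices on different edges agree at common vertices.
  Only because of this are the angles around a triangle integral multiples of 2 pi.\<close>

definition edge_lift :: "(((nat \<Rightarrow> real) \<Rightarrow> 'q) \<Rightarrow> real \<Rightarrow> complex) \<Rightarrow> bool" where
  "edge_lift L \<longleftrightarrow> (\<forall>g. singular_simplex 1 Q g \<longrightarrow>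
     triv {0..1} (edge_path g) (L g) \<and> L g 0 = 1 \<and> L g 1 = 1)"

text \<open>Any trivialisation along the segment can be normalised at both ends by a factor whose
  angle interpolates linearly between \<open>- a\<close> and \<open>- b\<close>, where
  \<open>a\<close> and \<open>b\<close> are its angles at the ends.\<close>

lemma edge_lift_exists: "\<exists>L. edge_lift L"
proof -
  have "\<exists>l. triv {0..1} (edge_path g) l \<and> l 0 = 1 \<and> l 1 = 1" if g: "singular_simplex 1 Q g" for g
  proof -
    obtain w where w: "triv {0..1} (edge_path g) w"
      using triv_exists[OF _ _ continuous_edge_path[OF g]] by auto
    then have nw: "norm (w 0) = 1" "norm (w 1) = 1" by (auto simp: triv_def)
    define a b where "a = Arg (w 0)" and "b = Arg (w 1)"
    from nw have "w 0 \<noteq> 0" "w 1 \<noteq> 0" by (metis norm_zero zero_neq_one)+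
    then have ab: "w 0 = cis a" "w 1 = cis b"
      using nw by (simp_all add: a_def b_def cis_Arg sgn_eq)
    have "triv {0..1} (edge_path g) (\<lambda>s. cis (- (1 - s) * a - s * b) * w s)"
      by (rule triv_mult[OF w]) (auto intro!: continuous_intros)
    then show ?thesis
      by (intro exI[of _ "\<lambda>s. cis (- (1 - s) * a - s * b) * w s"]) (auto simp: ab cis_mult)
  qed
  then show ?thesis unfolding edge_lift_def by meson
qed

lemma circle_path_lift_divide:
  assumes L: "edge_lift L" and g: "singular_simplex 1 Q g" and w: "triv K f w"
    and e: "continuous_on {0..1} e" "e ` {0..1} \<subseteq> K" "\<And>s. s \<in> {0..1} \<Longrightarrow> edge_path g s = f (e s)"
  shows "circle_path (\<lambda>s. L g s / w (e s))"
proof -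
  have "triv {0..1} (edge_path g) (\<lambda>s. w (e s))"
    using triv_compose[OF w e(1,2)] by (subst triv_cong[where f' = "\<lambda>s. f (e s)"]) (auto simp: e(3))
  moreover have "triv {0..1} (edge_path g) (L g)" using L g by (simp add: edge_lift_def)
  ultimately show ?thesis
    using triv_divide_continuous[OF continuous_edge_path[OF g], of "L g"]
    by (auto simp: circle_path_def triv_def norm_divide)
qed

text \<open>The angle by which the edge lifts turn around the boundary of \<open>\<sigma>\<close>,
  measured against a trivialisation \<open>w\<close> over the whole triangle, with the signs of the
  singular boundary. It obstructs the compatibility of the three edge lifts.\<close>

definition winding :: "(((nat \<Rightarrow> real) \<Rightarrow> 'q) \<Rightarrow> real \<Rightarrow> complex) \<Rightarrow> (real \<times> real \<Rightarrow> complex)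
    \<Rightarrow> ((nat \<Rightarrow> real) \<Rightarrow> 'q) \<Rightarrow> real" where
  "winding L w \<sigma> = angle_change (\<lambda>s. L (singular_face 2 0 \<sigma>) s / w (1 - s, s))
     - angle_change (\<lambda>s. L (singular_face 2 1 \<sigma>) s / w (0, s))
     + angle_change (\<lambda>s. L (singular_face 2 2 \<sigma>) s / w (s, 0))"

lemma circle_path_faces:
  assumes L: "edge_lift L" and s: "singular_simplex 2 Q \<sigma>" and w: "triv unit_triangle (triangle_map \<sigma>) w"
  shows "circle_path (\<lambda>s. L (singular_face 2 0 \<sigma>) s / w (1 - s, s))"
    "circle_path (\<lambda>s. L (singular_face 2 1 \<sigma>) s / w (0, s))"
    "circle_path (\<lambda>s. L (singular_face 2 2 \<sigma>) s / w (s, 0))"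
proof -
  have f: "singular_simplex 1 Q (singular_face 2 k \<sigma>)" if "k \<le> 2" for k
    using singular_simplex_singular_face[OF s, of k] that by simp
  show "circle_path (\<lambda>s. L (singular_face 2 0 \<sigma>) s / w (1 - s, s))"
    by (rule circle_path_lift_divide[OF L f w, where e = "\<lambda>s. (1 - s, s)"])
      (auto simp: edge_path_face unit_triangle_def intro!: continuous_intros)
  show "circle_path (\<lambda>s. L (singular_face 2 1 \<sigma>) s / w (0, s))"
    by (rule circle_path_lift_divide[OF L f w, where e = "\<lambda>s. (0, s)"])
      (auto simp: edge_path_face[unfolded One_nat_def] unit_triangle_def intro!: continuous_intros)
  show "circle_path (\<lambda>s. L (singular_face 2 2 \<sigma>) s / w (s, 0))"
    by (rule circle_path_lift_divide[OF L f w, where e = "\<lambda>s. (s, 0)"])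
      (auto simp: edge_path_face unit_triangle_def intro!: continuous_intros)
qed

text \<open>The triangle is contractible, so \<open>w / w'\<close> has a continuous angle
  \<open>\<zeta>\<close> on all of it. Each side contributes the difference of the values of
  \<open>\<zeta>\<close> at its ends, and these contributions telescope around the boundary.\<close>

lemma winding_independent:
  assumes L: "edge_lift L" and s: "singular_simplex 2 Q \<sigma>"
    and w: "triv unit_triangle (triangle_map \<sigma>) w" "triv unit_triangle (triangle_map \<sigma>) w'"
  shows "winding L w \<sigma> = winding L w' \<sigma>"
proof -
  have "continuous_on unit_triangle (\<lambda>x. w x / w' x)"
    by (rule triv_divide_continuous[OF continuous_triangle_map[OF s] w])
  then obtain \<zeta> :: "real \<times> real \<Rightarrow> real" where \<zeta>: "continuous_on unit_triangle \<zeta>"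
    and eq: "\<And>x. x \<in> unit_triangle \<Longrightarrow> w x / w' x = cis (\<zeta> x)"
    by (rule continuous_cis_lift) (use w convex_imp_contractible[OF unit_triangle(2)] in \<open>auto simp: triv_def norm_divide\<close>)
  have *: "angle_change (\<lambda>s. L g s / w' (e s)) = angle_change (\<lambda>s. L g s / w (e s)) + (\<zeta> (e 1) - \<zeta> (e 0))"
    if "circle_path (\<lambda>s. L g s / w (e s))" and e: "continuous_on {0..1} e" "e ` {0..1} \<subseteq> unit_triangle" for g e
  proof -
    have c: "continuous_on {0..1} (\<lambda>s. \<zeta> (e s))"
      using continuous_on_compose2[OF \<zeta> e] .
    have "angle_change (\<lambda>s. L g s / w' (e s)) = angle_change (\<lambda>s. L g s / w (e s) * cis (\<zeta> (e s)))"
    proof (rule angle_change_cong)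
      fix s :: real assume "s \<in> {0..1}"
      then have "e s \<in> unit_triangle" using e by auto
      moreover from this have "w (e s) \<noteq> 0" "w' (e s) \<noteq> 0" using w by (auto simp: triv_def)
      ultimately show "L g s / w' (e s) = L g s / w (e s) * cis (\<zeta> (e s))"
        by (simp flip: eq)
    qed
    also have "\<dots> = angle_change (\<lambda>s. L g s / w (e s)) + (\<zeta> (e 1) - \<zeta> (e 0))"
      using angle_change_mult[OF that(1) circle_path_cis[OF c]] angle_change_cis[OF c] by simp
    finally show ?thesis .
  qed
  note cp = circle_path_faces[OF L s w(1)]
  show ?thesis
    unfolding winding_def
    using *[of "singular_face 2 0 \<sigma>" "\<lambda>s. (1 - s, s)", OF cp(1)] *[of "singular_face 2 1 \<sigma>" "\<lambda>s. (0, s)", OF cp(2)]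
      *[of "singular_face 2 2 \<sigma>" "\<lambda>s. (s, 0)", OF cp(3)]
    by (force simp: unit_triangle_def intro!: continuous_intros)
qed

text \<open>The edge lifts equal 1 at the vertices, so modulo 2 pi the angle of a side is that of
  the quotient of \<open>w\<close> at its two ends. The signed product of these quotients around the
  triangle is 1.\<close>

lemma winding_integral:
  assumes L: "edge_lift L" and s: "singular_simplex 2 Q \<sigma>" and w: "triv unit_triangle (triangle_map \<sigma>) w"
  shows "\<exists>k::int. winding L w \<sigma> = 2 * pi * k"
proof -
  note cp = circle_path_faces[OF L s w]
  have f: "singular_simplex 1 Q (singular_face 2 k \<sigma>)" if "k \<le> 2" for k
    using singular_simplex_singular_face[OF s, of k] that by simp
  have L1: "L (singular_face 2 k \<sigma>) 0 = 1" "L (singular_face 2 k \<sigma>) 1 = 1" if "k \<le> 2" for k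
    using L f[OF that] by (auto simp: edge_lift_def)
  have nz: "w (0, 0) \<noteq> 0" "w (1, 0) \<noteq> 0" "w (0, 1) \<noteq> 0"
    using triv_nonzero[OF w] by (auto simp: unit_triangle_def)
  have "cis (winding L w \<sigma>) = cis 0"
    using L1[of 0] L1[of 1] L1[of 2] nz
    by (simp add: winding_def cis_angle_change cp cis_mult[symmetric] cis_divide[symmetric]
        cp(2)[unfolded One_nat_def])
  then show ?thesis
    unfolding cis_eq_cis_iff by simp
qed

text \<open>The four trivialisations are restrictions of one \<open>w\<close>. Each of the six edges
  therefore occurs in exactly two faces with the same angle, and with opposite signs in the
  alternating sum.\<close>

lemma winding_cocycle:
  assumes L: "edge_lift L" and t: "singular_simplex 3 Q \<tau>" and w: "triv unit_tetrahedron (tetra_map \<tau>) w"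
  shows "winding L (\<lambda>(a, b). w (1 - a - b, a, b)) (singular_face 3 0 \<tau>)
       - winding L (\<lambda>(a, b). w (0, a, b)) (singular_face 3 1 \<tau>)
       + winding L (\<lambda>(a, b). w (a, 0, b)) (singular_face 3 2 \<tau>)
       - winding L (\<lambda>(a, b). w (a, b, 0)) (singular_face 3 3 \<tau>) = 0"
proof -
  have c: "singular_face 2 i (singular_face 3 j \<tau>) = singular_face 2 (j - 1) (singular_face 3 i \<tau>)"
    if "i < j" "j \<le> 3" for i j
    using singular_face_commute[of 1 Q \<tau> i j] t that by (simp add: numeral_3_eq_3 numeral_2_eq_2)
  show ?thesis
    using c[of 0 1] c[of 0 2] c[of 0 3] c[of 1 2] c[of 1 3] c[of 2 3]
    by (simp add: winding_def)
qed

lemma triv_tetrahedron_faces: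
  assumes w: "triv unit_tetrahedron (tetra_map \<tau>) w"
  shows "triv unit_triangle (triangle_map (singular_face 3 0 \<tau>)) (\<lambda>(a, b). w (1 - a - b, a, b))"
    "triv unit_triangle (triangle_map (singular_face 3 1 \<tau>)) (\<lambda>(a, b). w (0, a, b))"
    "triv unit_triangle (triangle_map (singular_face 3 2 \<tau>)) (\<lambda>(a, b). w (a, 0, b))"
    "triv unit_triangle (triangle_map (singular_face 3 3 \<tau>)) (\<lambda>(a, b). w (a, b, 0))"
proof -
  have *: "triv unit_triangle f (\<lambda>(a, b). w (e a b))"
    if "\<And>a b. (a, b) \<in> unit_triangle \<Longrightarrow> f (a, b) = tetra_map \<tau> (e a b)"
       "continuous_on unit_triangle (\<lambda>x. e (fst x) (snd x))" "\<And>a b. (a, b) \<in> unit_triangle \<Longrightarrow> e a b \<in> unit_tetrahedron"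
      for f e
  proof -
    have "triv unit_triangle (\<lambda>x. tetra_map \<tau> (e (fst x) (snd x))) (\<lambda>x. w (e (fst x) (snd x)))"
      by (rule triv_compose[OF w that(2)]) (use that(3) in auto)
    then show ?thesis
      by (subst triv_cong[where f' = "\<lambda>x. tetra_map \<tau> (e (fst x) (snd x))"
            and w' = "\<lambda>x. w (e (fst x) (snd x))"]) (auto simp: that(1))
  qed
  show "triv unit_triangle (triangle_map (singular_face 3 0 \<tau>)) (\<lambda>(a, b). w (1 - a - b, a, b))"
    by (rule *) (auto simp: triangle_map_face unit_triangle_def unit_tetrahedron_def intro!: continuous_intros)
  show "triv unit_triangle (triangle_map (singular_face 3 1 \<tau>)) (\<lambda>(a, b). w (0, a, b))"
    by (rule *) (auto simp: triangle_map_face[unfolded One_nat_def] unit_triangle_def unit_tetrahedron_def intro!: continuous_intros)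
  show "triv unit_triangle (triangle_map (singular_face 3 2 \<tau>)) (\<lambda>(a, b). w (a, 0, b))"
    by (rule *) (auto simp: triangle_map_face unit_triangle_def unit_tetrahedron_def intro!: continuous_intros)
  show "triv unit_triangle (triangle_map (singular_face 3 3 \<tau>)) (\<lambda>(a, b). w (a, b, 0))"
    by (rule *) (auto simp: triangle_map_face unit_triangle_def unit_tetrahedron_def intro!: continuous_intros)
qed

text \<open>Full turns along an edge leave the values at both ends unchanged. So an edge lift may be
  altered by any integral 1-cochain, and its winding changes by 2 pi times the coboundary.\<close>

lemma edge_lift_twist:
  assumes "edge_lift L"
  shows "edge_lift (\<lambda>g s. cis (- (2 * pi * of_int (b g) * s)) * L g s)"
proof -
  have "cis (- (2 * pi * of_int (k::int))) = 1" for k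
    using cis_eq_cis_iff[of "- (2 * pi * of_int k)" 0] by (auto intro: exI[of _ "- k"])
  moreover have "triv {0..1} (edge_path g) (\<lambda>s. cis (- (2 * pi * of_int (b g) * s)) * L g s)"
    if "singular_simplex 1 Q g" for g
    by (rule triv_mult) (use assms that in \<open>auto simp: edge_lift_def intro!: continuous_intros\<close>)
  ultimately show ?thesis
    using assms by (auto simp: edge_lift_def)
qed

lemma winding_twist:
  assumes L: "edge_lift L" and s: "singular_simplex 2 Q \<sigma>" and w: "triv unit_triangle (triangle_map \<sigma>) w"
  shows "winding (\<lambda>g s. cis (- (2 * pi * of_int (b g) * s)) * L g s) w \<sigma> = winding L w \<sigma>
    - 2 * pi * of_int (b (singular_face 2 0 \<sigma>) - b (singular_face 2 1 \<sigma>) + b (singular_face 2 2 \<sigma>))"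
proof -
  have *: "angle_change (\<lambda>s. cis (- (2 * pi * of_int (k::int) * s)) * l s / v s) =
      angle_change (\<lambda>s. l s / v s) - 2 * pi * k" if "circle_path (\<lambda>s. l s / v s)" for k l v
  proof -
    have c: "continuous_on {0..1} (\<lambda>s. - (2 * pi * of_int k * s))" by (intro continuous_intros)
    show ?thesis
      using angle_change_mult[OF circle_path_cis[OF c] that] angle_change_cis[OF c] by simp
  qed
  show ?thesis
    unfolding winding_def circle_path_faces(1,2,3)[OF L s w, THEN *]
    by (simp add: algebra_simps)
qed

text \<open>The winding in units of 2 pi is an integral 2-cocycle \<open>c\<close>. A 1-cochain
  \<open>b\<close> with coboundary \<open>c\<close> exists by the hypothesis on cohomology, and
  twisting by \<open>b\<close> removes the winding on every triangle.\<close>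

lemma flat_edge_lift_exists:
  assumes "trivial_group (cohomology_group 2 Q (int_vec_group :: (int ^ 'n) monoid))"
  obtains L where "edge_lift L"
    "\<And>\<sigma> w. singular_simplex 2 Q \<sigma> \<Longrightarrow> triv unit_triangle (triangle_map \<sigma>) w \<Longrightarrow> winding L w \<sigma> = 0"
proof -
  obtain L where L: "edge_lift L" using edge_lift_exists by blast
  define c where "c \<sigma> = (SOME k::int. \<exists>w. triv unit_triangle (triangle_map \<sigma>) w \<and> winding L w \<sigma> = 2 * pi * k)" for \<sigma>
  have c: "winding L w \<sigma> = 2 * pi * c \<sigma>"
    if s: "singular_simplex 2 Q \<sigma>" and w: "triv unit_triangle (triangle_map \<sigma>) w" for \<sigma> w
  proof -
    have "\<exists>k::int. \<exists>w. triv unit_triangle (triangle_map \<sigma>) w \<and> winding L w \<sigma> = 2 * pi * k"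
      using winding_integral[OF L s w] w by blast
    from someI_ex[OF this] obtain w' where "triv unit_triangle (triangle_map \<sigma>) w'" "winding L w' \<sigma> = 2 * pi * c \<sigma>"
      unfolding c_def by blast
    then show ?thesis using winding_independent[OF L s w] by metis
  qed
  have "\<exists>b. \<forall>s. singular_simplex 2 Q s \<longrightarrow>
       c s = b (singular_face 2 0 s) - b (singular_face 2 1 s) + b (singular_face 2 2 s)"
  proof (rule cocycle_is_coboundary[OF assms])
    fix \<tau> assume t: "singular_simplex 3 Q \<tau>"
    \<comment> \<open>One trivialisation over the tetrahedron computes all four values of
      \<open>c\<close>, since the winding does not depend on the trivialisation.\<close>
    obtain w where w: "triv unit_tetrahedron (tetra_map \<tau>) w"
      using triv_exists[OF unit_tetrahedron continuous_tetra_map[OF t]] by blast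
    have f: "singular_simplex 2 Q (singular_face 3 k \<tau>)" if "k \<le> 3" for k
      using singular_simplex_singular_face[OF t, of k] that by simp
    note tf = triv_tetrahedron_faces[OF w]
    have "2 * pi * of_int (c (singular_face 3 0 \<tau>) - c (singular_face 3 1 \<tau>)
       + c (singular_face 3 2 \<tau>) - c (singular_face 3 3 \<tau>)) = 0"
      using winding_cocycle[OF L t w] c[OF f tf(1)] c[OF f tf(2)] c[OF f tf(3)] c[OF f tf(4)]
      by (simp add: algebra_simps)
    then show "c (singular_face 3 0 \<tau>) - c (singular_face 3 1 \<tau>)
       + c (singular_face 3 2 \<tau>) - c (singular_face 3 3 \<tau>) = 0"
      by (simp only: mult_eq_0_iff of_int_eq_0_iff) simp
  qed
  then obtain b where b: "\<And>s. singular_simplex 2 Q s \<Longrightarrow>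
       c s = b (singular_face 2 0 s) - b (singular_face 2 1 s) + b (singular_face 2 2 s)"
    by blast
  show ?thesis
  proof (rule that[OF edge_lift_twist[OF L, of b]])
    fix \<sigma> w assume s: "singular_simplex 2 Q \<sigma>" and w: "triv unit_triangle (triangle_map \<sigma>) w"
    show "winding (\<lambda>g s. cis (- (2 * pi * of_int (b g) * s)) * L g s) w \<sigma> = 0"
      using winding_twist[OF L s w, of b] c[OF s w] b[OF s] by simp
  qed
qed

end

section \<open>Triviality of circle cocycles\<close>

lemma simplex_1_coords:
  assumes "x \<in> standard_simplex 1"
  shows "x 0 + x 1 = 1" "0 \<le> x 0" "0 \<le> x 1" "x 0 \<le> 1" "x 1 \<le> 1"
  using assms by (auto simp: standard_simplex_def)

lemma simplex_2_coords:
  assumes "x \<in> standard_simplex 2"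
  shows "x 0 + x 1 + x 2 = 1" "0 \<le> x 0" "0 \<le> x 1" "0 \<le> x 2"
  using assms by (auto simp: standard_simplex_def numeral_2_eq_2)

lemma continuous_simplex_coord:
  "continuous_map (subtopology (powertop_real UNIV) (standard_simplex p)) euclideanreal (\<lambda>x. x i)"
  by (intro continuous_map_from_subtopology continuous_map_product_projection) auto

definition path_simplex :: "(real \<Rightarrow> 'q) \<Rightarrow> (nat \<Rightarrow> real) \<Rightarrow> 'q" where
  "path_simplex \<gamma> = (\<lambda>x\<in>standard_simplex 1. \<gamma> (x 1))"

lemma singular_simplex_path_simplex:
  assumes "continuous_map (top_of_set {0..1}) X \<gamma>"
  shows "singular_simplex 1 X (path_simplex \<gamma>)"
proof -
  have "continuous_map (subtopology (powertop_real UNIV) (standard_simplex 1)) (top_of_set {0..1}) (\<lambda>x. x 1)"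
    by (auto simp: continuous_map_in_subtopology continuous_simplex_coord simplex_1_coords[unfolded One_nat_def])
  from continuous_map_compose[OF this assms] show ?thesis
    by (auto simp: singular_simplex_def path_simplex_def o_def intro: continuous_map_eq)
qed

lemma edge_path_path_simplex:
  assumes "s \<in> {0..1}"
  shows "edge_path (path_simplex \<gamma>) s = \<gamma> s"
proof -
  have "simplex_pt [1 - s, s] \<in> standard_simplex 1"
    by (rule simplex_pt_in_standard_simplex) (use assms in auto)
  then show ?thesis by (simp add: edge_path_def path_simplex_def simplex_pt_def)
qed

text \<open>The lower half of a square that is cut along its diagonal.\<close>

definition square_simplex :: "(real \<times> real \<Rightarrow> 'q) \<Rightarrow> (nat \<Rightarrow> real) \<Rightarrow> 'q" where
  "square_simplex H = (\<lambda>x\<in>standard_simplex 2. H (x 1 + x 2, x 2))"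

lemma singular_simplex_square_simplex:
  assumes "continuous_map (top_of_set ({0..1} \<times> {0..1})) X H"
  shows "singular_simplex 2 X (square_simplex H)"
proof -
  have "(x 1 + x 2, x 2) \<in> {0..1} \<times> {0..1}" if "x \<in> standard_simplex 2" for x
    using simplex_2_coords[OF that] by auto
  then have "continuous_map (subtopology (powertop_real UNIV) (standard_simplex 2)) (top_of_set ({0..1} \<times> {0..1}))
     (\<lambda>x. (x 1 + x 2, x 2))"
    unfolding continuous_map_in_subtopology prod_topology_euclidean[symmetric]
    by (auto simp del: prod_topology_euclidean
        intro!: continuous_map_pairedI continuous_map_add continuous_simplex_coord)
  from continuous_map_compose[OF this assms] show ?thesis
    by (auto simp: singular_simplex_def square_simplex_def o_def intro: continuous_map_eq)
qed

lemma square_simplex_faces: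
  "singular_face 2 0 (square_simplex H) = path_simplex (\<lambda>t. H (1, t))"
  "singular_face 2 1 (square_simplex H) = path_simplex (\<lambda>t. H (t, t))"
  "singular_face 2 2 (square_simplex H) = path_simplex (\<lambda>t. H (t, 0))"
proof -
  have in2: "simplical_face k x \<in> standard_simplex 2" if "x \<in> standard_simplex 1" "k \<le> 2" for k and x :: "nat \<Rightarrow> real"
    using simplical_face_in_standard_simplex[of 2 k x] that by simp
  show "singular_face 2 0 (square_simplex H) = path_simplex (\<lambda>t. H (1, t))"
    using in2[of _ 0] simplex_1_coords
    by (auto simp: singular_face_def square_simplex_def path_simplex_def fun_eq_iff restrict_def simplical_face_def numeral_2_eq_2)
  show "singular_face 2 1 (square_simplex H) = path_simplex (\<lambda>t. H (t, t))"
    using in2[of _ 1]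
    by (auto simp: singular_face_def square_simplex_def path_simplex_def fun_eq_iff restrict_def simplical_face_def numeral_2_eq_2)
  show "singular_face 2 2 (square_simplex H) = path_simplex (\<lambda>t. H (t, 0))"
    using in2[of _ 2]
    by (auto simp: singular_face_def square_simplex_def path_simplex_def fun_eq_iff restrict_def simplical_face_def)
qed

text \<open>Normalised Urysohn functions of a finite subcover. The closed sets \<open>S p\<close>
  inside \<open>U (\<iota> p)\<close> are recorded because they allow a product of
  \<open>\<rho> p\<close> with a function continuous on \<open>U (\<iota> p)\<close> to be continued
  by zero.\<close>

lemma compact_Hausdorff_finite_partition_of_unity:
  assumes "compact_space Q" "Hausdorff_space Q" and open_U: "\<forall>i\<in>I. openin Q (U i)"
    and cover: "topspace Q \<subseteq> (\<Union>i\<in>I. U i)"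
  shows "\<exists>(P :: 'q set) (\<iota> :: 'q \<Rightarrow> 'i) (\<rho> :: 'q \<Rightarrow> 'q \<Rightarrow> real) S. finite P \<and>
    (\<forall>p\<in>P. \<iota> p \<in> I \<and> continuous_map Q euclideanreal (\<rho> p) \<and> closedin Q (S p) \<and> S p \<subseteq> U (\<iota> p) \<and>
       (\<forall>q\<in>topspace Q - S p. \<rho> p q = 0)) \<and>
    (\<forall>q\<in>topspace Q. (\<Sum>p\<in>P. \<rho> p q) = 1)"
proof -
  have "\<exists>i f. i \<in> I \<and> continuous_map Q euclideanreal f \<and> f p = 1 \<and> (\<forall>q\<in>topspace Q - U i. f q = (0::real))"
    if "p \<in> topspace Q" for p
  proof -
    obtain i where i: "i \<in> I" "p \<in> U i" using cover \<open>p \<in> topspace Q\<close> by blast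
    have "normal_space Q" using assms(1,2) compact_Hausdorff_or_regular_imp_normal_space by blast
    moreover have "closedin Q {p}"
      using assms(2) that by (simp add: Hausdorff_imp_t1_space closedin_t1_singleton)
    moreover have "closedin Q (topspace Q - U i)" using open_U i(1) by blast
    moreover have "disjnt {p} (topspace Q - U i)" using i by (auto simp: disjnt_def)
    ultimately obtain f where "continuous_map Q euclideanreal f" "f ` {p} \<subseteq> {1}" "f ` (topspace Q - U i) \<subseteq> {0}"
      by (rule Urysohn_lemma_alt)
    with i show ?thesis by (intro exI[of _ i] exI[of _ f]) auto
  qed
  then obtain \<iota> f where f: "\<And>p. p \<in> topspace Q \<Longrightarrow> \<iota> p \<in> I \<and> continuous_map Q euclideanreal (f p) \<and> f p p = 1
      \<and> (\<forall>q\<in>topspace Q - U (\<iota> p). f p q = (0::real))"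
    by metis
  define N where "N p = {q \<in> topspace Q. f p q \<in> {1/2<..}}" for p
  have N: "openin Q (N p)" if "p \<in> topspace Q" for p
    unfolding N_def using f[OF that] by (intro openin_continuous_map_preimage) auto
  have "\<exists>F. finite F \<and> F \<subseteq> N ` topspace Q \<and> topspace Q \<subseteq> \<Union>F"
  proof (rule compactinD)
    show "compactin Q (topspace Q)" using assms(1) by (simp add: compact_space_def)
    show "topspace Q \<subseteq> \<Union> (N ` topspace Q)" using f by (force simp: N_def)
  qed (use N in auto)
  then obtain P where P: "finite P" "P \<subseteq> topspace Q" "topspace Q \<subseteq> (\<Union>p\<in>P. N p)"
    by (metis finite_subset_image)
  \<comment> \<open>The threshold 1/4 keeps the functions zero outside the closed set where
    \<open>f p\<close> is at least 1/4, which lies inside \<open>U (\<iota> p)\<close>; they remain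
    positive on \<open>N p\<close>, where \<open>f p\<close> exceeds 1/2.\<close>
  define \<beta> where "\<beta> p q = max 0 (f p q - 1/4)" for p q
  have \<beta>: "continuous_map Q euclideanreal (\<beta> p)" if "p \<in> P" for p
    unfolding \<beta>_def using f P that by (intro continuous_intros) auto
  define s where "s q = (\<Sum>p\<in>P. \<beta> p q)" for q
  have s: "continuous_map Q euclideanreal s"
    unfolding s_def using \<beta> P(1) by (intro continuous_intros) auto
  have pos: "s q > 0" if q: "q \<in> topspace Q" for q
  proof -
    obtain p where p: "p \<in> P" "q \<in> N p" using P q by blast
    then have "\<beta> p q > 0" by (auto simp: \<beta>_def N_def)
    then show ?thesis
      unfolding s_def using P(1) p by (intro sum_pos2[of P p]) (auto simp: \<beta>_def)
  qed
  show ?thesis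
  proof (intro exI[of _ P] exI[of _ \<iota>] exI[of _ "\<lambda>p q. \<beta> p q / s q"]
      exI[of _ "\<lambda>p. {q \<in> topspace Q. f p q \<in> {1/4..}}"] conjI ballI)
    show "continuous_map Q euclideanreal (\<lambda>q. \<beta> p q / s q)" if "p \<in> P" for p
      using \<beta>[OF that] s pos by (intro continuous_map_real_divide) force+
    show "closedin Q {q \<in> topspace Q. f p q \<in> {1/4..}}" if "p \<in> P" for p
      using f P that by (intro closedin_continuous_map_preimage) auto
    show "{q \<in> topspace Q. f p q \<in> {1/4..}} \<subseteq> U (\<iota> p)" if "p \<in> P" for p
    proof
      fix q assume q: "q \<in> {q \<in> topspace Q. f p q \<in> {1/4..}}"
      show "q \<in> U (\<iota> p)"
      proof (rule ccontr)
        assume "q \<notin> U (\<iota> p)"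
        then have "f p q = 0" using f[of p] P that q by blast
        then show False using q by simp
      qed
    qed
    show "(\<Sum>p\<in>P. \<beta> p q / s q) = 1" if "q \<in> topspace Q" for q
      using pos[OF that] by (simp add: s_def flip: sum_divide_distrib)
  qed (use P f in \<open>auto simp: \<beta>_def\<close>)
qed

context circle_cocycle
begin

text \<open>Multiplication by \<open>\<theta> i\<close> is division by the local trivialisation
  \<open>1 / \<theta> i\<close>. So this is the integral along the path of the connection given by
  \<open>L\<close>, in the gauge of \<open>U i\<close>.\<close>

definition variation :: "(((nat \<Rightarrow> real) \<Rightarrow> 'q) \<Rightarrow> real \<Rightarrow> complex) \<Rightarrow> 'i \<Rightarrow> (real \<Rightarrow> 'q) \<Rightarrow> real" where
  "variation L i \<gamma> = angle_change (\<lambda>s. L (path_simplex \<gamma>) s * \<theta> i (\<gamma> s))"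

lemma circle_path_variation:
  assumes L: "edge_lift L" and \<gamma>: "continuous_map (top_of_set {0..1}) Q \<gamma>" and i: "i \<in> I" "\<gamma> ` {0..1} \<subseteq> U i"
  shows "circle_path (\<lambda>s. L (path_simplex \<gamma>) s * \<theta> i (\<gamma> s))"
proof -
  have "triv {0..1} (edge_path (path_simplex \<gamma>)) (L (path_simplex \<gamma>))"
    using L singular_simplex_path_simplex[OF \<gamma>] by (simp add: edge_lift_def)
  then have t: "triv {0..1} \<gamma> (L (path_simplex \<gamma>))"
    by (subst triv_cong[where f' = "edge_path (path_simplex \<gamma>)"]) (auto simp: edge_path_path_simplex)
  moreover have "{x \<in> {0..1}. \<gamma> x \<in> U i} = {0..1}" using i by auto
  ultimately show ?thesis
    using i norm_\<theta>[OF i(1)] by (auto simp: circle_path_def triv_def norm_mult image_subset_iff)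
qed

lemma cis_variation:
  assumes "edge_lift L" "continuous_map (top_of_set {0..1}) Q \<gamma>" "i \<in> I" "\<gamma> ` {0..1} \<subseteq> U i"
  shows "cis (variation L i \<gamma>) = \<theta> i (\<gamma> 1) / \<theta> i (\<gamma> 0)"
  using cis_angle_change[OF circle_path_variation[OF assms]] assms(1) singular_simplex_path_simplex[OF assms(2)]
  by (auto simp: variation_def edge_lift_def)

text \<open>The triangle lies in a single \<open>U i\<close>, so its winding can be computed with
  the trivialisation \<open>1 / \<theta> i\<close>. Flatness then says that two sides together have
  the variation of the third.\<close>

lemma variation_diagonal:
  assumes L: "edge_lift L"
    and flat: "\<And>\<sigma> w. singular_simplex 2 Q \<sigma> \<Longrightarrow> triv unit_triangle (triangle_map \<sigma>) w \<Longrightarrow> winding L w \<sigma> = 0"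
    and H: "continuous_map (top_of_set ({0..1} \<times> {0..1})) Q H" and i: "i \<in> I" "H ` ({0..1} \<times> {0..1}) \<subseteq> U i"
  shows "variation L i (\<lambda>t. H (1, t)) + variation L i (\<lambda>t. H (t, 0)) = variation L i (\<lambda>t. H (t, t))"
proof -
  let ?\<sigma> = "square_simplex H"
  have s: "singular_simplex 2 Q ?\<sigma>" by (rule singular_simplex_square_simplex[OF H])
  have eq: "triangle_map ?\<sigma> (a, b) = H (a + b, b)" if "(a, b) \<in> unit_triangle" for a b
  proof -
    have "simplex_pt [1 - a - b, a, b] \<in> standard_simplex 2"
      by (rule simplex_pt_in_standard_simplex) (use that in \<open>auto simp: unit_triangle_def\<close>)
    then show ?thesis by (simp add: triangle_map_def square_simplex_def simplex_pt_def)
  qed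
  have "triangle_map ?\<sigma> ` unit_triangle \<subseteq> U i"
    using i(2) eq by (force simp: unit_triangle_def)
  then have "winding L (\<lambda>x. 1 / \<theta> i (triangle_map ?\<sigma> x)) ?\<sigma> = 0"
    by (intro flat[OF s] triv_local[OF continuous_triangle_map[OF s]] i(1))
  moreover have "angle_change (\<lambda>s. l s / (1 / \<theta> i (triangle_map ?\<sigma> (e s)))) = angle_change (\<lambda>s. l s * \<theta> i (H (e' s)))"
    if "\<And>s. s \<in> {0..1} \<Longrightarrow> e s \<in> unit_triangle" "\<And>s. s \<in> {0..1} \<Longrightarrow> e' s = (fst (e s) + snd (e s), snd (e s))" for l e e'
  proof (rule angle_change_cong)
    fix s :: real assume "s \<in> {0..1}"
    then have "triangle_map ?\<sigma> (e s) = H (e' s)"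
      using eq[of "fst (e s)" "snd (e s)"] that by simp
    then show "l s / (1 / \<theta> i (triangle_map ?\<sigma> (e s))) = l s * \<theta> i (H (e' s))" by simp
  qed
  note c = this
  show ?thesis
    using calculation
    unfolding winding_def variation_def square_simplex_faces
    using c[of "\<lambda>s. (1 - s, s)" "\<lambda>s. (1, s)"] c[of "\<lambda>s. (0, s)" "\<lambda>s. (s, s)"] c[of "\<lambda>s. (s, 0)" "\<lambda>s. (s, 0)"]
    by (auto simp: unit_triangle_def)
qed

text \<open>A square and its reflection share the diagonal, so both routes from corner to corner
  have the variation of the diagonal.\<close>

lemma variation_square:
  assumes L: "edge_lift L"
    and flat: "\<And>\<sigma> w. singular_simplex 2 Q \<sigma> \<Longrightarrow> triv unit_triangle (triangle_map \<sigma>) w \<Longrightarrow> winding L w \<sigma> = 0"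
    and H: "continuous_map (top_of_set ({0..1} \<times> {0..1})) Q H" and i: "i \<in> I" "H ` ({0..1} \<times> {0..1}) \<subseteq> U i"
  shows "variation L i (\<lambda>t. H (1, t)) + variation L i (\<lambda>t. H (t, 0)) =
         variation L i (\<lambda>t. H (t, 1)) + variation L i (\<lambda>t. H (0, t))"
proof -
  have "continuous_map (top_of_set ({0..1} \<times> {0..1})) (top_of_set ({0..1} \<times> {0..1})) (\<lambda>x::real\<times>real. (snd x, fst x))"
    by (auto intro!: continuous_intros)
  from continuous_map_compose[OF this H]
  have H': "continuous_map (top_of_set ({0..1} \<times> {0..1})) Q (\<lambda>(x, y). H (y, x))"
    by (simp add: o_def case_prod_beta')
  show ?thesis
    using variation_diagonal[OF L flat H i] variation_diagonal[OF L flat H' i(1)] i(2)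
    by (force simp: image_subset_iff)
qed

text \<open>For the constant square the rule for the diagonal reads \<open>v + v = v\<close>.
  Flatness is what forces this: an arbitrary edge lift could wind along a constant edge.\<close>

lemma variation_const:
  assumes L: "edge_lift L"
    and flat: "\<And>\<sigma> w. singular_simplex 2 Q \<sigma> \<Longrightarrow> triv unit_triangle (triangle_map \<sigma>) w \<Longrightarrow> winding L w \<sigma> = 0"
    and i: "i \<in> I" "q \<in> U i"
  shows "variation L i (\<lambda>_. q) = 0"
proof -
  have "q \<in> topspace Q" using openin_U[OF i(1)] i(2) openin_subset by blast
  then have "variation L i (\<lambda>_. q) + variation L i (\<lambda>_. q) = variation L i (\<lambda>_. q)"
    using variation_diagonal[OF L flat _ i(1), of "\<lambda>_. q"] i(2) by auto
  then show ?thesis by simp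
qed

end

lemma continuous_map_divide_const:
  fixes c :: "'a::real_normed_field"
  assumes "continuous_map X euclidean f"
  shows "continuous_map X euclidean (\<lambda>x. f x / c)"
proof -
  have "continuous_map euclidean euclidean (\<lambda>z. z / c)"
    by (auto simp: divide_inverse intro!: continuous_intros)
  from continuous_map_compose[OF assms this] show ?thesis by (simp add: o_def)
qed

context circle_cocycle
begin

theorem global_trivialisation:
  assumes cpt: "compact_space Q" "Hausdorff_space Q" and lpc: "locally_path_connected_space Q"
    and contr: "\<And>i. i \<in> I \<Longrightarrow> contractible_space (subtopology Q (U i))"
    and H2: "trivial_group (cohomology_group 2 Q (int_vec_group :: (int ^ 'n) monoid))"
  shows "\<exists>g. (\<forall>q\<in>topspace Q. norm (g q) = 1) \<and>
     (\<forall>i\<in>I. continuous_map (subtopology Q (U i)) euclidean (\<lambda>q. g q * \<theta> i q))"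
proof -
  obtain L where L: "edge_lift L"
    and flat: "\<And>\<sigma> w. singular_simplex 2 Q \<sigma> \<Longrightarrow> triv unit_triangle (triangle_map \<sigma>) w \<Longrightarrow> winding L w \<sigma> = 0"
    using flat_edge_lift_exists[OF H2] by blast
  have Usub: "U i \<subseteq> topspace Q" if "i \<in> I" for i
    using openin_subset[OF openin_U[OF that]] .
  have "\<exists>a h. continuous_map (prod_topology (top_of_set {0..1}) (subtopology Q (U i))) (subtopology Q (U i)) h \<and>
      (\<forall>x\<in>U i. h (0::real, x) = x \<and> h (1, x) = a)" if i: "i \<in> I" for i
  proof -
    obtain a where "homotopic_with (\<lambda>x. True) (subtopology Q (U i)) (subtopology Q (U i)) id (\<lambda>x. a)"
      using contr[OF i] unfolding contractible_space_def by blast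
    then obtain h where "continuous_map (prod_topology (top_of_set {0..1}) (subtopology Q (U i))) (subtopology Q (U i)) h"
      "\<forall>x. h (0::real, x) = id x" "\<forall>x. h (1, x) = a"
      unfolding homotopic_with_def by blast
    then show ?thesis by (intro exI[of _ a] exI[of _ h]) auto
  qed
  then obtain a h where h: "\<And>i. i \<in> I \<Longrightarrow>
      continuous_map (prod_topology (top_of_set {0..1}) (subtopology Q (U i))) (subtopology Q (U i)) (h i)"
    and h01: "\<And>i x. i \<in> I \<Longrightarrow> x \<in> U i \<Longrightarrow> h i (0::real, x) = x \<and> h i (1, x) = a i"
    by metis
  have h_in: "h i (s, x) \<in> U i" if "i \<in> I" "x \<in> U i" "s \<in> {0..1}" for i s x
    using continuous_map_image_subset_topspace[OF h[OF that(1)]] that Usub[OF that(1)] by force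
  \<comment> \<open>The flat lift is integrated along the contraction path from \<open>q\<close> to
    \<open>a i\<close>. The result is an angle of \<open>\<theta> i q\<close>, but it depends on
    \<open>q\<close> as discontinuously as \<open>L\<close> depends on the path.\<close>
  define \<phi> where "\<phi> i q = Arg (\<theta> i (a i)) - variation L i (\<lambda>s. h i (s, q))" for i q
  have hpath: "continuous_map (top_of_set {0..1}) Q (\<lambda>s. h i (s, q))" if i: "i \<in> I" and q: "q \<in> U i" for i q
  proof -
    have "continuous_map (top_of_set {0..1}) (prod_topology (top_of_set {0..1}) (subtopology Q (U i))) (\<lambda>s. (s, q))"
      using q Usub[OF i] by (auto simp: continuous_map_pairwise o_def)
    from continuous_map_compose[OF this h[OF i]] show ?thesis
      by (simp add: o_def continuous_map_in_subtopology)
  qed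
  have cis_\<phi>: "cis (\<phi> i q) = \<theta> i q" if i: "i \<in> I" and q: "q \<in> U i" for i q
  proof -
    have a: "a i \<in> U i" using h_in[OF i q, of 1] h01[OF i q] by simp
    have "norm (\<theta> i (a i)) = 1" by (rule norm_\<theta>[OF i a])
    moreover from this have "\<theta> i (a i) \<noteq> 0" by auto
    moreover have "cis (variation L i (\<lambda>s. h i (s, q))) = \<theta> i (a i) / \<theta> i q"
      using cis_variation[OF L hpath[OF i q] i] h_in[OF i q] h01[OF i q] by (simp add: image_subset_iff)
    ultimately show ?thesis
      by (simp add: \<phi>_def cis_Arg sgn_eq flip: cis_divide)
  qed
  have \<phi>_path: "\<phi> i (\<gamma> 1) - \<phi> i (\<gamma> 0) = variation L i \<gamma>"
    if i: "i \<in> I" and \<gamma>: "continuous_map (top_of_set {0..1}) Q \<gamma>" "\<gamma> ` {0..1} \<subseteq> U i" for i \<gamma>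
  proof -
    \<comment> \<open>The square swept out by contracting \<open>\<gamma>\<close>: one side is
      \<open>\<gamma>\<close>, the opposite side is constant at \<open>a i\<close>, and the other
      two are the contraction paths of the ends of \<open>\<gamma>\<close>.\<close>
    define H where "H = (\<lambda>x. h i (fst x, \<gamma> (snd x)))"
    have "continuous_map (top_of_set ({0..1} \<times> {0..1})) (prod_topology (top_of_set {0..1}) (subtopology Q (U i)))
        (\<lambda>x::real \<times> real. (fst x, \<gamma> (snd x)))"
    proof (rule continuous_map_pairedI)
      show "continuous_map (top_of_set ({0..1} \<times> {0..1})) (top_of_set {0..1}) (fst :: real \<times> real \<Rightarrow> real)"
        by (auto intro!: continuous_intros)
      have "continuous_map (top_of_set ({0..1} \<times> {0..1})) (top_of_set {0..1}) (snd :: real \<times> real \<Rightarrow> real)"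
        by (auto intro!: continuous_intros)
      from continuous_map_compose[OF this \<gamma>(1)] \<gamma>(2)
      show "continuous_map (top_of_set ({0..1} \<times> {0..1})) (subtopology Q (U i)) (\<lambda>x::real\<times>real. \<gamma> (snd x))"
        by (auto simp: continuous_map_in_subtopology o_def)
    qed
    from continuous_map_compose[OF this h[OF i]]
    have H: "continuous_map (top_of_set ({0..1} \<times> {0..1})) Q H"
      by (simp add: H_def o_def continuous_map_in_subtopology)
    have HU: "H ` ({0..1} \<times> {0..1}) \<subseteq> U i"
      using h_in[OF i] \<gamma>(2) by (auto simp: H_def)
    have \<gamma>U: "\<gamma> s \<in> U i" if "s \<in> {0..1}" for s using \<gamma>(2) that by auto
    have cong: "variation L i f = variation L i f'" if "\<And>s. s \<in> {0..1} \<Longrightarrow> f s = f' s" for f f'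
    proof -
      have "path_simplex f = path_simplex f'"
        using that simplex_1_coords by (auto simp: path_simplex_def fun_eq_iff restrict_def)
      then show ?thesis
        unfolding variation_def by (metis (mono_tags, lifting) angle_change_cong that)
    qed
    have "variation L i (\<lambda>t. H (1, t)) = variation L i (\<lambda>_. a i)"
      by (rule cong) (use h01[OF i] \<gamma>U in \<open>auto simp: H_def\<close>)
    also have "\<dots> = 0"
      using h_in[OF i \<gamma>U, of 0 1] h01[OF i \<gamma>U, of 0] by (intro variation_const[OF L flat i]) auto
    finally have 1: "variation L i (\<lambda>t. H (1, t)) = 0" .
    have 2: "variation L i (\<lambda>t. H (0, t)) = variation L i \<gamma>"
      by (rule cong) (use h01[OF i] \<gamma>U in \<open>auto simp: H_def\<close>)
    show ?thesis
      using variation_square[OF L flat H i HU] 1 2 by (simp add: \<phi>_def H_def)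
  qed
  have diff: "continuous_map (subtopology Q (U i \<inter> U j)) euclideanreal (\<lambda>q. \<phi> i q - \<phi> j q)"
    if i: "i \<in> I" and j: "j \<in> I" for i j
  proof (rule continuous_map_locally)
    fix q assume "q \<in> topspace (subtopology Q (U i \<inter> U j))"
    then have q: "q \<in> U i" "q \<in> U j" by auto
    define t where "t x = \<theta> i x / \<theta> j x" for x
    have t: "continuous_map (subtopology Q (U i \<inter> U j)) euclidean t"
      unfolding t_def by (rule continuous_quotient[OF i j])
    have nt: "norm (t x) = 1" if "x \<in> U i" "x \<in> U j" for x
      using norm_\<theta>[OF i, of x] norm_\<theta>[OF j, of x] that by (simp add: t_def norm_divide)
    have tq: "t q \<noteq> 0" using nt[OF q] by auto
    \<comment> \<open>On \<open>V\<close> the quotient \<open>t x / t q\<close> stays in the right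
      half plane, where \<open>Arg\<close> is continuous. Local path connectedness then gives a
      neighbourhood in which every point is reached from \<open>q\<close> without leaving
      \<open>V\<close>.\<close>
    define V where "V = {x \<in> topspace (subtopology Q (U i \<inter> U j)). t x / t q \<in> {z. Re z > 0}}"
    have "openin (subtopology Q (U i \<inter> U j)) V"
      unfolding V_def
      by (rule openin_continuous_map_preimage[where Y = euclidean])
        (use t open_halfspace_Re_gt[of 0] continuous_map_divide_const in auto)
    then have "openin Q V"
      using openin_U[OF i] openin_U[OF j] by (meson openin_Int openin_trans_full)
    moreover have "q \<in> V" using q tq Usub[OF i] by (auto simp: V_def)
    ultimately obtain T where T: "openin Q T" "path_connectedin Q T" "q \<in> T" "T \<subseteq> V"
      using lpc unfolding locally_path_connected_space by metis
    have TV: "x \<in> U i" "x \<in> U j" "Re (t x / t q) > 0" if "x \<in> T" for x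
      using that T by (auto simp: V_def)
    have key: "\<phi> i x - \<phi> j x = (\<phi> i q - \<phi> j q) + Arg (t x / t q)" if x: "x \<in> T" for x
    proof -
      have "path_connected_space (subtopology Q T)" using T by (simp add: path_connectedin_def)
      then obtain \<gamma> where "pathin (subtopology Q T) \<gamma>" "\<gamma> 0 = q" "\<gamma> 1 = x"
        unfolding path_connected_space_def using x T by (metis openin_subset topspace_subtopology_subset)
      then have \<gamma>: "continuous_map (top_of_set {0..1}) Q \<gamma>" "\<gamma> ` {0..1} \<subseteq> T" "\<gamma> 0 = q" "\<gamma> 1 = x"
        by (auto simp: pathin_def continuous_map_in_subtopology)
      have \<gamma>T: "\<gamma> s \<in> T" if "s \<in> {0..1}" for s using \<gamma>(2) that by auto
      have \<gamma>i: "\<gamma> ` {0..1} \<subseteq> U i" and \<gamma>j: "\<gamma> ` {0..1} \<subseteq> U j"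
        using \<gamma>T TV by auto
      define g where "g s = Arg (t (\<gamma> s) / t q) + Arg (t q)" for s
      have "continuous_map (top_of_set {0..1}) (subtopology Q (U i \<inter> U j)) \<gamma>"
        using \<gamma>(1) \<gamma>i \<gamma>j by (auto simp: continuous_map_in_subtopology)
      from continuous_map_compose[OF this t] have ct: "continuous_on {0..1} (\<lambda>s. t (\<gamma> s))"
        by (simp add: o_def)
      have "continuous_on {0..1} (\<lambda>s. Arg (t (\<gamma> s) / t q))"
      proof (rule continuous_on_compose2[of "{z. Re z > 0}" Arg])
        show "continuous_on {z. 0 < Re z} Arg"
          by (intro continuous_at_imp_continuous_on ballI continuous_at_Arg) (auto simp: complex_nonpos_Reals_iff)
      qed (use ct tq \<gamma>T TV in \<open>auto intro!: continuous_intros\<close>)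
      then have cg: "continuous_on {0..1} g"
        unfolding g_def by (intro continuous_on_add continuous_on_const)
      have tg: "t (\<gamma> s) = cis (g s)" if "s \<in> {0..1}" for s
      proof -
        have "norm (t (\<gamma> s)) = 1" using nt TV \<gamma>T[OF that] by auto
        moreover from this have "t (\<gamma> s) \<noteq> 0" by auto
        ultimately have "cis (Arg (t (\<gamma> s) / t q)) = t (\<gamma> s) / t q"
          using tq nt[OF q] by (simp add: cis_Arg sgn_eq norm_divide)
        moreover have "cis (Arg (t q)) = t q" using tq nt[OF q] by (simp add: cis_Arg sgn_eq)
        ultimately show ?thesis using tq by (simp add: g_def flip: cis_mult)
      qed
      \<comment> \<open>The same value of \<open>L\<close> enters both variations. It cancels in
        their difference, and only the angle change of the continuous transition function
        \<open>\<theta> i / \<theta> j\<close> remains.\<close>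
      have "variation L i \<gamma> = angle_change (\<lambda>s. (L (path_simplex \<gamma>) s * \<theta> j (\<gamma> s)) * cis (g s))"
        unfolding variation_def
      proof (rule angle_change_cong)
        fix s :: real assume s: "s \<in> {0..1}"
        have "\<theta> j (\<gamma> s) \<noteq> 0" using norm_\<theta>[OF j, of "\<gamma> s"] TV \<gamma>T[OF s] by auto
        then show "L (path_simplex \<gamma>) s * \<theta> i (\<gamma> s) = L (path_simplex \<gamma>) s * \<theta> j (\<gamma> s) * cis (g s)"
          by (simp add: tg[OF s, symmetric] t_def)
      qed
      also have "\<dots> = variation L j \<gamma> + (g 1 - g 0)"
        using angle_change_mult[OF circle_path_variation[OF L \<gamma>(1) j \<gamma>j] circle_path_cis[OF cg]]
          angle_change_cis[OF cg] by (simp add: variation_def)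
      also have "g 1 - g 0 = Arg (t x / t q)"
        using \<gamma>(3,4) tq by (simp add: g_def)
      finally show ?thesis
        using \<phi>_path[OF i \<gamma>(1) \<gamma>i] \<phi>_path[OF j \<gamma>(1) \<gamma>j] \<gamma>(3,4) by simp
    qed
    have "continuous_map (subtopology Q T) euclideanreal (\<lambda>x. (\<phi> i q - \<phi> j q) + Arg (t x / t q))"
    proof -
      have "T \<subseteq> U i \<inter> U j" using TV by auto
      then have "continuous_map (subtopology Q T) euclidean t"
        using continuous_map_from_subtopology_mono t by blast
      then have "continuous_map (subtopology Q T) euclidean (\<lambda>x. t x / t q)"
        by (rule continuous_map_divide_const)
      then have "continuous_map (subtopology Q T) (top_of_set {z. Re z > 0}) (\<lambda>x. t x / t q)"
        using TV by (auto simp: continuous_map_in_subtopology)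
      moreover have "continuous_map (top_of_set {z. Re z > 0}) euclideanreal Arg"
        by (auto intro!: continuous_at_imp_continuous_on continuous_at_Arg simp: complex_nonpos_Reals_iff)
      ultimately have "continuous_map (subtopology Q T) euclideanreal (Arg \<circ> (\<lambda>x. t x / t q))"
        by (rule continuous_map_compose)
      then show ?thesis by (intro continuous_intros) (auto simp: o_def)
    qed
    then have "continuous_map (subtopology Q T) euclideanreal (\<lambda>q. \<phi> i q - \<phi> j q)"
      by (rule continuous_map_eq) (auto simp: key)
    moreover have "subtopology (subtopology Q (U i \<inter> U j)) T = subtopology Q T"
      using TV by (simp add: subtopology_subtopology Int_absorb1 subset_iff)
    moreover have "openin (subtopology Q (U i \<inter> U j)) T"
      using T(1) TV openin_subtopology_Int2[of Q T "U i \<inter> U j"] by (metis Int_iff inf.absorb_iff2 subsetI)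
    ultimately show "\<exists>T. openin (subtopology Q (U i \<inter> U j)) T \<and> q \<in> T \<and>
       continuous_map (subtopology (subtopology Q (U i \<inter> U j)) T) euclideanreal (\<lambda>q. \<phi> i q - \<phi> j q)"
      using T(3) by (intro exI[of _ T]) auto
  qed
  have open_all: "\<forall>i\<in>I. openin Q (U i)" using openin_U by blast
  obtain P :: "'q set" and \<iota> \<rho> S where P: "finite P"
    "\<forall>p\<in>P. \<iota> p \<in> I \<and> continuous_map Q euclideanreal (\<rho> p) \<and> closedin Q (S p) \<and> S p \<subseteq> U (\<iota> p) \<and>
       (\<forall>q\<in>topspace Q - S p. \<rho> p q = 0)" "\<forall>q\<in>topspace Q. (\<Sum>p\<in>P. \<rho> p q) = 1"
    using compact_Hausdorff_finite_partition_of_unity[OF cpt open_all U_cover]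
    by blast
  \<comment> \<open>Averaging splits the real cocycle \<open>\<phi> i - \<phi> j\<close>: since the
    weights sum to 1, \<open>\<phi> i - f\<close> is the weighted sum of the continuous differences
    \<open>\<phi> i - \<phi> (\<iota> p)\<close>.\<close>
  define f where "f q = (\<Sum>p\<in>P. \<rho> p q * \<phi> (\<iota> p) q)" for q
  have "continuous_map (subtopology Q (U i)) euclidean (\<lambda>q. cis (- f q) * \<theta> i q)" if i: "i \<in> I" for i
  proof -
    \<comment> \<open>Outside \<open>U (\<iota> p)\<close> the difference need not be continuous,
      but there a neighbourhood avoids the closed set \<open>S p\<close>, and the summand is zero on
      it.\<close>
    have summand: "continuous_map (subtopology Q (U i)) euclideanreal (\<lambda>q. \<rho> p q * (\<phi> i q - \<phi> (\<iota> p) q))" if p: "p \<in> P" for p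
    proof (rule continuous_map_locally)
      fix q assume q: "q \<in> topspace (subtopology Q (U i))"
      show "\<exists>T. openin (subtopology Q (U i)) T \<and> q \<in> T \<and>
        continuous_map (subtopology (subtopology Q (U i)) T) euclideanreal (\<lambda>q. \<rho> p q * (\<phi> i q - \<phi> (\<iota> p) q))"
      proof (cases "q \<in> U (\<iota> p)")
        case True
        have "continuous_map (subtopology Q (U i \<inter> U (\<iota> p))) euclideanreal (\<lambda>q. \<rho> p q * (\<phi> i q - \<phi> (\<iota> p) q))"
          using diff[OF i, of "\<iota> p"] continuous_map_from_subtopology[of Q _ "\<rho> p"] P(2) p
          by (intro continuous_map_real_mult) blast+
        then show ?thesis
          using True q openin_U P(2) p
          by (intro exI[of _ "U i \<inter> U (\<iota> p)"]) (auto simp: subtopology_subtopology openin_subtopology_Int2)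
      next
        case False
        let ?T = "U i \<inter> (topspace Q - S p)"
        have "continuous_map (subtopology Q ?T) euclideanreal (\<lambda>q. \<rho> p q * (\<phi> i q - \<phi> (\<iota> p) q))"
          by (rule continuous_map_eq[of _ _ "\<lambda>_. 0"]) (use P(2) p in auto)
        moreover have "openin (subtopology Q (U i)) ?T"
          using P(2) p by (intro openin_subtopology_Int2) auto
        ultimately show ?thesis
          using False q P(2) p by (intro exI[of _ ?T]) (auto simp: subtopology_subtopology)
      qed
    qed
    have "continuous_map (subtopology Q (U i)) euclideanreal (\<lambda>q. \<Sum>p\<in>P. \<rho> p q * (\<phi> i q - \<phi> (\<iota> p) q))"
      using P(1) summand by (rule continuous_map_sum)
    moreover have "continuous_map euclideanreal euclidean cis"
      by (auto intro!: continuous_intros)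
    ultimately have c: "continuous_map (subtopology Q (U i)) euclidean
        (cis \<circ> (\<lambda>q. \<Sum>p\<in>P. \<rho> p q * (\<phi> i q - \<phi> (\<iota> p) q)))"
      by (rule continuous_map_compose)
    have eq: "(\<Sum>p\<in>P. \<rho> p q * (\<phi> i q - \<phi> (\<iota> p) q)) = \<phi> i q - f q" if "q \<in> topspace Q" for q
      using P(3) that by (simp add: f_def right_diff_distrib sum_subtractf flip: sum_distrib_right)
    show ?thesis
    proof (rule continuous_map_eq[OF c])
      fix q assume "q \<in> topspace (subtopology Q (U i))"
      then have "q \<in> topspace Q" "q \<in> U i" by auto
      then show "(cis \<circ> (\<lambda>q. \<Sum>p\<in>P. \<rho> p q * (\<phi> i q - \<phi> (\<iota> p) q))) q = cis (- f q) * \<theta> i q"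
        by (simp add: eq cis_\<phi>[OF i, symmetric] cis_mult)
    qed
  qed
  then show ?thesis
    by (intro exI[of _ "\<lambda>q. cis (- f q)"]) auto
qed

end

section \<open>Locally standard charts and the charts they induce on the orbit space\<close>

section \<open>The torus\<close>

lemma torus_mult: "s \<in> torus \<Longrightarrow> t \<in> torus \<Longrightarrow> s * t \<in> torus"
  by (simp add: torus_def norm_mult)

lemma one_in_torus: "1 \<in> torus"
  by (simp add: torus_def)

definition torus_inverse :: "complex ^ 'n \<Rightarrow> complex ^ 'n" where
  "torus_inverse t = (\<chi> i. inverse (t $ i))"

lemma torus_inverse: "t \<in> torus \<Longrightarrow> torus_inverse t \<in> torus"
  by (simp add: torus_def torus_inverse_def norm_inverse)

lemma torus_nonzero: "t \<in> torus \<Longrightarrow> t $ i \<noteq> 0"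
  by (auto simp: torus_def dest: spec[of _ i])

lemma torus_inverse_mult: "t \<in> torus \<Longrightarrow> torus_inverse t * t = 1" "t \<in> torus \<Longrightarrow> t * torus_inverse t = 1"
  by (auto simp: vec_eq_iff torus_inverse_def torus_nonzero)

lemma comm_group_torus: "comm_group torus_group"
proof (rule comm_groupI)
  fix t :: "complex ^ 'n" assume "t \<in> carrier torus_group"
  then show "\<exists>s\<in>carrier torus_group. s \<otimes>\<^bsub>torus_group\<^esub> t = \<one>\<^bsub>torus_group\<^esub>"
    by (intro bexI[of _ "torus_inverse t"]) (auto simp: torus_group_def torus_inverse torus_inverse_mult)
qed (auto simp: torus_group_def torus_mult one_in_torus mult_ac)

lemma torus_group_simps [simp]:
  "carrier torus_group = torus" "mult torus_group = (*)" "one torus_group = 1"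
  by (auto simp: torus_group_def)

lemma inv_torus_group: "t \<in> torus \<Longrightarrow> inv\<^bsub>torus_group\<^esub> t = torus_inverse t"
proof -
  interpret comm_group torus_group by (rule comm_group_torus)
  show "t \<in> torus \<Longrightarrow> inv\<^bsub>torus_group\<^esub> t = torus_inverse t"
    by (intro inv_equality) (auto simp: torus_inverse torus_inverse_mult)
qed

lemma torus_exp_in_torus: "torus_exp \<theta> \<in> torus"
  by (simp add: torus_exp_def torus_def)

lemma torus_exp_add: "torus_exp (a + b) = torus_exp a * torus_exp b"
  by (simp add: torus_exp_def vec_eq_iff cis_mult)

lemma torus_exp_0: "torus_exp 0 = 1"
  by (simp add: torus_exp_def vec_eq_iff)

lemma continuous_torus_exp: "continuous_on S torus_exp"
  unfolding torus_exp_def by (intro continuous_intros)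

lemma norm_vec_le_sum:
  fixes w :: "'a::real_normed_vector ^ 'n"
  shows "norm w \<le> (\<Sum>i\<in>UNIV. norm (w $ i))"
  unfolding norm_vec_def by (rule L2_set_le_sum) auto

lemma compact_torus: "compact (torus :: (complex ^ 'n) set)"
proof -
  have "closed (torus :: (complex ^ 'n) set)"
    unfolding torus_def by (intro closed_Collect_all closed_Collect_eq continuous_intros)
  moreover have "norm t \<le> real CARD('n)" if "t \<in> torus" for t :: "complex ^ 'n"
  proof -
    have "norm t \<le> (\<Sum>i\<in>UNIV. norm (t $ i))" by (rule norm_vec_le_sum)
    then show ?thesis using that by (simp add: torus_def)
  qed
  then have "bounded (torus :: (complex ^ 'n) set)" unfolding bounded_iff by blast
  ultimately show ?thesis by (simp add: compact_eq_bounded_closed)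
qed

definition zero_set :: "complex ^ 'n \<Rightarrow> 'n set" where
  "zero_set w = {i. w $ i = 0}"

definition coord_torus :: "'n set \<Rightarrow> (complex ^ 'n) set" where
  "coord_torus Z = {s \<in> torus. \<forall>i. i \<notin> Z \<longrightarrow> s $ i = 1}"

lemma mult_eq_self_iff: "s \<in> torus \<Longrightarrow> s * w = w \<longleftrightarrow> s \<in> coord_torus (zero_set w)"
  by (auto simp: coord_torus_def zero_set_def vec_eq_iff)

lemma norms_eq_iff:
  fixes v w :: "complex ^ 'n"
  shows "(\<exists>s\<in>torus. v = s * w) \<longleftrightarrow> (\<forall>i. norm (v $ i) = norm (w $ i))"
proof
  assume "\<exists>s\<in>torus. v = s * w"
  then show "\<forall>i. norm (v $ i) = norm (w $ i)" by (auto simp: norm_mult torus_def)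
next
  assume n: "\<forall>i. norm (v $ i) = norm (w $ i)"
  define s :: "complex ^ 'n" where "s = (\<chi> i. if w $ i = 0 then 1 else v $ i / w $ i)"
  have "norm (s $ i) = 1" for i
    using n[rule_format, of i] by (auto simp: s_def norm_divide)
  then have "s \<in> torus" by (simp add: torus_def)
  moreover have "v $ i = s $ i * w $ i" for i
    using n[rule_format, of i] by (auto simp: s_def)
  then have "v = s * w" by (auto simp: vec_eq_iff)
  ultimately show "\<exists>s\<in>torus. v = s * w" by blast
qed

definition abs_vec :: "complex ^ 'n \<Rightarrow> complex ^ 'n" where
  "abs_vec w = (\<chi> i. of_real (norm (w $ i)))"

lemma abs_vec: "\<exists>s\<in>torus. abs_vec w = s * w" "\<exists>s\<in>torus. w = s * abs_vec w"
  by (simp_all add: norms_eq_iff abs_vec_def)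

lemma abs_vec_cong: "(\<forall>i. norm (v $ i) = norm (w $ i)) \<Longrightarrow> abs_vec v = abs_vec w"
  by (simp add: abs_vec_def vec_eq_iff)

lemma continuous_abs_vec: "continuous_on S abs_vec"
  unfolding abs_vec_def by (intro continuous_intros)

lemma abs_vec_idem: "abs_vec (abs_vec w) = abs_vec w"
  by (simp add: abs_vec_def)

text \<open>The zero coordinates outside \<open>J\<close> are moved to a small positive number.
  Taking it real and positive keeps points of the orthant in the orthant. With \<open>J\<close>
  empty this yields nearby free points, with \<open>J = {j}\<close> points in the interior of a
  facet.\<close>

lemma perturb_zeros:
  fixes w :: "complex ^ 'n"
  assumes "open O'" "w \<in> O'" "J \<subseteq> zero_set w"
  obtains w' where "w' \<in> O'" "zero_set w' = J" "abs_vec w = w \<Longrightarrow> abs_vec w' = w'"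
proof -
  obtain e where e: "e > 0" "ball w e \<subseteq> O'" using assms(1,2) open_contains_ball by blast
  define \<delta> where "\<delta> = e / (2 * real CARD('n))"
  have \<delta>: "\<delta> > 0" using e by (simp add: \<delta>_def)
  define w' :: "complex ^ 'n" where "w' = (\<chi> i. if i \<in> zero_set w - J then of_real \<delta> else w $ i)"
  have "norm (w - w') \<le> (\<Sum>i\<in>UNIV. norm ((w - w') $ i))" by (rule norm_vec_le_sum)
  also have "\<dots> \<le> (\<Sum>i\<in>(UNIV::'n set). \<delta>)"
    using \<delta> by (intro sum_mono) (auto simp: w'_def zero_set_def)
  also have "\<dots> < e" using e by (simp add: \<delta>_def)
  finally have "w' \<in> O'" using e by (auto simp: dist_norm)
  moreover have "zero_set w' = J"
    using assms(3) \<delta> by (auto simp: w'_def zero_set_def)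
  moreover have "abs_vec w' = w'" if "abs_vec w = w"
  proof -
    have "of_real (norm (w $ i)) = w $ i" for i using that by (metis abs_vec_def vec_lambda_beta)
    then show ?thesis using \<delta> by (simp add: abs_vec_def w'_def vec_eq_iff)
  qed
  ultimately show ?thesis using that by blast
qed

section \<open>Continuous torus actions\<close>

locale torus_action =
  fixes X :: "'x topology" and act :: "complex ^ 'n \<Rightarrow> 'x \<Rightarrow> 'x"
  assumes action: "group_action torus_group (topspace X) act"
    and continuous_action: "continuous_map (prod_topology (top_of_set torus) X) X (\<lambda>(t, x). act t x)"
begin

abbreviation orb :: "'x \<Rightarrow> 'x set" where "orb \<equiv> orbit torus_group act"
abbreviation Q :: "'x set topology" where "Q \<equiv> orbit_space X act"
abbreviation stab :: "'x \<Rightarrow> (complex ^ 'n) set" where "stab \<equiv> stabilizer torus_group act"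

lemma act_in: "t \<in> torus \<Longrightarrow> x \<in> topspace X \<Longrightarrow> act t x \<in> topspace X"
  using group_action.element_image[OF action] by simp

lemma act_mult: "s \<in> torus \<Longrightarrow> t \<in> torus \<Longrightarrow> x \<in> topspace X \<Longrightarrow> act (s * t) x = act s (act t x)"
  using group_action.composition_rule[OF action] by simp

lemma act_one: "x \<in> topspace X \<Longrightarrow> act 1 x = x"
  using group_action.id_eq_one[OF action] by (metis restrict_apply' torus_group_simps(3))

lemma act_inverse: "t \<in> torus \<Longrightarrow> x \<in> topspace X \<Longrightarrow> act (torus_inverse t) (act t x) = x"
  by (simp add: act_one torus_inverse torus_inverse_mult flip: act_mult)

lemma act_inverse': "t \<in> torus \<Longrightarrow> x \<in> topspace X \<Longrightarrow> act t (act (torus_inverse t) x) = x"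
  by (simp add: act_one torus_inverse torus_inverse_mult flip: act_mult)

lemma continuous_map_act:
  assumes "continuous_map Y (top_of_set torus) f" "continuous_map Y X g"
  shows "continuous_map Y X (\<lambda>y. act (f y) (g y))"
  using continuous_map_compose[OF continuous_map_pairedI[OF assms] continuous_action] by (simp add: o_def)

lemma continuous_act: "t \<in> torus \<Longrightarrow> continuous_map X X (act t)"
  using continuous_map_act[of X "\<lambda>_. t" "\<lambda>x. x"] by simp

lemma openin_act:
  assumes "t \<in> torus" "openin X O'"
  shows "openin X (act t ` O')"
proof -
  have "O' \<subseteq> topspace X" using assms(2) by (rule openin_subset)
  have "act t ` O' = {x \<in> topspace X. act (torus_inverse t) x \<in> O'}"
  proof (intro equalityI subsetI)
    fix x assume "x \<in> {x \<in> topspace X. act (torus_inverse t) x \<in> O'}"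
    then show "x \<in> act t ` O'" using act_inverse'[OF assms(1), of x] by (metis (mono_tags) image_eqI mem_Collect_eq)
  qed (use \<open>O' \<subseteq> topspace X\<close> assms(1) act_in act_inverse in auto)
  then show ?thesis
    using openin_continuous_map_preimage[OF continuous_act[OF torus_inverse[OF assms(1)]] assms(2)] by simp
qed

lemma orb_eq_iff:
  assumes "x \<in> topspace X" "y \<in> topspace X"
  shows "orb x = orb y \<longleftrightarrow> (\<exists>t\<in>torus. y = act t x)"
proof
  assume "orb x = orb y"
  then have "y \<in> orb x" using group_action.orbit_refl[OF action assms(2)] by simp
  then show "\<exists>t\<in>torus. y = act t x" by (auto simp: orbit_def)
next
  assume "\<exists>t\<in>torus. y = act t x"
  then obtain t where t: "t \<in> torus" "y = act t x" by blast
  show "orb x = orb y"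
  proof (intro equalityI subsetI)
    fix z assume "z \<in> orb x"
    then obtain s where s: "s \<in> torus" "z = act s x" by (auto simp: orbit_def)
    then have "z = act (s * torus_inverse t) y"
      using t assms by (simp add: act_mult torus_inverse act_in act_inverse)
    then show "z \<in> orb y" using s t by (auto simp: orbit_def intro!: exI[of _ "s * torus_inverse t"] torus_mult torus_inverse)
  next
    fix z assume "z \<in> orb y"
    then obtain s where s: "s \<in> torus" "z = act s y" by (auto simp: orbit_def)
    then have "z = act (s * t) x" using t assms by (simp add: act_mult)
    then show "z \<in> orb x" using s t by (auto simp: orbit_def intro!: exI[of _ "s * t"] torus_mult)
  qed
qed

lemma orb_act: "x \<in> topspace X \<Longrightarrow> t \<in> torus \<Longrightarrow> orb (act t x) = orb x"
  by (metis act_in orb_eq_iff)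

lemma quotient_map_orb: "quotient_map X Q orb"
  unfolding orbit_space_def by (rule quotient_map_quotient_topology)

lemma topspace_Q: "topspace Q = orb ` topspace X"
  by (simp add: orbit_space_def topspace_quotient_topology)

lemma continuous_orb: "continuous_map X Q orb"
  using quotient_map_orb by (rule quotient_imp_continuous_map)

text \<open>The saturation of an open set is the union of its translates, which are open.\<close>

lemma openin_orb:
  assumes "openin X O'"
  shows "openin Q (orb ` O')"
proof -
  have sub: "O' \<subseteq> topspace X" using assms by (rule openin_subset)
  have "{x \<in> topspace X. orb x \<in> orb ` O'} = (\<Union>t\<in>torus. act t ` O')"
  proof (intro equalityI subsetI)
    fix x assume "x \<in> {x \<in> topspace X. orb x \<in> orb ` O'}"
    then obtain y where "x \<in> topspace X" "y \<in> O'" "orb y = orb x" by auto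
    then show "x \<in> (\<Union>t\<in>torus. act t ` O')" using orb_eq_iff[of y x] sub by auto
  qed (use sub act_in orb_act in auto)
  then show ?thesis
    unfolding orbit_space_def openin_quotient_topology using sub openin_act[OF _ assms] by auto
qed

lemma stab_iff: "t \<in> stab x \<longleftrightarrow> t \<in> torus \<and> act t x = x"
  by (simp add: stabilizer_def)

text \<open>Stabilisers along an orbit are conjugate, and the torus is commutative.\<close>

lemma stab_act:
  assumes "x \<in> topspace X" "t \<in> torus"
  shows "stab (act t x) = stab x"
proof -
  have "act s (act t x) = act t x \<longleftrightarrow> act s x = x" if "s \<in> torus" for s
  proof -
    have "act s (act t x) = act t (act s x)"
      using assms that by (metis act_mult mult.commute)
    then show ?thesis using assms that by (metis act_in act_inverse)
  qed
  then show ?thesis by (auto simp: stab_iff)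
qed

lemma stab_orb: "x \<in> topspace X \<Longrightarrow> y \<in> topspace X \<Longrightarrow> orb x = orb y \<Longrightarrow> stab x = stab y"
  using orb_eq_iff stab_act by metis

text \<open>This is the shape in which the identifications of the quotient construction are stated,
  with an isotropy group in place of the face torus.\<close>

lemma act_eq_iff:
  assumes "x \<in> topspace X" "s \<in> torus" "t \<in> torus"
  shows "act s x = act t x \<longleftrightarrow> torus_inverse s * t \<in> stab x"
proof -
  have "act (torus_inverse s * t) x = act (torus_inverse s) (act t x)"
    using assms by (simp add: act_mult torus_inverse)
  moreover have "act (torus_inverse s) (act t x) = x \<longleftrightarrow> act t x = act s x"
    using assms by (metis act_in act_inverse act_mult act_one torus_inverse torus_inverse_mult(2))
  ultimately show ?thesis
    using assms by (auto simp: stab_iff torus_mult torus_inverse)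
qed

end

section \<open>Locally standard charts\<close>

lemma smooth_on_imp_continuous_on: "smooth_on S f \<Longrightarrow> continuous_on S f"
  unfolding smooth_on_def by (metis Ck_on.simps(1))

lemma continuous_on_vec_mult:
  fixes f g :: "'a::topological_space \<Rightarrow> 'b::real_normed_algebra ^ 'n"
  shows "continuous_on S f \<Longrightarrow> continuous_on S g \<Longrightarrow> continuous_on S (\<lambda>x. f x * g x)"
  unfolding times_vec_def by (intro continuous_intros)

lemma BijGroup_subgroup_inverse:
  assumes "subgroup G (BijGroup S)" "g \<in> G"
  shows "inv_into S g ` S = S" "(\<lambda>x\<in>S. inv_into S g x) \<in> G" "bij_betw g S S"
proof -
  have g: "g \<in> Bij S" using assms subgroup.subset by (fastforce simp: BijGroup_def)
  then show "bij_betw g S S" by (simp add: Bij_def)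
  then show "inv_into S g ` S = S" by (simp add: bij_betw_imp_surj_on bij_betw_inv_into)
  show "(\<lambda>x\<in>S. inv_into S g x) \<in> G"
    using subgroup.m_inv_closed[OF assms] inv_BijGroup[OF g] by simp
qed

text \<open>The full preimage of the image of \<open>O'\<close> is the union of the preimages of
  \<open>O'\<close> under the elements of the local group, hence open; and the chart map is a
  quotient map onto an open set.\<close>

lemma chart_map_open:
  assumes c: "orbifold_chart X c" and O': "open O'" "O' \<subseteq> chart_dom c"
  shows "openin X (chart_map c ` O')"
proof -
  let ?D = "chart_dom c" and ?G = "chart_grp c" and ?\<phi> = "chart_map c"
  have sub: "subgroup ?G (BijGroup ?D)" and sm: "\<And>g. g \<in> ?G \<Longrightarrow> smooth_on ?D g"
    and op: "openin X (?\<phi> ` ?D)"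
    and q: "quotient_map (top_of_set ?D) (subtopology X (?\<phi> ` ?D)) ?\<phi>"
    and fib: "\<And>x y. x \<in> ?D \<Longrightarrow> y \<in> ?D \<Longrightarrow> ?\<phi> x = ?\<phi> y \<longleftrightarrow> (\<exists>g\<in>?G. g x = y)"
    using c by (auto simp: orbifold_chart_def)
  have "{x \<in> ?D. ?\<phi> x \<in> ?\<phi> ` O'} = (\<Union>g\<in>?G. {x \<in> ?D. g x \<in> O'})"
    using fib O'(2) by fastforce
  moreover have "openin (top_of_set ?D) {x \<in> ?D. g x \<in> O'}" if "g \<in> ?G" for g
    using continuous_openin_preimage_gen[OF smooth_on_imp_continuous_on[OF sm[OF that]] O'(1)]
    by (simp add: vimage_def Int_def)
  ultimately have "openin (top_of_set ?D) {x \<in> ?D. ?\<phi> x \<in> ?\<phi> ` O'}" by auto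
  moreover have "?\<phi> ` O' \<subseteq> topspace (subtopology X (?\<phi> ` ?D))"
    using O'(2) openin_subset[OF op] by auto
  ultimately have "openin (subtopology X (?\<phi> ` ?D)) (?\<phi> ` O')"
    using q[unfolded quotient_map_def topspace_euclidean_subtopology, THEN conjunct2, rule_format, of "?\<phi> ` O'"]
    by simp
  then show ?thesis using op openin_trans_full by blast
qed

text \<open>A locally standard chart with its local group replaced by the kernel of
  \<open>\<xi>\<close>: the map \<open>m\<close>, the composite of the chart map and
  \<open>\<psi>\<close>, is open and equivariant along \<open>\<xi>\<close>, and its fibres are the
  orbits of that kernel acting by multiplication.\<close>

locale torus_chart = torus_action X act
  for X :: "'x topology" and act :: "complex ^ 'n \<Rightarrow> 'x \<Rightarrow> 'x" +
  fixes W :: "(complex ^ 'n) set" and m :: "complex ^ 'n \<Rightarrow> 'x" and \<xi> :: "complex ^ 'n \<Rightarrow> complex ^ 'n"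
  assumes open_W: "open W"
    and torus_W: "s \<in> torus \<Longrightarrow> w \<in> W \<Longrightarrow> s * w \<in> W"
    and continuous_m: "continuous_map (top_of_set W) X m"
    and open_m: "open O' \<Longrightarrow> O' \<subseteq> W \<Longrightarrow> openin X (m ` O')"
    and \<xi>_mult: "s \<in> torus \<Longrightarrow> t \<in> torus \<Longrightarrow> \<xi> (s * t) = \<xi> s * \<xi> t"
    and \<xi>_surj: "\<xi> ` torus = torus"
    and continuous_\<xi>: "continuous_on torus \<xi>"
    and finite_kernel: "finite {s \<in> torus. \<xi> s = 1}"
    and m_mult: "s \<in> torus \<Longrightarrow> w \<in> W \<Longrightarrow> m (s * w) = act (\<xi> s) (m w)"
    and m_eqD: "w \<in> W \<Longrightarrow> w' \<in> W \<Longrightarrow> m w = m w' \<Longrightarrow> \<exists>s\<in>torus. \<xi> s = 1 \<and> w' = s * w"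

text \<open>The kernel of the covering homomorphism has as many elements as the local group, and acts with
  free orbits on the points without vanishing coordinates. There the two groups have the same orbits,
  hence everywhere by density.\<close>

lemma (in torus_action) standard_chart_imp_torus_chart:
  assumes sc: "standard_chart X \<U> act c W \<psi> \<xi>"
  shows "torus_chart X act W (\<lambda>w. chart_map c (\<psi> w)) \<xi>"
proof -
  let ?D = "chart_dom c" and ?G = "chart_grp c" and ?\<phi> = "chart_map c"
  define K where "K = {s \<in> torus. \<xi> s = 1}"
  have oc: "orbifold_chart X c" and W: "open W" "\<And>s w. s \<in> torus \<Longrightarrow> w \<in> W \<Longrightarrow> s * w \<in> W"
    and dif: "diffeo W ?D \<psi>" and hom: "\<xi> \<in> hom torus_group torus_group"
    and cov: "covering_space torus \<xi> torus"
    and iso: "torus_group\<lparr>carrier := kernel torus_group torus_group \<xi>\<rparr> \<cong> (BijGroup ?D)\<lparr>carrier := ?G\<rparr>"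
    and eqv: "\<And>s w. s \<in> torus \<Longrightarrow> w \<in> W \<Longrightarrow> ?\<phi> (\<psi> (s * w)) = act (\<xi> s) (?\<phi> (\<psi> w))"
    using sc by (auto simp: standard_chart_def orbifold_charts_def)
  have finG: "finite ?G" and sub: "subgroup ?G (BijGroup ?D)" and sm: "\<And>g. g \<in> ?G \<Longrightarrow> smooth_on ?D g"
    and op: "openin X (?\<phi> ` ?D)"
    and q: "quotient_map (top_of_set ?D) (subtopology X (?\<phi> ` ?D)) ?\<phi>"
    and fib: "\<And>x y. x \<in> ?D \<Longrightarrow> y \<in> ?D \<Longrightarrow> ?\<phi> x = ?\<phi> y \<longleftrightarrow> (\<exists>g\<in>?G. g x = y)"
    using oc by (auto simp: orbifold_chart_def)
  have bij: "bij_betw \<psi> W ?D" and c\<psi>: "continuous_on W \<psi>" and ci: "continuous_on ?D (inv_into W \<psi>)"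
    and "open ?D"
    using dif by (simp_all add: diffeo_def smooth_on_imp_continuous_on)
  have \<psi>W: "\<psi> w \<in> ?D" if "w \<in> W" for w using bij that by (auto simp: bij_betw_def)
  have inv: "inv_into W \<psi> (\<psi> w) = w" if "w \<in> W" for w
    using bij that by (simp add: bij_betw_inv_into_left)
  have invD: "\<psi> (inv_into W \<psi> x) = x" "inv_into W \<psi> x \<in> W" if "x \<in> ?D" for x
    using bij that by (auto simp: bij_betw_inv_into_right bij_betw_def inv_into_into)
  have K_eq: "kernel torus_group torus_group \<xi> = K" by (simp add: kernel_def K_def)
  obtain j where "bij_betw j K ?G"
    using iso by (auto simp: is_iso_def iso_def K_eq)
  then have finK: "finite K" and card: "card K = card ?G"
    using finG bij_betw_finite bij_betw_same_card by auto
  have \<xi>m: "\<xi> (s * t) = \<xi> s * \<xi> t" if "s \<in> torus" "t \<in> torus" for s t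
    using hom_mult[OF hom, of s t] that by simp
  have X\<phi>: "?\<phi> x \<in> topspace X" if "x \<in> ?D" for x
    using op openin_subset that by blast
  have mK: "?\<phi> (\<psi> (s * w)) = ?\<phi> (\<psi> w)" if "s \<in> K" "w \<in> W" for s w
    using eqv[of s w] that act_one X\<phi> \<psi>W by (auto simp: K_def)
  \<comment> \<open>The local group transported to \<open>W\<close>, where its orbits can be
    compared with those of the kernel acting by multiplication.\<close>
  define h where "h g w = inv_into W \<psi> (g (\<psi> w))" for g w
  have gD: "g x \<in> ?D" if "g \<in> ?G" "x \<in> ?D" for g x
    using BijGroup_subgroup_inverse(3)[OF sub that(1)] that(2) by (auto simp: bij_betw_def)
  have hW: "h g w \<in> W" if "g \<in> ?G" "w \<in> W" for g w
    unfolding h_def using invD(2) gD \<psi>W that by blast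
  have conth: "continuous_on W (h g)" if "g \<in> ?G" for g
  proof -
    have "continuous_on W (\<lambda>w. g (\<psi> w))"
      by (rule continuous_on_compose2[OF smooth_on_imp_continuous_on[OF sm[OF that]] c\<psi>]) (use \<psi>W in auto)
    then show ?thesis
      unfolding h_def by (rule continuous_on_compose2[OF ci]) (use \<psi>W gD that in auto)
  qed
  have free: "h g w \<in> (\<lambda>s. s * w) ` K" if g: "g \<in> ?G" and w: "w \<in> W" and z: "zero_set w = {}" for g w
  proof -
    have "inj_on (\<lambda>s. s * w) K"
      using z by (auto simp: inj_on_def vec_eq_iff zero_set_def)
    then have c1: "card ((\<lambda>s. s * w) ` K) = card ?G" by (simp add: card_image card)
    have "(\<lambda>s. s * w) ` K \<subseteq> (\<lambda>g. h g w) ` ?G"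
    proof
      fix v assume "v \<in> (\<lambda>s. s * w) ` K"
      then obtain s where s: "s \<in> K" "v = s * w" by blast
      then have v: "v \<in> W" using W(2) w by (auto simp: K_def)
      then obtain g' where "g' \<in> ?G" "g' (\<psi> w) = \<psi> v"
        using mK[OF s(1) w] fib[OF \<psi>W[OF w] \<psi>W[OF v]] s by auto
      then show "v \<in> (\<lambda>g. h g w) ` ?G" using inv[OF v] by (auto simp: h_def image_iff intro!: bexI[of _ g'])
    qed
    moreover have "card ((\<lambda>g. h g w) ` ?G) \<le> card ?G" using finG by (rule card_image_le)
    ultimately have "(\<lambda>s. s * w) ` K = (\<lambda>g. h g w) ` ?G"
      using finG c1 card_mono[of "(\<lambda>g. h g w) ` ?G" "(\<lambda>s. s * w) ` K"] by (intro card_subset_eq) auto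
    then show ?thesis using g by blast
  qed
  have all: "h g w \<in> (\<lambda>s. s * w) ` K" if g: "g \<in> ?G" and w: "w \<in> W" for g w
  proof -
    have "closedin (top_of_set W) {w \<in> W. h g w - s * w = 0}" for s
      by (rule continuous_closedin_preimage_constant)
        (intro continuous_on_diff conth[OF g] continuous_on_vec_mult continuous_on_const continuous_on_id)
    then have "closedin (top_of_set W) (\<Union>s\<in>K. {w \<in> W. h g w - s * w = 0})"
      using finK by (intro closedin_Union) auto
    define B where "B = {w \<in> W. h g w \<in> (\<lambda>s. s * w) ` K}"
    have "B = (\<Union>s\<in>K. {w \<in> W. h g w - s * w = 0})" by (auto simp: B_def)
    with \<open>closedin (top_of_set W) (\<Union>s\<in>K. {w \<in> W. h g w - s * w = 0})\<close>
    have "openin (top_of_set W) (W - B)"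
      by (simp only: closedin_def topspace_euclidean_subtopology)
    then have o: "open (W - B)"
      using W(1) openin_open_trans by blast
    show ?thesis
    proof (rule ccontr)
      assume "h g w \<notin> (\<lambda>s. s * w) ` K"
      then have "w \<in> W - B" using w by (simp add: B_def)
      then obtain w' where "w' \<in> W - B" "zero_set w' = {}"
        using perturb_zeros[OF o, of w "{}"] by blast
      then show False using free[OF g, of w'] by (simp add: B_def)
    qed
  qed
  show ?thesis
  proof
    show "continuous_map (top_of_set W) X (\<lambda>w. ?\<phi> (\<psi> w))"
    proof -
      have 1: "continuous_map (top_of_set W) (top_of_set ?D) \<psi>" using c\<psi> \<psi>W by auto
      have 2: "continuous_map (top_of_set ?D) X ?\<phi>"
        using quotient_imp_continuous_map[OF q] by (simp add: continuous_map_in_subtopology)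
      show ?thesis using continuous_map_compose[OF 1 2] by (simp add: o_def)
    qed
    show "openin X ((\<lambda>w. ?\<phi> (\<psi> w)) ` O')" if "open O'" "O' \<subseteq> W" for O'
    proof -
      have "\<psi> ` O' = ?D \<inter> inv_into W \<psi> -` O'"
      proof (intro equalityI subsetI)
        fix x assume "x \<in> \<psi> ` O'"
        then show "x \<in> ?D \<inter> inv_into W \<psi> -` O'" using that(2) inv \<psi>W by auto
      next
        fix x assume "x \<in> ?D \<inter> inv_into W \<psi> -` O'"
        then show "x \<in> \<psi> ` O'" using invD(1)[of x] by (metis IntE image_eqI vimageE)
      qed
      then have "open (\<psi> ` O')"
        using continuous_open_preimage[OF ci \<open>open ?D\<close> that(1)] by simp
      moreover have "\<psi> ` O' \<subseteq> ?D" using that \<psi>W by blast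
      ultimately have "openin X (?\<phi> ` \<psi> ` O')" by (rule chart_map_open[OF oc])
      then show ?thesis by (simp add: image_image)
    qed
    show "\<xi> ` torus = torus" using covering_space_imp_surjective[OF cov] .
    show "continuous_on torus \<xi>" using covering_space_imp_continuous[OF cov] .
    show "finite {s \<in> torus. \<xi> s = 1}" using finK by (simp add: K_def)
    show "\<exists>s\<in>torus. \<xi> s = 1 \<and> w' = s * w" if w: "w \<in> W" "w' \<in> W" "?\<phi> (\<psi> w) = ?\<phi> (\<psi> w')" for w w'
    proof -
      obtain g where g: "g \<in> ?G" "g (\<psi> w) = \<psi> w'" using fib[OF \<psi>W[OF w(1)] \<psi>W[OF w(2)]] w(3) by blast
      then have "h g w = w'" using inv[OF w(2)] by (simp add: h_def)
      then show ?thesis using all[OF g(1) w(1)] by (auto simp: K_def)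
    qed
  qed (fact W eqv \<xi>m)+
qed

context torus_chart
begin

lemma \<xi>_torus: "s \<in> torus \<Longrightarrow> \<xi> s \<in> torus"
  using \<xi>_surj by blast

lemma \<xi>_one: "\<xi> 1 = 1"
proof -
  have "\<xi> 1 * \<xi> 1 = \<xi> 1" using \<xi>_mult[OF one_in_torus one_in_torus] by simp
  then have "torus_inverse (\<xi> 1) * (\<xi> 1 * \<xi> 1) = torus_inverse (\<xi> 1) * \<xi> 1" by simp
  then show ?thesis
    using \<xi>_torus[OF one_in_torus] by (simp add: torus_inverse_mult flip: mult.assoc)
qed

lemma m_in: "w \<in> W \<Longrightarrow> m w \<in> topspace X"
  using continuous_m by (auto simp: continuous_map_def)

text \<open>If \<open>\<xi> s\<close> fixes \<open>m w\<close>, then \<open>s * w\<close> and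
  \<open>w\<close> have the same image, so \<open>k * s\<close> fixes \<open>w\<close> for some
  \<open>k\<close> in the kernel. The correction by \<open>k\<close> does not change the value of
  \<open>\<xi>\<close>.\<close>

lemma stab_m:
  assumes "w \<in> W"
  shows "stab (m w) = \<xi> ` coord_torus (zero_set w)"
proof (intro equalityI subsetI)
  fix t assume "t \<in> stab (m w)"
  then have t: "t \<in> torus" "act t (m w) = m w" by (auto simp: stab_iff)
  then obtain s where s: "s \<in> torus" "t = \<xi> s" using \<xi>_surj by blast
  then have "m (s * w) = m w" using t m_mult[OF s(1) assms] by simp
  then obtain k where k: "k \<in> torus" "\<xi> k = 1" "w = k * (s * w)"
    using m_eqD[OF torus_W[OF s(1) assms] assms] by blast
  then have "k * s \<in> coord_torus (zero_set w)"
    using mult_eq_self_iff[OF torus_mult[OF k(1) s(1)], of w] by (simp add: mult.assoc)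
  moreover have "t = \<xi> (k * s)" using k s \<xi>_mult by simp
  ultimately show "t \<in> \<xi> ` coord_torus (zero_set w)" by blast
next
  fix t assume "t \<in> \<xi> ` coord_torus (zero_set w)"
  then obtain s where s: "s \<in> coord_torus (zero_set w)" "t = \<xi> s" by blast
  then have "s \<in> torus" by (simp add: coord_torus_def)
  then have "s * w = w" using s mult_eq_self_iff by blast
  then show "t \<in> stab (m w)"
    using m_mult[OF \<open>s \<in> torus\<close> assms] s \<xi>_torus[OF \<open>s \<in> torus\<close>] by (simp add: stab_iff)
qed

text \<open>Since \<open>\<xi>\<close> is onto and the fibres of \<open>m\<close> lie in torus
  orbits, orbits in \<open>X\<close> over the chart correspond to orbits of the standard action on
  \<open>W\<close>. The moduli are therefore coordinates on the orbit space.\<close>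

lemma orb_m_eq_iff:
  assumes "w \<in> W" "w' \<in> W"
  shows "orb (m w) = orb (m w') \<longleftrightarrow> (\<forall>i. norm (w' $ i) = norm (w $ i))"
proof -
  have "orb (m w) = orb (m w') \<longleftrightarrow> (\<exists>s\<in>torus. m w' = act (\<xi> s) (m w))"
    using orb_eq_iff[OF m_in[OF assms(1)] m_in[OF assms(2)]] \<xi>_surj by (metis \<xi>_torus imageE)
  also have "\<dots> \<longleftrightarrow> (\<exists>s\<in>torus. m (s * w) = m w')" using m_mult assms by metis
  also have "\<dots> \<longleftrightarrow> (\<exists>s\<in>torus. w' = s * w)"
  proof
    assume "\<exists>s\<in>torus. m (s * w) = m w'"
    then obtain s where s: "s \<in> torus" "m (s * w) = m w'" by blast
    then obtain k where "k \<in> torus" "w' = k * (s * w)"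
      using m_eqD[OF torus_W[OF s(1) assms(1)] assms(2)] by blast
    then show "\<exists>s\<in>torus. w' = s * w" using s torus_mult by (auto intro!: bexI[of _ "k * s"] simp: mult.assoc)
  qed auto
  finally show ?thesis unfolding norms_eq_iff .
qed

lemma abs_vec_in: "w \<in> W \<Longrightarrow> abs_vec w \<in> W"
  using abs_vec(1)[of w] torus_W[of _ w] by metis

lemma orb_m_abs_vec: "w \<in> W \<Longrightarrow> orb (m (abs_vec w)) = orb (m w)"
  using orb_m_eq_iff[OF _ abs_vec_in, of w w] by (simp add: abs_vec_def)

lemma in_W_if_abs_vec_in:
  assumes "abs_vec w \<in> W"
  shows "w \<in> W"
proof -
  obtain s where s: "s \<in> torus" "w = s * abs_vec w" using abs_vec(2) by blast
  show ?thesis by (subst s(2)) (rule torus_W[OF s(1) assms])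
qed

lemma open_orb_m: "open O' \<Longrightarrow> O' \<subseteq> W \<Longrightarrow> openin Q ((\<lambda>w. orb (m w)) ` O')"
  using openin_orb[OF open_m] by (simp add: image_image)

lemma quotient_map_orb_m:
  assumes "open N" "N \<subseteq> W"
  shows "quotient_map (top_of_set N) (subtopology Q ((\<lambda>w. orb (m w)) ` N)) (\<lambda>w. orb (m w))"
proof (rule continuous_open_imp_quotient_map)
  have "continuous_map (top_of_set N) X m"
    using continuous_m assms(2) continuous_map_from_subtopology_mono by blast
  from continuous_map_compose[OF this continuous_orb]
  show "continuous_map (top_of_set N) (subtopology Q ((\<lambda>w. orb (m w)) ` N)) (\<lambda>w. orb (m w))"
    by (auto simp: continuous_map_in_subtopology o_def)
  show "open_map (top_of_set N) (subtopology Q ((\<lambda>w. orb (m w)) ` N)) (\<lambda>w. orb (m w))"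
    unfolding open_map_def
  proof (intro allI impI)
    fix O' assume O': "openin (top_of_set N) O'"
    then have "openin Q ((\<lambda>w. orb (m w)) ` O')"
      using assms open_orb_m[of O'] openin_open_trans openin_imp_subset by (metis dual_order.trans)
    moreover have "O' \<subseteq> N" using O' openin_imp_subset by blast
    ultimately show "openin (subtopology Q ((\<lambda>w. orb (m w)) ` N)) ((\<lambda>w. orb (m w)) ` O')"
      by (metis image_mono inf.absorb_iff2 openin_subtopology_Int2)
  qed
  show "(\<lambda>w. orb (m w)) ` topspace (top_of_set N) = topspace (subtopology Q ((\<lambda>w. orb (m w)) ` N))"
    using assms(2) m_in by (auto simp: topspace_Q)
qed

definition dom_orb :: "'x set set" where "dom_orb = (\<lambda>w. orb (m w)) ` W"

text \<open>The arbitrary choice of \<open>w\<close> is undone by \<open>abs_vec\<close>, because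
  all points over \<open>q\<close> have the same moduli. This is the representative of
  \<open>q\<close> in the orthant.\<close>

definition rep :: "'x set \<Rightarrow> complex ^ 'n" where
  "rep q = abs_vec (SOME w. w \<in> W \<and> orb (m w) = q)"

lemma rep_orb_m:
  assumes "w \<in> W"
  shows "rep (orb (m w)) = abs_vec w"
proof -
  have "\<exists>w'. w' \<in> W \<and> orb (m w') = orb (m w)" using assms by blast
  from someI_ex[OF this] show ?thesis
    unfolding rep_def using assms orb_m_eq_iff by (intro abs_vec_cong) blast
qed

lemma rep:
  assumes "q \<in> dom_orb"
  shows "rep q \<in> W" "orb (m (rep q)) = q" "abs_vec (rep q) = rep q"
proof -
  obtain w where w: "w \<in> W" "q = orb (m w)" using assms by (auto simp: dom_orb_def)
  show "rep q \<in> W" "orb (m (rep q)) = q" "abs_vec (rep q) = rep q"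
    unfolding w(2) rep_orb_m[OF w(1)] by (rule abs_vec_in[OF w(1)] orb_m_abs_vec[OF w(1)] abs_vec_idem)+
qed

lemma openin_dom_orb: "openin Q dom_orb"
  unfolding dom_orb_def by (rule open_orb_m[OF open_W]) simp

text \<open>Pulled back to \<open>W\<close> the map is \<open>abs_vec\<close>, and \<open>W\<close>
  maps to the orbit space by a quotient map onto an open set.\<close>

lemma continuous_rep: "continuous_map (subtopology Q dom_orb) (top_of_set W) rep"
proof -
  have "continuous_map (top_of_set W) (top_of_set W) (rep \<circ> (\<lambda>w. orb (m w)))"
    using continuous_abs_vec abs_vec_in
    by (rule_tac continuous_map_eq[of _ _ abs_vec]) (auto simp: rep_orb_m)
  then show ?thesis
    by (simp only: dom_orb_def continuous_compose_quotient_map_eq[OF quotient_map_orb_m[OF open_W order_refl]])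
qed

definition local_section :: "'x set \<Rightarrow> 'x" where "local_section q = m (rep q)"

lemma continuous_local_section: "continuous_map (subtopology Q dom_orb) X local_section"
  using continuous_map_compose[OF continuous_rep continuous_m] by (simp add: local_section_def[abs_def] o_def)

lemma orb_local_section: "q \<in> dom_orb \<Longrightarrow> orb (local_section q) = q"
  by (simp add: local_section_def rep)

lemma local_section_in: "q \<in> dom_orb \<Longrightarrow> local_section q \<in> topspace X"
  by (simp add: local_section_def rep m_in)

end

section \<open>The covering homomorphism on Lie algebras\<close>

lemma additive_continuous_imp_linear:
  fixes f :: "'a::real_normed_vector \<Rightarrow> 'b::real_normed_vector"
  assumes add: "\<And>x y. f (x + y) = f x + f y" and cont: "continuous_on UNIV f"
  shows "linear f"
proof (rule linearI)
  fix r :: real and x :: 'a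
  interpret Modules.additive f by standard (rule add)
  have nat: "f (of_nat n *\<^sub>R y) = of_nat n *\<^sub>R f y" for n y
    by (induction n) (simp_all add: zero add scaleR_add_left)
  have rat: "f (q *\<^sub>R x) = q *\<^sub>R f x" if "q \<in> \<rat>" for q
  proof -
    have pos: "f (q *\<^sub>R x) = q *\<^sub>R f x" if q: "q \<in> \<rat>" "q \<ge> 0" for q
    proof -
      obtain m n :: nat where n: "n \<noteq> 0" and "\<bar>q\<bar> = of_nat m / of_nat n"
        using Rats_abs_nat_div_natE[OF q(1)] by blast
      then have "q = of_nat m / of_nat n" using q(2) by simp
      then have "of_nat n *\<^sub>R (q *\<^sub>R x) = of_nat m *\<^sub>R x" using n by simp
      then have "of_nat n *\<^sub>R f (q *\<^sub>R x) = of_nat m *\<^sub>R f x" using nat by metis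
      then have "inverse (of_nat n) *\<^sub>R (of_nat n *\<^sub>R f (q *\<^sub>R x)) = inverse (of_nat n) *\<^sub>R (of_nat m *\<^sub>R f x)"
        by simp
      then show ?thesis using n \<open>q = of_nat m / of_nat n\<close> by (simp add: divide_inverse mult.commute)
    qed
    show ?thesis
    proof (cases "q \<ge> 0")
      case False
      then show ?thesis using pos[of "- q"] that minus by (simp add: minus)
    qed (use pos that in blast)
  qed
  have "f (r *\<^sub>R x) - r *\<^sub>R f x = 0"
  proof (rule continuous_constant_on_closure[of \<rat> "\<lambda>q. f (q *\<^sub>R x) - q *\<^sub>R f x"])
    show "continuous_on (closure \<rat>) (\<lambda>q. f (q *\<^sub>R x) - q *\<^sub>R f x)"
      by (intro continuous_intros continuous_on_compose2[OF cont]) auto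
  qed (auto simp: rat Rats_closure_real)
  then show "f (r *\<^sub>R x) = r *\<^sub>R f x" by simp
qed (rule add)

text \<open>A continuous function on the line with finite range is constant, and the angle of a
  constant function does not grow. This turns the finiteness of the kernel of \<open>\<xi>\<close>
  into statements on Lie algebras.\<close>

lemma cis_finite_range_imp_zero:
  assumes "finite F" "\<And>s. cis (s * r) \<in> F"
  shows "r = 0"
proof -
  have "(\<lambda>s. cis (s * r)) constant_on UNIV"
  proof (rule continuous_finite_range_constant)
    show "finite (range (\<lambda>s. cis (s * r)))"
      by (rule finite_subset[OF _ assms(1)]) (use assms(2) in auto)
  qed (auto intro!: continuous_intros)
  then obtain c where "\<And>s. cis (s * r) = c" unfolding constant_on_def by auto
  then have "cis (s * r) = cis (0 * r)" for s by metis
  then have "1 * r - 0 * r = 0 - (0::real)"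
    by (intro cis_lift_unique[of UNIV "\<lambda>s. s * r" "\<lambda>s. 0"]) (auto intro!: continuous_intros)
  then show ?thesis by simp
qed

context torus_chart
begin

definition lie_map :: "real ^ 'n \<Rightarrow> real ^ 'n" where
  "lie_map = (SOME A. linear A \<and> (\<forall>\<theta>. \<xi> (torus_exp \<theta>) = torus_exp (A \<theta>)))"

text \<open>The differential of \<open>\<xi>\<close> is obtained by lifting the coordinates of
  \<open>\<xi> (torus_exp \<theta>)\<close> to angles that vanish at 0. Uniqueness of lifts makes
  them additive, and a continuous additive map is linear.\<close>

lemma lie_map: "linear lie_map" "\<xi> (torus_exp \<theta>) = torus_exp (lie_map \<theta>)"
proof -
  have c: "continuous_on UNIV (\<lambda>\<theta>. \<xi> (torus_exp \<theta>))"
    by (rule continuous_on_compose2[OF continuous_\<xi> continuous_torus_exp]) (auto simp: torus_exp_in_torus)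
  have "\<exists>g::real ^ 'n \<Rightarrow> real. continuous_on UNIV g \<and> (\<forall>\<theta>. \<xi> (torus_exp \<theta>) $ i = cis (g \<theta>))" for i
  proof -
    have "continuous_on UNIV (\<lambda>\<theta>. \<xi> (torus_exp \<theta>) $ i)" using c by (intro continuous_intros)
    moreover have "norm (\<xi> (torus_exp \<theta>) $ i) = 1" for \<theta>
      using \<xi>_torus[OF torus_exp_in_torus, of \<theta>] by (simp add: torus_def)
    ultimately obtain g :: "real ^ 'n \<Rightarrow> real"
      where "continuous_on UNIV g" "\<And>\<theta>. \<theta> \<in> UNIV \<Longrightarrow> \<xi> (torus_exp \<theta>) $ i = cis (g \<theta>)"
      using continuous_cis_lift[of UNIV "\<lambda>\<theta>. \<xi> (torus_exp \<theta>) $ i"] contractible_UNIV by blast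
    then show ?thesis by blast
  qed
  then obtain g where g: "\<And>i. continuous_on UNIV (g i)" "\<And>i \<theta>. \<xi> (torus_exp \<theta>) $ i = cis (g i \<theta>)"
    by metis
  define A :: "real ^ 'n \<Rightarrow> real ^ 'n" where "A \<theta> = (\<chi> i. g i \<theta> - g i 0)" for \<theta>
  have "cis (g i 0) = 1" for i
    using g(2)[of 0 i] by (simp add: torus_exp_0 \<xi>_one)
  then have "torus_exp (A \<theta>) $ i = cis (g i \<theta>)" for \<theta> i
    by (simp add: A_def torus_exp_def flip: cis_divide)
  then have A: "\<xi> (torus_exp \<theta>) = torus_exp (A \<theta>)" for \<theta>
    by (simp add: vec_eq_iff g(2))
  have contA: "continuous_on UNIV A" unfolding A_def by (intro continuous_intros g(1))
  have "A (x + y) = A x + A y" for x y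
  proof -
    have "(A (x + y) - A (0 + y)) $ i = (A x + A y - (A 0 + A y)) $ i" for i
    proof -
      have ci: "continuous_on UNIV (\<lambda>x. A x $ i)" using contA by (intro continuous_intros)
      have "A (x + y) $ i - A (0 + y) $ i = (A x $ i + A y $ i) - (A 0 $ i + A y $ i)"
      proof (rule cis_lift_unique[of UNIV "\<lambda>x. A (x + y) $ i" "\<lambda>x. A x $ i + A y $ i"])
        show "cis (A (z + y) $ i) = cis (A z $ i + A y $ i)" for z
        proof -
          have "torus_exp (A (z + y)) = torus_exp (A z) * torus_exp (A y)"
            using A \<xi>_mult torus_exp_in_torus torus_exp_add by metis
          then show ?thesis by (simp add: torus_exp_def vec_eq_iff cis_mult)
        qed
        show "continuous_on UNIV (\<lambda>x. A (x + y) $ i)"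
          by (rule continuous_on_compose2[OF ci]) (auto intro!: continuous_intros)
        show "continuous_on UNIV (\<lambda>x. A x $ i + A y $ i)" by (intro continuous_on_add ci continuous_on_const)
      qed auto
      then show ?thesis by simp
    qed
    moreover have "A 0 = 0" by (simp add: A_def vec_eq_iff)
    ultimately show ?thesis by (simp add: vec_eq_iff diff_eq_eq)
  qed
  then have "linear A" using contA by (rule additive_continuous_imp_linear)
  then have "\<exists>A. linear A \<and> (\<forall>\<theta>. \<xi> (torus_exp \<theta>) = torus_exp (A \<theta>))" using A by blast
  then have "linear lie_map \<and> (\<forall>\<theta>. \<xi> (torus_exp \<theta>) = torus_exp (lie_map \<theta>))"
    unfolding lie_map_def by (rule someI_ex)
  then show "linear lie_map" "\<xi> (torus_exp \<theta>) = torus_exp (lie_map \<theta>)" by blast+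
qed

text \<open>A vector killed by the differential spans a one-parameter subgroup inside the finite
  kernel, which must then be constant.\<close>

lemma inj_lie_map: "inj lie_map"
proof -
  have "v = 0" if v: "lie_map v = 0" for v
  proof -
    have "torus_exp (s *\<^sub>R v) \<in> {s \<in> torus. \<xi> s = 1}" for s
      using v lie_map by (simp add: linear_scale torus_exp_in_torus torus_exp_0)
    then have "cis (s * v $ i) \<in> (\<lambda>t. t $ i) ` {s \<in> torus. \<xi> s = 1}" for s i
      by (force simp: torus_exp_def intro: image_eqI[of _ _ "torus_exp (s *\<^sub>R v)"])
    then have "v $ i = 0" for i
      using cis_finite_range_imp_zero[OF finite_imageI[OF finite_kernel]] by blast
    then show ?thesis by (simp add: vec_eq_iff)
  qed
  then show ?thesis using linear_injective_0[OF lie_map(1)] by blast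
qed

lemma surj_lie_map: "surj lie_map"
  by (rule linear_injective_imp_surjective[OF lie_map(1) inj_lie_map]) simp

text \<open>If \<open>\<xi>\<close> takes the same value at \<open>torus_exp (s *\<^sub>R u)\<close>
  and at \<open>z\<close> in the coordinate torus, their quotient lies in the finite kernel.
  Coordinates outside \<open>Z\<close> are not affected by \<open>z\<close>, so there
  \<open>u\<close> generates a finite set of phases and vanishes.\<close>

lemma lie_algebra_coord_torus:
  "{v. \<forall>s. torus_exp (s *\<^sub>R v) \<in> \<xi> ` coord_torus Z} = lie_map ` {u. \<forall>i. i \<notin> Z \<longrightarrow> u $ i = 0}"
proof (intro equalityI subsetI)
  fix v assume v: "v \<in> {v. \<forall>s. torus_exp (s *\<^sub>R v) \<in> \<xi> ` coord_torus Z}"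
  obtain u where u: "v = lie_map u" using surj_lie_map by blast
  have "u $ i = 0" if i: "i \<notin> Z" for i
  proof (rule cis_finite_range_imp_zero[of "(\<lambda>t. t $ i) ` {s \<in> torus. \<xi> s = 1}"])
    fix s :: real
    have "\<xi> (torus_exp (s *\<^sub>R u)) \<in> \<xi> ` coord_torus Z"
      using v lie_map by (simp add: u linear_scale)
    then obtain z where z: "z \<in> coord_torus Z" "\<xi> (torus_exp (s *\<^sub>R u)) = \<xi> z" by auto
    then have zt: "z \<in> torus" by (simp add: coord_torus_def)
    let ?k = "torus_exp (s *\<^sub>R u) * torus_inverse z"
    have "\<xi> ?k = \<xi> z * \<xi> (torus_inverse z)"
      using z zt by (simp add: \<xi>_mult torus_exp_in_torus torus_inverse)
    also have "\<dots> = 1" using zt by (simp add: torus_inverse torus_inverse_mult \<xi>_one flip: \<xi>_mult)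
    finally have k: "?k \<in> {s \<in> torus. \<xi> s = 1}" using zt by (simp add: torus_mult torus_exp_in_torus torus_inverse)
    have "cis (s * u $ i) = ?k $ i"
      using z i by (simp add: torus_exp_def torus_inverse_def coord_torus_def)
    then show "cis (s * u $ i) \<in> (\<lambda>t. t $ i) ` {s \<in> torus. \<xi> s = 1}" using k by (rule image_eqI)
  qed (use finite_kernel in simp)
  then show "v \<in> lie_map ` {u. \<forall>i. i \<notin> Z \<longrightarrow> u $ i = 0}" using u by blast
next
  fix v assume "v \<in> lie_map ` {u. \<forall>i. i \<notin> Z \<longrightarrow> u $ i = 0}"
  then obtain u where u: "v = lie_map u" "\<forall>i. i \<notin> Z \<longrightarrow> u $ i = 0" by blast
  have "torus_exp (s *\<^sub>R v) = \<xi> (torus_exp (s *\<^sub>R u))" for s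
    using lie_map by (simp add: u(1) linear_scale)
  moreover have "torus_exp (s *\<^sub>R u) \<in> coord_torus Z" for s
    using u(2) torus_exp_in_torus[of "s *\<^sub>R u"] by (simp add: coord_torus_def torus_exp_def)
  ultimately show "v \<in> {v. \<forall>s. torus_exp (s *\<^sub>R v) \<in> \<xi> ` coord_torus Z}" by auto
qed

lemma lie_algebra_stab:
  "w \<in> W \<Longrightarrow> {v. \<forall>s. torus_exp (s *\<^sub>R v) \<in> stab (m w)} = lie_map ` {u. \<forall>i. i \<notin> zero_set w \<longrightarrow> u $ i = 0}"
  by (simp only: stab_m lie_algebra_coord_torus)

end

section \<open>Neighbourhoods in the orbit space\<close>

text \<open>Only moduli are restricted, so the set is invariant under the torus, and its image in
  the orbit space is a box in the orthant.\<close>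

definition box_at :: "complex ^ 'n \<Rightarrow> real \<Rightarrow> (complex ^ 'n) set" where
  "box_at w0 \<epsilon> = {w. \<forall>i. \<bar>norm (w $ i) - norm (w0 $ i)\<bar> < \<epsilon>}"

lemma open_box_at:
  fixes w0 :: "complex ^ 'n"
  shows "open (box_at w0 \<epsilon>)"
proof -
  have "box_at w0 \<epsilon> = (\<Inter>i. {w. \<bar>norm (w $ i) - norm (w0 $ i)\<bar> < \<epsilon>})" by (auto simp: box_at_def)
  moreover have "open {w :: complex ^ 'n. \<bar>norm (w $ i) - norm (w0 $ i)\<bar> < \<epsilon>}" for i
    by (intro open_Collect_less continuous_intros)
  ultimately show ?thesis by (simp add: open_INT)
qed

definition coord_box :: "complex ^ 'n \<Rightarrow> real \<Rightarrow> (real ^ 'n) set" where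
  "coord_box w0 \<epsilon> = {r. \<forall>i. 0 \<le> r $ i \<and> \<bar>r $ i - norm (w0 $ i)\<bar> < \<epsilon>}"

definition cpx :: "real ^ 'n \<Rightarrow> complex ^ 'n" where
  "cpx r = (\<chi> i. of_real (r $ i))"

definition norms :: "complex ^ 'n \<Rightarrow> real ^ 'n" where
  "norms w = (\<chi> i. norm (w $ i))"

lemma convex_coord_box:
  fixes w0 :: "complex ^ 'n"
  shows "convex (coord_box w0 \<epsilon>)"
proof -
  have "linear (\<lambda>r :: real ^ 'n. r $ i)" for i
    using bounded_linear.linear bounded_linear_vec_nth by blast
  then have "convex ((\<lambda>r. r $ i) -` ({0..} \<inter> ball (norm (w0 $ i)) \<epsilon>))" for i
    by (intro convex_linear_vimage convex_Int convex_ball) auto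
  moreover have "(\<lambda>r :: real ^ 'n. r $ i) -` ({0..} \<inter> ball (norm (w0 $ i)) \<epsilon>) =
      {r. 0 \<le> r $ i \<and> \<bar>r $ i - norm (w0 $ i)\<bar> < \<epsilon>}" for i
    by (auto simp: dist_real_def abs_minus_commute)
  ultimately have "convex {r :: real ^ 'n. 0 \<le> r $ i \<and> \<bar>r $ i - norm (w0 $ i)\<bar> < \<epsilon>}" for i
    by metis
  moreover have "coord_box w0 \<epsilon> = (\<Inter>i. {r. 0 \<le> r $ i \<and> \<bar>r $ i - norm (w0 $ i)\<bar> < \<epsilon>})"
    by (auto simp: coord_box_def)
  ultimately show ?thesis by (simp add: convex_INT)
qed

context torus_chart
begin

text \<open>A point of the box may be far from \<open>rep q\<close>, but its vector of moduli is
  close to it: the sum norm explains the division by the number of coordinates. Invariance under the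
  torus carries the conclusion back to the point.\<close>

lemma box_neighbourhood:
  assumes O': "openin Q O'" and q: "q \<in> O'" "q \<in> dom_orb"
  obtains \<epsilon> where "\<epsilon> > 0" "box_at (rep q) \<epsilon> \<subseteq> W" "(\<lambda>w. orb (m w)) ` box_at (rep q) \<epsilon> \<subseteq> O'"
proof -
  let ?w0 = "rep q"
  have "continuous_map (top_of_set W) Q (\<lambda>w. orb (m w))"
    using continuous_map_compose[OF continuous_m continuous_orb] by (simp add: o_def)
  from openin_continuous_map_preimage[OF this O']
  have "openin (top_of_set W) {w \<in> W. orb (m w) \<in> O'}" by simp
  then have "open {w \<in> W. orb (m w) \<in> O'}" using open_W openin_open_trans by blast
  moreover have "?w0 \<in> {w \<in> W. orb (m w) \<in> O'}" using rep[OF q(2)] q(1) by simp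
  ultimately obtain e where e: "e > 0" "ball ?w0 e \<subseteq> {w \<in> W. orb (m w) \<in> O'}"
    using open_contains_ball by blast
  define \<epsilon> where "\<epsilon> = e / real CARD('n)"
  have *: "w \<in> W \<and> orb (m w) \<in> O'" if w: "w \<in> box_at ?w0 \<epsilon>" for w
  proof -
    have "norm (?w0 - abs_vec w) \<le> (\<Sum>i\<in>UNIV. norm ((?w0 - abs_vec w) $ i))" by (rule norm_vec_le_sum)
    also have "\<dots> < (\<Sum>i\<in>(UNIV::'n set). \<epsilon>)"
    proof (rule sum_strict_mono)
      fix i :: 'n
      have "(?w0 - abs_vec w) $ i = of_real (norm (?w0 $ i) - norm (w $ i))"
        by (subst (1) rep(3)[OF q(2), symmetric]) (simp add: abs_vec_def)
      then show "norm ((?w0 - abs_vec w) $ i) < \<epsilon>"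
        using w by (simp only: norm_of_real) (simp add: box_at_def abs_minus_commute)
    qed auto
    also have "\<dots> = e" by (simp add: \<epsilon>_def)
    finally have "abs_vec w \<in> {w \<in> W. orb (m w) \<in> O'}" using e(2) by (auto simp: dist_norm)
    then have "w \<in> W" using in_W_if_abs_vec_in by blast
    then show ?thesis using orb_m_abs_vec \<open>abs_vec w \<in> {w \<in> W. orb (m w) \<in> O'}\<close> by simp
  qed
  moreover have "\<epsilon> > 0" using e by (simp add: \<epsilon>_def)
  ultimately show ?thesis using that[of \<epsilon>] by blast
qed

lemma homeomorphic_coord_box:
  assumes "box_at w0 \<epsilon> \<subseteq> W"
  shows "homeomorphic_maps (top_of_set (coord_box w0 \<epsilon>)) (subtopology Q ((\<lambda>w. orb (m w)) ` box_at w0 \<epsilon>))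
     (\<lambda>r. orb (m (cpx r))) (\<lambda>q. norms (rep q))"
proof -
  have cW: "cpx r \<in> box_at w0 \<epsilon>" if "r \<in> coord_box w0 \<epsilon>" for r
    using that by (auto simp: coord_box_def box_at_def cpx_def)
  have sub: "(\<lambda>w. orb (m w)) ` box_at w0 \<epsilon> \<subseteq> dom_orb" using assms by (auto simp: dom_orb_def)
  have "continuous_on (coord_box w0 \<epsilon>) cpx"
    unfolding cpx_def by (intro continuous_intros)
  then have "continuous_map (top_of_set (coord_box w0 \<epsilon>)) (top_of_set W) cpx"
    using cW assms by auto
  from continuous_map_compose[OF continuous_map_compose[OF this continuous_m] continuous_orb]
  have 1: "continuous_map (top_of_set (coord_box w0 \<epsilon>)) (subtopology Q ((\<lambda>w. orb (m w)) ` box_at w0 \<epsilon>))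
     (\<lambda>r. orb (m (cpx r)))"
    using cW by (auto simp: continuous_map_in_subtopology o_def)
  have "continuous_map (subtopology Q ((\<lambda>w. orb (m w)) ` box_at w0 \<epsilon>)) (top_of_set W) rep"
    using continuous_rep sub continuous_map_from_subtopology_mono by blast
  moreover have "continuous_map (top_of_set W) euclidean norms"
    unfolding norms_def by (auto intro!: continuous_intros)
  ultimately have "continuous_map (subtopology Q ((\<lambda>w. orb (m w)) ` box_at w0 \<epsilon>)) euclidean (norms \<circ> rep)"
    by (rule continuous_map_compose)
  moreover have n: "norms (rep (orb (m w))) = norms w" if "w \<in> W" for w
    using that by (simp add: rep_orb_m norms_def abs_vec_def)
  have nb: "norms w \<in> coord_box w0 \<epsilon>" if "w \<in> box_at w0 \<epsilon>" for w
    using that by (auto simp: norms_def coord_box_def box_at_def)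
  ultimately have 2: "continuous_map (subtopology Q ((\<lambda>w. orb (m w)) ` box_at w0 \<epsilon>)) (top_of_set (coord_box w0 \<epsilon>))
     (\<lambda>q. norms (rep q))"
    using assms n by (auto simp: continuous_map_in_subtopology o_def)
  have 3: "norms (rep (orb (m (cpx r)))) = r" if "r \<in> coord_box w0 \<epsilon>" for r
    using that cW[OF that] assms n by (auto simp: norms_def cpx_def coord_box_def vec_eq_iff)
  have 4: "orb (m (cpx (norms (rep q)))) = q" if q: "q \<in> (\<lambda>w. orb (m w)) ` box_at w0 \<epsilon>" for q
  proof -
    obtain w where w: "w \<in> W" "q = orb (m w)" using q assms by blast
    have "cpx (norms w) = abs_vec w" by (simp add: cpx_def norms_def abs_vec_def)
    then show ?thesis using w n by (simp add: orb_m_abs_vec)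
  qed
  show ?thesis
    unfolding homeomorphic_maps_def using 1 2 3 4 by auto
qed

lemma contractible_box:
  assumes "box_at w0 \<epsilon> \<subseteq> W"
  shows "contractible_space (subtopology Q ((\<lambda>w. orb (m w)) ` box_at w0 \<epsilon>))"
proof -
  have "top_of_set (coord_box w0 \<epsilon>) homeomorphic_space subtopology Q ((\<lambda>w. orb (m w)) ` box_at w0 \<epsilon>)"
    using homeomorphic_coord_box[OF assms] homeomorphic_maps_imp_homeomorphic_space by blast
  then show ?thesis
    using homeomorphic_space_contractibility convex_imp_contractible[OF convex_coord_box] contractible_space_top_of_set by blast
qed

end

section \<open>Continuity of transition functions at points with vanishing coordinates\<close>

section \<open>Extension of phases across the boundary\<close>

text \<open>Hadamard's lemma: since \<open>G\<close> vanishes where the coordinate \<open>j\<close> does, \<open>G w\<close> is \<open>\<bar>w\<^sub>j\<bar>\<close> times the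
  average \<open>h w\<close> of a partial derivative, and \<open>h\<close> does not vanish. So the phase of \<open>h\<close> extends that of \<open>G\<close>.\<close>

lemma phase_extension:
  fixes G :: "complex ^ 'n \<Rightarrow> complex"
  assumes N: "open N" "w1 \<in> N" and der: "\<And>w. w \<in> N \<Longrightarrow> (G has_derivative G' w) (at w)"
    and surj: "\<And>w. w \<in> N \<Longrightarrow> surj (G' w)"
    and cont: "\<And>v. continuous_on N (\<lambda>w. G' w v)"
    and zero: "\<And>w. w \<in> N \<Longrightarrow> w $ j = 0 \<longleftrightarrow> G w = 0" and w1: "w1 $ j = 0"
  shows "\<exists>M u. open M \<and> w1 \<in> M \<and> M \<subseteq> N \<and> continuous_on (M \<inter> {w. abs_vec w = w}) u \<and>
     (\<forall>w\<in>M \<inter> {w. abs_vec w = w}. norm (u w) = 1 \<and> G w = u w * of_real (norm (G w)))"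
proof -
  obtain e where e: "e > 0" "ball w1 e \<subseteq> N" using N open_contains_ball by blast
  define M where "M = ball w1 e"
  define R where "R = M \<inter> {w. abs_vec w = w}"
  \<comment> \<open>The path scales the coordinate \<open>j\<close> alone. For \<open>w\<close> in
    the orthant it runs in the direction of \<open>axis j 1\<close>, with speed the modulus of that
    coordinate.\<close>
  define \<gamma> :: "complex ^ 'n \<Rightarrow> real \<Rightarrow> complex ^ 'n"
    where "\<gamma> w s = (\<chi> k. if k = j then of_real s * w $ j else w $ k)" for w s
  \<comment> \<open>As \<open>w1 $ j = 0\<close>, shrinking the coordinate \<open>j\<close> cannot
    increase the distance to \<open>w1\<close>, so the path stays in the ball.\<close>
  have \<gamma>M: "\<gamma> w s \<in> M" if "w \<in> M" "s \<in> {0..1}" for w s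
  proof -
    have "norm (w1 - \<gamma> w s) \<le> norm (w1 - w)"
      unfolding norm_vec_def
    proof (rule L2_set_mono)
      fix k
      show "norm ((w1 - \<gamma> w s) $ k) \<le> norm ((w1 - w) $ k)"
        using w1 that(2) by (auto simp: \<gamma>_def norm_mult mult_left_le_one_le)
    qed auto
    then show ?thesis using that(1) by (simp add: M_def dist_norm)
  qed
  define h where "h w = integral {0..1} (\<lambda>s. G' (\<gamma> w s) (axis j 1))" for w
  have lin: "linear (G' w)" if "w \<in> N" for w using der[OF that] has_derivative_linear by blast
  have cont2: "continuous_on (M \<times> {0..1}) (\<lambda>(w, s). G' (\<gamma> w s) (axis j 1))"
  proof -
    have "continuous_on (M \<times> {0..1}) (\<lambda>x. \<gamma> (fst x) (snd x))"
    proof -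
      have "continuous_on (M \<times> {0..1}) (\<lambda>x. if k = j then of_real (snd x) * fst x $ j else fst x $ k)" for k
        by (cases "k = j") (auto intro!: continuous_intros)
      then show ?thesis unfolding \<gamma>_def by (intro continuous_on_vec_lambda)
    qed
    then have "continuous_on (M \<times> {0..1}) (\<lambda>x. G' (\<gamma> (fst x) (snd x)) (axis j 1))"
      by (rule continuous_on_compose2[OF cont]) (use \<gamma>M e in \<open>auto simp: M_def\<close>)
    then show ?thesis by (simp add: case_prod_beta')
  qed
  have conth: "continuous_on M h"
    using integral_continuous_on_param[of M 0 "1::real" "\<lambda>w s. G' (\<gamma> w s) (axis j 1)"] cont2
    by (simp add: h_def[abs_def])
  have Gh: "G w = of_real (norm (w $ j)) * h w" if w: "w \<in> R" for w
  proof -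
    have wM: "w \<in> M" and ab: "w $ k = of_real (norm (w $ k))" for k
      using w by (auto simp: R_def abs_vec_def vec_eq_iff)
    define r where "r = norm (w $ j)"
    have dir: "((\<lambda>s. G (\<gamma> w s)) has_vector_derivative r *\<^sub>R G' (\<gamma> w s) (axis j 1)) (at s within {0..1})"
      if s: "s \<in> {0..1}" for s
    proof -
      have "((\<lambda>s. \<gamma> w s) has_derivative (\<lambda>t. t *\<^sub>R (r *\<^sub>R axis j 1))) (at s within {0..1})"
      proof -
        have "w $ j = of_real r" using ab[of j] by (simp add: r_def)
        then have "\<gamma> w s $ k = (\<gamma> w 0 + s *\<^sub>R (r *\<^sub>R axis j 1)) $ k" for s k
          by (simp add: \<gamma>_def axis_def scaleR_conv_of_real[where 'a = complex])
        then have eq: "\<gamma> w = (\<lambda>s. \<gamma> w 0 + s *\<^sub>R (r *\<^sub>R axis j 1))"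
          by (simp only: fun_eq_iff vec_eq_iff) blast
        show ?thesis by (subst eq) (auto intro!: derivative_eq_intros)
      qed
      from has_derivative_in_compose2[of N G G' "\<gamma> w" "{0..1}" s, OF has_derivative_at_withinI[OF der] _ s this]
      have "((\<lambda>s. G (\<gamma> w s)) has_derivative (\<lambda>t. G' (\<gamma> w s) (t *\<^sub>R (r *\<^sub>R axis j 1)))) (at s within {0..1})"
        using \<gamma>M[OF wM] e(2) s unfolding M_def by blast
      moreover have "\<gamma> w s \<in> N" using \<gamma>M[OF wM s] e by (auto simp: M_def)
      ultimately show ?thesis
        by (simp add: has_vector_derivative_def linear_scale[OF lin])
    qed
    have "((\<lambda>s. r *\<^sub>R G' (\<gamma> w s) (axis j 1)) has_integral (G (\<gamma> w 1) - G (\<gamma> w 0))) {0..1}"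
      by (rule fundamental_theorem_of_calculus) (use dir in auto)
    then have "integral {0..1} (\<lambda>s. r *\<^sub>R G' (\<gamma> w s) (axis j 1)) = G (\<gamma> w 1) - G (\<gamma> w 0)"
      by (rule integral_unique)
    moreover have "\<gamma> w 1 = w" by (simp add: \<gamma>_def vec_eq_iff)
    moreover have "\<gamma> w 0 \<in> N" "\<gamma> w 0 $ j = 0" using \<gamma>M[OF wM, of 0] e by (auto simp: M_def \<gamma>_def)
    then have "G (\<gamma> w 0) = 0" using zero by blast
    ultimately show ?thesis by (simp add: h_def r_def scaleR_conv_of_real)
  qed
  \<comment> \<open>On the hyperplane \<open>w $ j = 0\<close> the function \<open>G\<close>
    vanishes, so its derivative kills all tangential directions. If it also killed
    \<open>axis j 1\<close>, its range would be the real line spanned by its value at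
    \<open>axis j \<i>\<close>, against surjectivity.\<close>
  have boundary: "G' w (axis j 1) \<noteq> 0" if w: "w \<in> N" "w $ j = 0" for w
  proof
    assume zero_der: "G' w (axis j 1) = 0"
    have tangential: "G' w v = 0" if v: "v $ j = 0" for v
    proof -
      have "((\<lambda>s::real. w + s *\<^sub>R v) has_derivative (\<lambda>s. s *\<^sub>R v)) (at 0)"
        by (auto intro!: derivative_eq_intros)
      moreover have "(G has_derivative G' w) (at (w + 0 *\<^sub>R v))" using der[OF w(1)] by simp
      ultimately have "((\<lambda>s::real. G (w + s *\<^sub>R v)) has_derivative (\<lambda>s. G' w (s *\<^sub>R v))) (at 0)"
        by (rule has_derivative_compose)
      moreover have "((\<lambda>s::real. G (w + s *\<^sub>R v)) has_derivative (\<lambda>s. 0)) (at 0)"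
      proof (rule has_derivative_transform_within_open[of "\<lambda>_. 0"])
        show "open ((\<lambda>s::real. w + s *\<^sub>R v) -` N)"
          by (intro open_vimage N(1) continuous_intros)
        show "0 = G (w + s *\<^sub>R v)" if "s \<in> (\<lambda>s::real. w + s *\<^sub>R v) -` N" for s
          using zero[of "w + s *\<^sub>R v"] that w v by simp
      qed (use w in auto)
      ultimately have "(\<lambda>s. G' w (s *\<^sub>R v)) = (\<lambda>s. 0)" by (rule has_derivative_unique)
      then have "G' w (1 *\<^sub>R v) = 0" by metis
      then show ?thesis by simp
    qed
    have form: "G' w v = Im (v $ j) *\<^sub>R G' w (axis j \<i>)" for v
    proof -
      define v' where "v' = v - Re (v $ j) *\<^sub>R axis j 1 - Im (v $ j) *\<^sub>R axis j \<i>"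
      have "v' $ j = 0" by (simp add: v'_def axis_def complex_eq_iff)
      then have "G' w v' = 0" by (rule tangential)
      then show ?thesis
        using zero_der by (simp add: v'_def linear_diff[OF lin[OF w(1)]] linear_scale[OF lin[OF w(1)]])
    qed
    obtain a b where "G' w a = 1" "G' w b = \<i>" using surj[OF w(1)] by (metis surjD)
    then have "Im (a $ j) *\<^sub>R G' w (axis j \<i>) = 1" "Im (b $ j) *\<^sub>R G' w (axis j \<i>) = \<i>"
      using form by metis+
    then show False
      by (auto simp: complex_eq_iff)
  qed
  \<comment> \<open>On the hyperplane the path is constant and \<open>h\<close> is the partial
    derivative itself; off the hyperplane \<open>G\<close> is nonzero and \<open>h\<close> divides
    it.\<close>
  have hnz: "h w \<noteq> 0" if w: "w \<in> R" for w
  proof (cases "w $ j = 0")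
    case True
    then have "\<gamma> w s = w" for s by (auto simp: \<gamma>_def vec_eq_iff)
    then have "h w = G' w (axis j 1)" by (simp add: h_def)
    then show ?thesis using boundary True w e by (auto simp: R_def M_def)
  next
    case False
    then show ?thesis using Gh[OF w] zero[of w] w e by (auto simp: R_def M_def)
  qed
  have "continuous_on R (\<lambda>w. sgn (h w))"
    by (rule continuous_on_sgn) (use continuous_on_subset[OF conth, of R] hnz in \<open>auto simp: R_def\<close>)
  moreover have "norm (sgn (h w)) = 1 \<and> G w = sgn (h w) * of_real (norm (G w))" if w: "w \<in> R" for w
  proof
    show "norm (sgn (h w)) = 1" using hnz[OF w] by (simp add: norm_sgn)
    have "sgn (h w) * of_real (norm (h w)) = h w" using hnz[OF w] by (simp add: sgn_eq)
    then show "G w = sgn (h w) * of_real (norm (G w))"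
      using Gh[OF w] by (simp add: norm_mult mult_ac)
  qed
  ultimately show ?thesis
    using e by (intro exI[of _ M] exI[of _ "\<lambda>w. sgn (h w)"]) (auto simp: M_def R_def)
qed


section \<open>Transition functions between local sections\<close>

definition coord_space :: "'n set \<Rightarrow> (real ^ 'n) set" where
  "coord_space Z = {u. \<forall>i. i \<notin> Z \<longrightarrow> u $ i = 0}"

lemma axis_in_coord_space: "c \<noteq> 0 \<Longrightarrow> axis j c \<in> coord_space Z \<longleftrightarrow> j \<in> Z"
  by (auto simp: coord_space_def axis_def)

text \<open>The left side is a line, so all coordinate axes from \<open>Z\<close> lie on one line
  and \<open>Z\<close> is a singleton. It allows the facet directions of two charts to be matched
  through the isotropy Lie algebra.\<close>

lemma coord_space_singleton_image:
  fixes A B :: "real ^ 'n \<Rightarrow> real ^ 'n"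
  assumes A: "linear A" "inj A" and B: "linear B" "inj B"
    and eq: "A ` coord_space {j} = B ` coord_space Z"
  shows "\<exists>b c. Z = {b} \<and> c \<noteq> 0 \<and> A (axis j 1) = B (axis b c)"
proof -
  have "A (axis j 1) \<in> A ` coord_space {j}"
    by (intro imageI) (simp add: axis_in_coord_space)
  then have "A (axis j 1) \<in> B ` coord_space Z" by (simp only: eq)
  then obtain y where y: "y \<in> coord_space Z" "A (axis j 1) = B y" by blast
  have "A (axis j 1) \<noteq> 0"
    using A linear_injective_0 by (metis axis_eq_0_iff zero_neq_one)
  then have "y \<noteq> 0" using y(2) linear_0[OF B(1)] by metis
  then obtain b where b: "y $ b \<noteq> 0" by (auto simp: vec_eq_iff)
  then have bZ: "b \<in> Z" using y(1) by (auto simp: coord_space_def)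
  have mult: "\<exists>c. axis k 1 = c *\<^sub>R y" if k: "k \<in> Z" for k
  proof -
    have "B (axis k 1) \<in> B ` coord_space Z"
      using k by (intro imageI) (simp add: axis_in_coord_space)
    then have "B (axis k 1) \<in> A ` coord_space {j}" by (simp only: eq)
    then obtain u where u: "u \<in> coord_space {j}" "B (axis k 1) = A u" by blast
    then have "u = (u $ j) *\<^sub>R axis j 1" by (auto simp: vec_eq_iff axis_def coord_space_def)
    then have "B (axis k 1) = B ((u $ j) *\<^sub>R y)"
      using u(2) y(2) by (metis linear_scale A(1) B(1))
    then show ?thesis using B(2) injD by metis
  qed
  obtain c0 where c0: "axis b 1 = c0 *\<^sub>R y" using mult[OF bZ] by blast
  have y0: "y $ k = 0" if "k \<noteq> b" for k
  proof -
    have "(axis b 1 :: real ^ 'n) $ b = c0 * y $ b" "(axis b 1 :: real ^ 'n) $ k = c0 * y $ k"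
      by (simp_all add: c0)
    then show ?thesis using that by (auto simp: axis_def)
  qed
  have "k = b" if "k \<in> Z" for k
  proof (rule ccontr)
    assume "k \<noteq> b"
    obtain c where "axis k 1 = c *\<^sub>R y" using mult[OF \<open>k \<in> Z\<close>] by blast
    then have "(axis k 1 :: real ^ 'n) $ k = c * y $ k" by simp
    then show False using y0[OF \<open>k \<noteq> b\<close>] by (simp add: axis_def)
  qed
  then have "Z = {b}" using bZ by blast
  moreover have "y = axis b (y $ b)" using y0 by (auto simp: vec_eq_iff axis_def)
  ultimately show ?thesis using b y(2) by metis
qed

text \<open>The regularity that the extension of phases requires. It is stable under composition, so
  a change of coordinates can be treated as a composite of maps of this kind.\<close>

definition surj_C1_on :: "'a::real_normed_vector set \<Rightarrow> ('a \<Rightarrow> 'b::real_normed_vector) \<Rightarrow> bool" where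
  "surj_C1_on N F \<longleftrightarrow> (\<exists>F'. (\<forall>w\<in>N. (F has_derivative F' w) (at w) \<and> surj (F' w)) \<and>
     (\<forall>v. continuous_on N (\<lambda>w. F' w v)))"

text \<open>The assumption \<open>lift\<close> carries the smoothness of the change of charts: near
  a common point the identity of \<open>X\<close> is covered by a map from \<open>W1\<close> to
  \<open>W2\<close> that is continuously differentiable with surjective derivative.\<close>

locale chart_pair =
  c1: torus_chart X act W1 m1 \<xi>1 + c2: torus_chart X act W2 m2 \<xi>2
  for X :: "'x topology" and act :: "complex ^ 'n \<Rightarrow> 'x \<Rightarrow> 'x" and W1 m1 \<xi>1 W2 m2 \<xi>2 +
  assumes lift: "w1 \<in> W1 \<Longrightarrow> w2 \<in> W2 \<Longrightarrow> m1 w1 = m2 w2 \<Longrightarrow>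
    \<exists>N F. open N \<and> w1 \<in> N \<and> N \<subseteq> W1 \<and> F ` N \<subseteq> W2 \<and> surj_C1_on N F \<and> (\<forall>w\<in>N. m2 (F w) = m1 w)"
begin

lemma lie_maps_eq:
  assumes "w \<in> W1" "v \<in> W2" "m2 v = m1 w"
  shows "c1.lie_map ` coord_space (zero_set w) = c2.lie_map ` coord_space (zero_set v)"
  using c1.lie_algebra_stab[OF assms(1)] c2.lie_algebra_stab[OF assms(2)]
  unfolding coord_space_def assms(3) by simp

text \<open>The hypersurfaces on which the coordinates of \<open>F\<close> vanish are coordinate hyperplanes: both are
  determined by the isotropy Lie algebras.\<close>

lemma zero_coordinate:
  assumes N: "open N" "w1 \<in> N" "N \<subseteq> W1" and F: "F ` N \<subseteq> W2" "\<And>w. w \<in> N \<Longrightarrow> m2 (F w) = m1 w"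
    and i: "F w1 $ i = 0"
  shows "\<exists>j. w1 $ j = 0 \<and> (\<forall>w\<in>N. w $ j = 0 \<longleftrightarrow> F w $ i = 0)"
proof -
  note A = c1.lie_map(1) c1.inj_lie_map and B = c2.lie_map(1) c2.inj_lie_map
  have eq: "c1.lie_map ` coord_space (zero_set w) = c2.lie_map ` coord_space (zero_set (F w))" if "w \<in> N" for w
    using lie_maps_eq[of w "F w"] that N F by blast
  \<comment> \<open>A nearby point at which only the coordinate \<open>j\<close> vanishes has a
    one-dimensional isotropy Lie algebra. In the second chart it must again be a coordinate line,
    which determines \<open>b j\<close>.\<close>
  have "\<exists>b c. c \<noteq> 0 \<and> c1.lie_map (axis j 1) = c2.lie_map (axis b c)" if j: "j \<in> zero_set w1" for j
  proof -
    have "{j} \<subseteq> zero_set w1" using j by simp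
    then obtain w where w: "w \<in> N" "zero_set w = {j}" using perturb_zeros[OF N(1,2)] by metis
    show ?thesis
      using coord_space_singleton_image[OF A B eq[OF w(1), unfolded w(2)]] by blast
  qed
  then obtain b c where bc: "\<And>j. j \<in> zero_set w1 \<Longrightarrow> c j \<noteq> 0 \<and> c1.lie_map (axis j 1) = c2.lie_map (axis (b j) (c j))"
    by metis
  have "c2.lie_map (axis i 1) \<in> c2.lie_map ` coord_space (zero_set (F w1))"
    using i by (intro imageI) (simp add: axis_in_coord_space zero_set_def)
  then have "c2.lie_map (axis i 1) \<in> c1.lie_map ` coord_space (zero_set w1)"
    by (simp only: eq[OF N(2)])
  then obtain x where x: "x \<in> coord_space (zero_set w1)" "c2.lie_map (axis i 1) = c1.lie_map x" by blast
  have "x = (\<Sum>j\<in>zero_set w1. x $ j *\<^sub>R axis j 1)"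
    using x(1) by (auto simp: vec_eq_iff coord_space_def axis_def if_distrib cong: if_cong)
  then have "c1.lie_map x = (\<Sum>j\<in>zero_set w1. x $ j *\<^sub>R c1.lie_map (axis j 1))"
    using linear_sum[OF A(1), of "\<lambda>j. x $ j *\<^sub>R axis j 1" "zero_set w1"] by (simp add: linear_scale[OF A(1)])
  also have "\<dots> = (\<Sum>j\<in>zero_set w1. c2.lie_map (x $ j *\<^sub>R axis (b j) (c j)))"
    by (rule sum.cong) (auto simp: bc linear_scale[OF B(1)])
  also have "\<dots> = c2.lie_map (\<Sum>j\<in>zero_set w1. x $ j *\<^sub>R axis (b j) (c j))"
    by (rule linear_sum[OF B(1), symmetric])
  finally have "c2.lie_map (axis i 1) = c2.lie_map (\<Sum>j\<in>zero_set w1. x $ j *\<^sub>R axis (b j) (c j))"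
    using x(2) by simp
  then have sum: "axis i 1 = (\<Sum>j\<in>zero_set w1. x $ j *\<^sub>R axis (b j) (c j))"
    using B(2) injD by metis
  \<comment> \<open>The vector \<open>axis i 1\<close> is a combination of multiples of the
    \<open>axis (b j)\<close>, so one of these must involve the coordinate \<open>i\<close>.\<close>
  have "\<exists>j\<in>zero_set w1. b j = i"
  proof (rule ccontr)
    assume "\<not> ?thesis"
    then have "(\<Sum>j\<in>zero_set w1. x $ j *\<^sub>R axis (b j) (c j)) $ i = 0"
      by (auto simp: axis_def intro!: sum.neutral)
    then show False using arg_cong[OF sum, of "\<lambda>v. v $ i"] by (simp add: axis_def)
  qed
  then obtain j where j: "j \<in> zero_set w1" "b j = i" by blast
  have "w $ j = 0 \<longleftrightarrow> F w $ i = 0" if w: "w \<in> N" for w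
  proof -
    have "w $ j = 0 \<longleftrightarrow> axis j 1 \<in> coord_space (zero_set w)"
      by (simp add: axis_in_coord_space zero_set_def)
    also have "\<dots> \<longleftrightarrow> c1.lie_map (axis j 1) \<in> c1.lie_map ` coord_space (zero_set w)"
      by (simp add: inj_image_mem_iff[OF A(2)])
    also have "\<dots> \<longleftrightarrow> c2.lie_map (axis i (c j)) \<in> c2.lie_map ` coord_space (zero_set (F w))"
      using eq[OF w] bc[OF j(1)] j(2) by simp
    also have "\<dots> \<longleftrightarrow> F w $ i = 0"
      using bc[OF j(1)] by (simp add: inj_image_mem_iff[OF B(2)] axis_in_coord_space zero_set_def)
    finally show ?thesis .
  qed
  then show ?thesis using j(1) by (auto simp: zero_set_def)
qed

text \<open>Write \<open>F w\<close> as a torus element \<open>u' w\<close> times its vector of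
  moduli. At \<open>w = c1.rep q\<close> these moduli form \<open>c2.rep q\<close>, so the first
  section is the translate of the second by \<open>\<xi>2 (u' w)\<close>. It remains to choose the
  phases continuously on the orthant.\<close>

lemma local_transition:
  assumes q: "q \<in> c1.dom_orb" "q \<in> c2.dom_orb"
  shows "\<exists>O' t. openin (orbit_space X act) O' \<and> q \<in> O' \<and> O' \<subseteq> c1.dom_orb \<inter> c2.dom_orb \<and>
     continuous_map (subtopology (orbit_space X act) O') euclidean t \<and>
     (\<forall>q\<in>O'. t q \<in> torus \<and> c1.local_section q = act (t q) (c2.local_section q))"
proof -
  define w1 where "w1 = c1.rep q"
  have w1: "w1 \<in> W1" "c1.orb (m1 w1) = q" "abs_vec w1 = w1" using c1.rep[OF q(1)] by (auto simp: w1_def)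
  have "c1.orb (m2 (c2.rep q)) = c1.orb (m1 w1)" using c2.rep[OF q(2)] w1 by simp
  then obtain s where s: "s \<in> torus" "m1 w1 = act s (m2 (c2.rep q))"
    using c1.orb_eq_iff c1.m_in[OF w1(1)] c2.m_in[OF c2.rep(1)[OF q(2)]] by metis
  \<comment> \<open>Lifting the translation along \<open>\<xi>2\<close> turns the second
    representative into a point of \<open>W2\<close> with exactly the image \<open>m1 w1\<close>, as
    the assumption \<open>lift\<close> demands.\<close>
  obtain s' where s': "s' \<in> torus" "s = \<xi>2 s'" using c2.\<xi>_surj s(1) by blast
  have m12: "s' * c2.rep q \<in> W2" "m1 w1 = m2 (s' * c2.rep q)"
    using s s' c2.m_mult[OF s'(1) c2.rep(1)[OF q(2)]] c2.torus_W[OF s'(1) c2.rep(1)[OF q(2)]] by auto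
  then obtain N F where N: "open N" "w1 \<in> N" "N \<subseteq> W1" and F: "F ` N \<subseteq> W2" "surj_C1_on N F"
    and mF: "\<And>w. w \<in> N \<Longrightarrow> m2 (F w) = m1 w"
    using lift[OF w1(1) m12] by (elim exE conjE) (rule that, auto)
  obtain F' where F': "\<And>w. w \<in> N \<Longrightarrow> (F has_derivative F' w) (at w)" "\<And>w. w \<in> N \<Longrightarrow> surj (F' w)"
    "\<And>v. continuous_on N (\<lambda>w. F' w v)"
    using F(2) unfolding surj_C1_on_def by blast
  have contF: "continuous_on N F"
    using F'(1) N(1) by (meson continuous_at_imp_continuous_on has_derivative_continuous)
  define phase where "phase i M u \<longleftrightarrow> open M \<and> w1 \<in> M \<and> M \<subseteq> N \<and> continuous_on (M \<inter> {w. abs_vec w = w}) u \<and>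
     (\<forall>w\<in>M \<inter> {w. abs_vec w = w}. norm (u w) = 1 \<and> F w $ i = u w * of_real (norm (F w $ i)))" for i M u
  \<comment> \<open>Where the component \<open>i\<close> of \<open>F\<close> does not vanish, its
    phase is its \<open>sgn\<close>. Where it does, it vanishes along a coordinate hyperplane and
    Hadamard's lemma applies.\<close>
  have "\<exists>M u. phase i M u" for i
  proof (cases "F w1 $ i = 0")
    case True
    then obtain j where j: "w1 $ j = 0" "\<forall>w\<in>N. w $ j = 0 \<longleftrightarrow> F w $ i = 0"
      using zero_coordinate[OF N F(1) mF] by blast
    show ?thesis
      unfolding phase_def
    proof (rule phase_extension[of N w1 "\<lambda>w. F w $ i" "\<lambda>w v. F' w v $ i" j])
      show "((\<lambda>w. F w $ i) has_derivative (\<lambda>v. F' w v $ i)) (at w)" if "w \<in> N" for w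
        using bounded_linear.has_derivative[OF bounded_linear_vec_nth F'(1)[OF that]] .
      show "surj (\<lambda>v. F' w v $ i)" if wN: "w \<in> N" for w
        unfolding surj_def
      proof
        fix z
        obtain v where "axis i z = F' w v" using surjD[OF F'(2)[OF wN]] by blast
        then have "F' w v $ i = z" by (metis axis_nth)
        then show "\<exists>v. z = F' w v $ i" by blast
      qed
      show "continuous_on N (\<lambda>w. F' w v $ i)" for v using F'(3) by (intro continuous_intros)
    qed (use N j in auto)
  next
    case False
    define M where "M = N \<inter> (\<lambda>w. F w $ i) -` (- {0})"
    have "open M"
      unfolding M_def using contF N(1) by (intro continuous_open_preimage continuous_intros) auto
    moreover have "continuous_on (M \<inter> {w. abs_vec w = w}) (\<lambda>w. sgn (F w $ i))"
      using continuous_on_subset[OF contF, of "M \<inter> {w. abs_vec w = w}"]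
      by (intro continuous_on_sgn continuous_intros) (auto simp: M_def)
    moreover have "norm (sgn (F w $ i)) = 1 \<and> F w $ i = sgn (F w $ i) * of_real (norm (F w $ i))" if "w \<in> M" for w
      using that by (auto simp: M_def sgn_eq norm_divide)
    ultimately show ?thesis
      unfolding phase_def using False N(2) by (intro exI[of _ M] exI[of _ "\<lambda>w. sgn (F w $ i)"]) (auto simp: M_def)
  qed
  then obtain M u where "\<And>i. phase i (M i) (u i)" by metis
  then have M: "\<And>i. open (M i)" "\<And>i. w1 \<in> M i" "\<And>i. M i \<subseteq> N"
    and u: "\<And>i. continuous_on (M i \<inter> {w. abs_vec w = w}) (u i)"
    and u2: "\<And>i w. w \<in> M i \<Longrightarrow> abs_vec w = w \<Longrightarrow> norm (u i w) = 1 \<and> F w $ i = u i w * of_real (norm (F w $ i))"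
    unfolding phase_def by blast+
  define N0 where "N0 = (\<Inter>i. M i)"
  have N0: "open N0" "w1 \<in> N0" "N0 \<subseteq> N"
    unfolding N0_def using M(1,2) M(3)[of undefined] by (auto intro!: open_INT)
  define u' :: "complex ^ 'n \<Rightarrow> complex ^ 'n" where "u' w = (\<chi> i. u i w)" for w
  have u'T: "u' w \<in> torus" if "w \<in> N0" "abs_vec w = w" for w
    using u2 that by (auto simp: u'_def torus_def N0_def)
  have Fu: "F w = u' w * abs_vec (F w)" if "w \<in> N0" "abs_vec w = w" for w
    using u2[of w] that by (auto simp: u'_def abs_vec_def vec_eq_iff N0_def)
  have contu': "continuous_on (N0 \<inter> {w. abs_vec w = w}) u'"
    unfolding u'_def by (intro continuous_on_vec_lambda continuous_on_subset[OF u]) (auto simp: N0_def)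
  define O' where "O' = {q \<in> topspace (subtopology (orbit_space X act) c1.dom_orb). c1.rep q \<in> N0}"
  have "openin (top_of_set W1) N0"
    using N0 N(3) c1.open_W by (metis dual_order.trans inf.absorb_iff2 openin_open_Int)
  then have "openin (subtopology (orbit_space X act) c1.dom_orb) O'"
    unfolding O'_def by (rule openin_continuous_map_preimage[OF c1.continuous_rep])
  then have opO: "openin (orbit_space X act) O'" using c1.openin_dom_orb openin_trans_full by blast
  have O1: "q' \<in> c1.dom_orb" "c1.rep q' \<in> N0" if "q' \<in> O'" for q' using that by (auto simp: O'_def)
  have qO: "q \<in> O'"
    using q(1) N0(2) c1.openin_dom_orb openin_subset by (auto simp: O'_def w1_def)
  have point: "q' \<in> c2.dom_orb \<and> \<xi>2 (u' (c1.rep q')) \<in> torus \<and>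
      c1.local_section q' = act (\<xi>2 (u' (c1.rep q'))) (c2.local_section q')" if q': "q' \<in> O'" for q'
  proof -
    let ?w = "c1.rep q'"
    have w: "?w \<in> N0" "abs_vec ?w = ?w" using O1[OF q'] c1.rep by auto
    have FW: "F ?w \<in> W2" using w N0 F(1) by blast
    have orbF: "c1.orb (m2 (F ?w)) = q'" using mF[of ?w] w N0 c1.rep(2)[OF O1(1)[OF q']] by auto
    then have d: "q' \<in> c2.dom_orb" using FW by (auto simp: c2.dom_orb_def)
    have r: "c2.rep q' = abs_vec (F ?w)" using c2.rep_orb_m[OF FW] orbF by simp
    have "c1.local_section q' = m2 (F ?w)" using mF[of ?w] w N0 by (auto simp: c1.local_section_def)
    also have "\<dots> = m2 (u' ?w * abs_vec (F ?w))" using Fu[OF w] by simp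
    also have "\<dots> = act (\<xi>2 (u' ?w)) (m2 (abs_vec (F ?w)))"
      using c2.m_mult[OF u'T[OF w] c2.abs_vec_in[OF FW]] .
    finally show ?thesis using d r c2.\<xi>_torus[OF u'T[OF w]] by (simp add: c2.local_section_def)
  qed
  have "continuous_map (subtopology (orbit_space X act) O') (top_of_set W1) c1.rep"
    using c1.continuous_rep O1 continuous_map_from_subtopology_mono by (metis subsetI)
  then have "continuous_map (subtopology (orbit_space X act) O') (top_of_set (N0 \<inter> {w. abs_vec w = w})) c1.rep"
    using O1 c1.rep by (auto simp: continuous_map_in_subtopology)
  moreover have "continuous_map (top_of_set (N0 \<inter> {w. abs_vec w = w})) (top_of_set torus) u'"
    using contu' u'T by auto
  moreover have "continuous_map (top_of_set torus) euclidean \<xi>2" using c2.continuous_\<xi> by simp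
  ultimately have "continuous_map (subtopology (orbit_space X act) O') euclidean (\<xi>2 \<circ> (u' \<circ> c1.rep))"
    by (intro continuous_map_compose)
  then have "continuous_map (subtopology (orbit_space X act) O') euclidean (\<lambda>q. \<xi>2 (u' (c1.rep q)))"
    by (simp add: o_def)
  then show ?thesis using opO qO O1 point by (intro exI[of _ O'] exI[of _ "\<lambda>q. \<xi>2 (u' (c1.rep q))"]) auto
qed

end

section \<open>Smooth changes of charts\<close>

lemma smooth_on_derivative:
  assumes "smooth_on S f"
  shows "x \<in> S \<Longrightarrow> (f has_derivative frechet_derivative f (at x)) (at x)"
    "continuous_on S (\<lambda>x. frechet_derivative f (at x) v)"
proof -
  have "Ck_on (Suc 0) S f" using assms by (simp only: smooth_on_def)
  then have "\<forall>x\<in>S. f differentiable (at x)" "\<forall>v. continuous_on S (\<lambda>x. frechet_derivative f (at x) v)" by simp_all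
  then show "x \<in> S \<Longrightarrow> (f has_derivative frechet_derivative f (at x)) (at x)"
    "continuous_on S (\<lambda>x. frechet_derivative f (at x) v)"
    using frechet_derivative_works by blast+
qed

text \<open>Continuity for every fixed vector is enough: expanding the argument in a finite basis
  gives joint continuity.\<close>

lemma continuous_on_apply_derivative:
  fixes D :: "'a::topological_space \<Rightarrow> 'b::euclidean_space \<Rightarrow> 'c::real_normed_vector"
  assumes D: "\<And>v. continuous_on S (\<lambda>x. D x v)" and lin: "\<And>x. x \<in> S \<Longrightarrow> linear (D x)"
    and g: "continuous_on T g" "g ` T \<subseteq> S" and k: "continuous_on T k"
  shows "continuous_on T (\<lambda>t. D (g t) (k t))"
proof -
  have "D (g t) (k t) = (\<Sum>b\<in>Basis. (k t \<bullet> b) *\<^sub>R D (g t) b)" if "t \<in> T" for t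
  proof -
    have l: "linear (D (g t))" using lin g that by blast
    have "D (g t) (k t) = D (g t) (\<Sum>b\<in>Basis. (k t \<bullet> b) *\<^sub>R b)" by (simp add: euclidean_representation)
    then show ?thesis by (simp add: linear_sum[OF l] linear_scale[OF l])
  qed
  moreover have "continuous_on T (\<lambda>t. \<Sum>b\<in>Basis. (k t \<bullet> b) *\<^sub>R D (g t) b)"
    by (intro continuous_on_sum continuous_on_scaleR continuous_on_inner k continuous_on_const
        continuous_on_compose2[OF D g])
  ultimately show ?thesis by (simp cong: continuous_on_cong)
qed

text \<open>The chain rule for both composites of the map with its inverse.\<close>

lemma diffeo_surj_derivative:
  assumes d: "diffeo V W f" and x: "x \<in> V"
  shows "surj (frechet_derivative f (at x))" "surj (frechet_derivative (inv_into V f) (at (f x)))"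
proof -
  let ?g = "inv_into V f"
  have V: "open V" "open W" and bij: "bij_betw f V W" and sm: "smooth_on V f" "smooth_on W ?g"
    using d by (auto simp: diffeo_def)
  have fx: "f x \<in> W" using bij x by (auto simp: bij_betw_def)
  have gf: "?g (f z) = z" if "z \<in> V" for z using bij that by (simp add: bij_betw_inv_into_left)
  have fg: "f (?g y) = y" if "y \<in> W" for y using bij that by (simp add: bij_betw_inv_into_right)
  note Df = smooth_on_derivative(1)[OF sm(1) x] and Dg = smooth_on_derivative(1)[OF sm(2) fx]
  have "((\<lambda>z. ?g (f z)) has_derivative (\<lambda>v. frechet_derivative ?g (at (f x)) (frechet_derivative f (at x) v))) (at x)"
    by (rule has_derivative_compose[OF Df Dg])
  moreover have "((\<lambda>z. ?g (f z)) has_derivative (\<lambda>v. v)) (at x)"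
    by (rule has_derivative_transform_within_open[OF has_derivative_ident V(1) x]) (simp add: gf)
  ultimately have "(\<lambda>v. frechet_derivative ?g (at (f x)) (frechet_derivative f (at x) v)) = (\<lambda>v. v)"
    by (rule has_derivative_unique)
  then show "surj (frechet_derivative ?g (at (f x)))" by (metis surjI)
  have Df': "(f has_derivative frechet_derivative f (at x)) (at (?g (f x)))" using Df gf[OF x] by simp
  have "((\<lambda>y. f (?g y)) has_derivative (\<lambda>v. frechet_derivative f (at x) (frechet_derivative ?g (at (f x)) v))) (at (f x))"
    by (rule has_derivative_compose[OF Dg Df'])
  moreover have "((\<lambda>y. f (?g y)) has_derivative (\<lambda>v. v)) (at (f x))"
    by (rule has_derivative_transform_within_open[OF has_derivative_ident V(2) fx]) (simp add: fg)
  ultimately have "(\<lambda>v. frechet_derivative f (at x) (frechet_derivative ?g (at (f x)) v)) = (\<lambda>v. v)"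
    by (rule has_derivative_unique)
  then show "surj (frechet_derivative f (at x))" by (metis surjI)
qed

lemma surj_C1_on_compose:
  fixes f :: "'a::euclidean_space \<Rightarrow> 'b::euclidean_space" and g :: "'b \<Rightarrow> 'c::real_normed_vector"
  assumes "surj_C1_on S f" "surj_C1_on T g" "f ` S \<subseteq> T"
  shows "surj_C1_on S (\<lambda>x. g (f x))"
proof -
  obtain f' where f': "\<And>x. x \<in> S \<Longrightarrow> (f has_derivative f' x) (at x)" "\<And>x. x \<in> S \<Longrightarrow> surj (f' x)"
    "\<And>v. continuous_on S (\<lambda>x. f' x v)"
    using assms(1) unfolding surj_C1_on_def by blast
  obtain g' where g': "\<And>x. x \<in> T \<Longrightarrow> (g has_derivative g' x) (at x)" "\<And>x. x \<in> T \<Longrightarrow> surj (g' x)"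
    "\<And>v. continuous_on T (\<lambda>x. g' x v)"
    using assms(2) unfolding surj_C1_on_def by blast
  have f: "f x \<in> T" if "x \<in> S" for x using assms(3) that by blast
  have contf: "continuous_on S f"
    using f'(1) by (meson continuous_at_imp_continuous_on has_derivative_continuous)
  show ?thesis
    unfolding surj_C1_on_def
  proof (intro exI[of _ "\<lambda>x v. g' (f x) (f' x v)"] conjI ballI allI)
    fix x assume x: "x \<in> S"
    show "((\<lambda>x. g (f x)) has_derivative (\<lambda>v. g' (f x) (f' x v))) (at x)"
      by (rule has_derivative_compose[OF f'(1)[OF x] g'(1)[OF f[OF x]]])
    show "surj (\<lambda>v. g' (f x) (f' x v))"
      using comp_surj[OF f'(2)[OF x] g'(2)[OF f[OF x]]] by (simp add: o_def)
  next
    fix v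
    show "continuous_on S (\<lambda>x. g' (f x) (f' x v))"
      by (rule continuous_on_apply_derivative[OF g'(3) _ contf assms(3) f'(3)])
        (use g'(1) has_derivative_linear in blast)
  qed
qed

lemma diffeo_surj_C1_on:
  assumes "diffeo V W f"
  shows "surj_C1_on V f" "surj_C1_on W (inv_into V f)"
proof -
  have V: "bij_betw f V W" and sm: "smooth_on V f" "smooth_on W (inv_into V f)"
    using assms by (auto simp: diffeo_def)
  show "surj_C1_on V f"
    unfolding surj_C1_on_def
    using smooth_on_derivative[OF sm(1)] diffeo_surj_derivative(1)[OF assms]
    by (intro exI[of _ "\<lambda>x. frechet_derivative f (at x)"]) blast
  have "surj (frechet_derivative (inv_into V f) (at y))" if y: "y \<in> W" for y
  proof -
    have "inv_into V f y \<in> V" "f (inv_into V f y) = y"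
      using V y by (auto simp: bij_betw_def inv_into_into f_inv_into_f)
    then show ?thesis using diffeo_surj_derivative(2)[OF assms] by metis
  qed
  then show "surj_C1_on W (inv_into V f)"
    unfolding surj_C1_on_def
    using smooth_on_derivative[OF sm(2)]
    by (intro exI[of _ "\<lambda>x. frechet_derivative (inv_into V f) (at x)"]) blast
qed

lemma surj_C1_on_subset: "surj_C1_on S f \<Longrightarrow> T \<subseteq> S \<Longrightarrow> surj_C1_on T f"
  unfolding surj_C1_on_def by (meson continuous_on_subset subset_iff)

text \<open>At the neutral element of the torus, smoothness of the action provides a diffeomorphism
  between open parts of the two charts that covers the identity of \<open>X\<close>. Conjugating it
  with \<open>\<psi>1\<close> and \<open>\<psi>2\<close> gives the change of coordinates.\<close>

lemma (in torus_action) standard_charts_imp_chart_pair: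
  assumes smooth: "smooth_torus_action X \<U> act"
    and c: "standard_chart X \<U> act c W1 \<psi>1 \<xi>1" and d: "standard_chart X \<U> act d W2 \<psi>2 \<xi>2"
  shows "chart_pair X act W1 (\<lambda>w. chart_map c (\<psi>1 w)) \<xi>1 W2 (\<lambda>w. chart_map d (\<psi>2 w)) \<xi>2"
proof -
  interpret c1: torus_chart X act W1 "\<lambda>w. chart_map c (\<psi>1 w)" \<xi>1
    by (rule standard_chart_imp_torus_chart[OF c])
  interpret c2: torus_chart X act W2 "\<lambda>w. chart_map d (\<psi>2 w)" \<xi>2
    by (rule standard_chart_imp_torus_chart[OF d])
  have cU: "c \<in> orbifold_charts X \<U>" "diffeo W1 (chart_dom c) \<psi>1"
    and dU: "d \<in> orbifold_charts X \<U>" "diffeo W2 (chart_dom d) \<psi>2"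
    using c d by (auto simp: standard_chart_def)
  have bij1: "bij_betw \<psi>1 W1 (chart_dom c)" and bij2: "bij_betw \<psi>2 W2 (chart_dom d)"
    and cont1: "continuous_on W1 \<psi>1"
    using cU(2) dU(2) by (simp_all add: diffeo_def smooth_on_imp_continuous_on)
  show ?thesis
  proof
    fix w1 w2 assume w: "w1 \<in> W1" "w2 \<in> W2" and eq: "chart_map c (\<psi>1 w1) = chart_map d (\<psi>2 w2)"
    have x: "\<psi>1 w1 \<in> chart_dom c" and y: "\<psi>2 w2 \<in> chart_dom d"
      using bij1 bij2 w by (auto simp: bij_betw_def)
    have one: "act (torus_exp (0 :: real ^ 'n)) p = p" if "p \<in> topspace X" for p
      using act_one[OF that] by (simp add: torus_exp_0)
    have "act (torus_exp (0 :: real ^ 'n)) (chart_map c (\<psi>1 w1)) = chart_map d (\<psi>2 w2)"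
      using one[OF c1.m_in[OF w(1)]] eq by simp
    then obtain A :: "(real ^ 'n) set" and V f where A: "0 \<in> A" and V: "open V" "\<psi>1 w1 \<in> V"
      and ll: "\<forall>\<theta>\<in>A. local_lift c d V (act (torus_exp \<theta>)) (f \<theta>)"
      using smooth x y cU(1) dU(1) unfolding smooth_torus_action_def by blast
    have VD: "V \<subseteq> chart_dom c" "f 0 ` V \<subseteq> chart_dom d" "diffeo V (f 0 ` V) (f 0)"
      and fm: "\<And>v. v \<in> V \<Longrightarrow> chart_map d (f 0 v) = act (torus_exp 0) (chart_map c v)"
      using ll A by (auto simp: local_lift_def)
    define N where "N = W1 \<inter> \<psi>1 -` V"
    define F where "F w = inv_into W2 \<psi>2 (f 0 (\<psi>1 w))" for w
    have N: "open N" "w1 \<in> N" "N \<subseteq> W1"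
      using continuous_open_preimage[OF cont1 c1.open_W V(1)] V(2) w(1) by (auto simp: N_def)
    have inD: "f 0 (\<psi>1 w) \<in> chart_dom d" if "w \<in> N" for w using that VD(2) by (auto simp: N_def)
    have FW: "F w \<in> W2" and \<psi>F: "\<psi>2 (F w) = f 0 (\<psi>1 w)" if "w \<in> N" for w
      using inD[OF that] bij2 unfolding F_def bij_betw_def
      by (metis inv_into_into, metis f_inv_into_f)
    have "surj_C1_on N \<psi>1" by (rule surj_C1_on_subset[OF diffeo_surj_C1_on(1)[OF cU(2)] N(3)])
    then have "surj_C1_on N (\<lambda>w. f 0 (\<psi>1 w))"
      by (rule surj_C1_on_compose[OF _ diffeo_surj_C1_on(1)[OF VD(3)]]) (auto simp: N_def)
    then have "surj_C1_on N F"
      unfolding F_def by (rule surj_C1_on_compose[OF _ diffeo_surj_C1_on(2)[OF dU(2)]]) (use inD in blast)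
    moreover have "chart_map d (\<psi>2 (F w)) = chart_map c (\<psi>1 w)" if "w \<in> N" for w
      using fm[of "\<psi>1 w"] that one[OF c1.m_in] \<psi>F[OF that] by (simp add: N_def)
    ultimately show "\<exists>N F. open N \<and> w1 \<in> N \<and> N \<subseteq> W1 \<and> F ` N \<subseteq> W2 \<and> surj_C1_on N F \<and>
        (\<forall>w\<in>N. chart_map d (\<psi>2 (F w)) = chart_map c (\<psi>1 w))"
      using N FW by (intro exI[of _ N] exI[of _ F]) auto
  qed
qed

section \<open>Uniqueness of translations and density of free orbits\<close>

text \<open>A point without vanishing coordinates has isotropy group \<open>\<xi>\<close> of the
  trivial group, and such points are dense in \<open>W\<close>.\<close>

lemma (in torus_chart) free_orbit_dense:
  assumes "openin Q O'" "O' \<noteq> {}" "O' \<subseteq> dom_orb"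
  shows "\<exists>x\<in>topspace X. orb x \<in> O' \<and> stab x = {1}"
proof -
  obtain w where w: "w \<in> W" "orb (m w) \<in> O'" using assms(2,3) by (auto simp: dom_orb_def)
  have "continuous_map (top_of_set W) Q (\<lambda>w. orb (m w))"
    using continuous_map_compose[OF continuous_m continuous_orb] by (simp add: o_def)
  from openin_continuous_map_preimage[OF this assms(1)]
  have o: "open {w \<in> W. orb (m w) \<in> O'}" using open_W openin_open_trans by fastforce
  obtain w' where w': "w' \<in> {w \<in> W. orb (m w) \<in> O'}" "zero_set w' = {}"
    using perturb_zeros[OF o, of w "{}"] w by blast
  have "coord_torus {} = {1 :: complex ^ 'n}"
    by (auto simp: coord_torus_def vec_eq_iff one_in_torus)
  then have "stab (m w') = {1}" using w' stab_m[of w'] by (simp add: \<xi>_one)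
  then show ?thesis using w' m_in by blast
qed

context torus_action
begin

text \<open>The set where \<open>t\<close> and \<open>t'\<close> differ is open, so if nonempty it
  contains a free orbit, over which the translation is determined.\<close>

lemma translation_unique:
  assumes O': "openin Q O'" and t: "continuous_map (subtopology Q O') euclidean t" "continuous_map (subtopology Q O') euclidean t'"
    and dense: "\<And>G. openin Q G \<Longrightarrow> G \<noteq> {} \<Longrightarrow> G \<subseteq> O' \<Longrightarrow> \<exists>x\<in>topspace X. orb x \<in> G \<and> stab x = {1}"
    and \<sigma>: "\<And>q. q \<in> O' \<Longrightarrow> \<sigma> q \<in> topspace X \<and> orb (\<sigma> q) = q"
    and tt: "\<And>q. q \<in> O' \<Longrightarrow> t q \<in> torus \<and> t' q \<in> torus \<and> act (t q) (\<sigma> q) = act (t' q) (\<sigma> q)"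
    and q: "q \<in> O'"
  shows "t q = t' q"
proof (rule ccontr)
  assume neq: "t q \<noteq> t' q"
  define G where "G = {q \<in> topspace (subtopology Q O'). t q - t' q \<in> - {0}}"
  have "continuous_map (subtopology Q O') euclidean (\<lambda>q. t q - t' q)"
    using continuous_map_diff t by blast
  then have "openin (subtopology Q O') G"
    unfolding G_def by (rule openin_continuous_map_preimage) (simp add: open_Compl)
  then have "openin Q G" using O' openin_trans_full by blast
  moreover have "q \<in> G" using q neq O' openin_subset by (auto simp: G_def)
  moreover have "G \<subseteq> O'" by (auto simp: G_def)
  ultimately obtain x where x: "x \<in> topspace X" "orb x \<in> G" "stab x = {1}" using dense by blast
  let ?q = "orb x"
  have qO: "?q \<in> O'" using x \<open>G \<subseteq> O'\<close> by blast
  have "stab (\<sigma> ?q) = {1}" using stab_orb[of "\<sigma> ?q" x] \<sigma>[OF qO] x by simp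
  then have "torus_inverse (t ?q) * t' ?q = 1"
    using act_eq_iff[of "\<sigma> ?q" "t ?q" "t' ?q"] tt[OF qO] \<sigma>[OF qO] by simp
  then have "t ?q * (torus_inverse (t ?q) * t' ?q) = t ?q" by simp
  then have "t' ?q = t ?q" using tt[OF qO] by (simp add: torus_inverse_mult flip: mult.assoc)
  then show False using x(2) by (simp add: G_def)
qed

lemma locally_path_connected_Q:
  assumes "\<And>x. x \<in> topspace X \<Longrightarrow> \<exists>W m \<xi>. torus_chart X act W m \<xi> \<and> x \<in> m ` W"
  shows "locally_path_connected_space Q"
  unfolding locally_path_connected_space
proof (intro allI impI)
  fix V q assume Vq: "openin Q V \<and> q \<in> V"
  then obtain x where x: "x \<in> topspace X" "q = orb x"
    using openin_subset[of Q V] by (auto simp: topspace_Q)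
  obtain W m \<xi> where ch: "torus_chart X act W m \<xi>" and "x \<in> m ` W" using assms[OF x(1)] by blast
  interpret torus_chart X act W m \<xi> by (rule ch)
  have q: "q \<in> dom_orb" using \<open>x \<in> m ` W\<close> x by (auto simp: dom_orb_def)
  obtain \<epsilon> where \<epsilon>: "\<epsilon> > 0" "box_at (rep q) \<epsilon> \<subseteq> W" "(\<lambda>w. orb (m w)) ` box_at (rep q) \<epsilon> \<subseteq> V"
    using box_neighbourhood Vq q by blast
  let ?B = "(\<lambda>w. orb (m w)) ` box_at (rep q) \<epsilon>"
  have "rep q \<in> box_at (rep q) \<epsilon>" using \<epsilon>(1) by (simp add: box_at_def)
  then have "q \<in> ?B" using rep(2)[OF q] by (metis image_eqI)
  moreover have op: "openin Q ?B" by (rule open_orb_m[OF open_box_at \<epsilon>(2)])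
  moreover have "path_connectedin Q ?B"
    using contractible_imp_path_connected_space[OF contractible_box[OF \<epsilon>(2)]] openin_subset[OF op]
    by (simp add: path_connectedin_def)
  ultimately show "\<exists>U. openin Q U \<and> path_connectedin Q U \<and> q \<in> U \<and> U \<subseteq> V" using \<epsilon>(3) by blast
qed

end

context chart_pair
begin

text \<open>By uniqueness the local transition functions agree on overlaps, so evaluating at each
  \<open>q\<close> the one chosen for \<open>q\<close> is locally the same as using a single
  continuous one.\<close>

lemma transition_exists:
  "\<exists>t. continuous_map (subtopology (orbit_space X act) (c1.dom_orb \<inter> c2.dom_orb)) euclidean t \<and>
     (\<forall>q\<in>c1.dom_orb \<inter> c2.dom_orb. t q \<in> torus \<and> c1.local_section q = act (t q) (c2.local_section q))"
proof -
  let ?D = "c1.dom_orb \<inter> c2.dom_orb"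
  define good where "good q O' t \<longleftrightarrow> openin (orbit_space X act) O' \<and> q \<in> O' \<and> O' \<subseteq> ?D \<and>
     continuous_map (subtopology (orbit_space X act) O') euclidean t \<and>
     (\<forall>q\<in>O'. t q \<in> torus \<and> c1.local_section q = act (t q) (c2.local_section q))" for q O' t
  have "\<exists>O' t. good q O' t" if "q \<in> ?D" for q
    unfolding good_def using local_transition[of q] that by blast
  then obtain O' t where g: "\<And>q. q \<in> ?D \<Longrightarrow> good q (O' q) (t q)" by metis
  have eq: "t q' q' = t q q'" if q: "q \<in> ?D" and q': "q' \<in> O' q" for q q'
  proof -
    have q'D: "q' \<in> ?D" using g[OF q] q' unfolding good_def by blast
    let ?O = "O' q \<inter> O' q'"
    have O: "openin (orbit_space X act) ?O" "?O \<subseteq> ?D" "q' \<in> ?O"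
      using g[OF q] g[OF q'D] q' unfolding good_def by auto
    have "continuous_map (subtopology (orbit_space X act) ?O) euclidean (t q')"
      using g[OF q'D] continuous_map_from_subtopology_mono unfolding good_def by (metis inf_le2)
    moreover have "continuous_map (subtopology (orbit_space X act) ?O) euclidean (t q)"
      using g[OF q] continuous_map_from_subtopology_mono unfolding good_def by (metis inf_le1)
    ultimately show ?thesis
    proof (rule c1.translation_unique[OF O(1), where \<sigma> = c2.local_section])
      show "\<exists>x\<in>topspace X. c1.orb x \<in> G \<and> c1.stab x = {1}"
        if "openin (orbit_space X act) G" "G \<noteq> {}" "G \<subseteq> ?O" for G
        using c1.free_orbit_dense[OF that(1,2)] that(3) O(2) by blast
      show "c2.local_section r \<in> topspace X \<and> c1.orb (c2.local_section r) = r" if "r \<in> ?O" for r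
        using that O(2) c2.local_section_in c2.orb_local_section by blast
      show "t q' r \<in> torus \<and> t q r \<in> torus \<and> act (t q' r) (c2.local_section r) = act (t q r) (c2.local_section r)"
        if "r \<in> ?O" for r
        using g[OF q] g[OF q'D] that unfolding good_def by (metis IntD1 IntD2)
    qed (rule O(3))
  qed
  have "continuous_map (subtopology (orbit_space X act) ?D) euclidean (\<lambda>q. t q q)"
  proof (rule continuous_map_locally)
    fix q assume "q \<in> topspace (subtopology (orbit_space X act) ?D)"
    then have q: "q \<in> ?D" by auto
    have sub: "O' q \<subseteq> ?D" "openin (orbit_space X act) (O' q)" "q \<in> O' q"
      and c: "continuous_map (subtopology (orbit_space X act) (O' q)) euclidean (t q)"
      using g[OF q] unfolding good_def by auto
    have "continuous_map (subtopology (orbit_space X act) (O' q)) euclidean (\<lambda>q. t q q)"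
      by (rule continuous_map_eq[OF c]) (use eq[OF q] in auto)
    moreover have "subtopology (subtopology (orbit_space X act) ?D) (O' q) = subtopology (orbit_space X act) (O' q)"
      using sub(1) by (simp add: subtopology_subtopology Int_absorb1)
    moreover have "openin (subtopology (orbit_space X act) ?D) (O' q)"
      using sub openin_subset_topspace_eq by (metis inf.absorb_iff2 openin_subtopology_Int2)
    ultimately show "\<exists>T. openin (subtopology (orbit_space X act) ?D) T \<and> q \<in> T \<and>
      continuous_map (subtopology (subtopology (orbit_space X act) ?D) T) euclidean (\<lambda>q. t q q)"
      using sub(3) by metis
  qed
  moreover have "t q q \<in> torus \<and> c1.local_section q = act (t q q) (c2.local_section q)" if "q \<in> ?D" for q
    using g[OF that] unfolding good_def by blast
  ultimately show ?thesis by blast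
qed

end

section \<open>Faces in local coordinates, and isotropy groups as face tori\<close>

section \<open>Faces of the orbit space\<close>

lemma card_eq_if_linear_images_eq:
  fixes A B :: "real ^ 'n \<Rightarrow> real ^ 'n"
  assumes "linear A" "inj A" "linear B" "inj B" and eq: "A ` coord_space Y = B ` coord_space Z"
  shows "card Y = card Z"
proof -
  have d: "dim (coord_space Y :: (real ^ 'n) set) = card Y" for Y :: "'n set"
    using dim_substandard_cart[of Y, where 'a = real] by (simp add: dim_vec_eq coord_space_def)
  have "dim (A ` coord_space Y) = card Y" "dim (B ` coord_space Z) = card Z"
    using assms d by (metis dim_image_eq inj_on_subset subset_UNIV)+
  then show ?thesis using eq by simp
qed

text \<open>An element of a coordinate torus is a product of elements of coordinate circles, split
  off one coordinate at a time; \<open>\<xi>\<close> preserves the products. This matches the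
  definition of a face torus by circles of facets.\<close>

lemma (in torus_chart) generate_coord_tori:
  assumes "w \<in> W"
  shows "generate torus_group (\<Union>j\<in>zero_set w. \<xi> ` coord_torus {j}) = stab (m w)"
proof
  interpret T: comm_group "torus_group :: (complex ^ 'n) monoid" by (rule comm_group_torus)
  have mono: "coord_torus Y \<subseteq> coord_torus Z" if "Y \<subseteq> Z" for Y Z :: "'n set"
    using that by (auto simp: coord_torus_def)
  have "subgroup (stab (m w)) torus_group"
    using group_action.stabilizer_subgroup[OF action m_in[OF assms]] .
  moreover have "(\<Union>j\<in>zero_set w. \<xi> ` coord_torus {j}) \<subseteq> stab (m w)"
    using mono stab_m[OF assms] by blast
  ultimately show "generate torus_group (\<Union>j\<in>zero_set w. \<xi> ` coord_torus {j}) \<subseteq> stab (m w)"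
    by (intro T.generate_subgroup_incl)
  have "\<xi> s \<in> generate torus_group (\<Union>j\<in>Z. \<xi> ` coord_torus {j})" if "finite Z" "s \<in> coord_torus Z" for s Z
    using that
  proof (induction Z arbitrary: s rule: finite_induct)
    case empty
    then have "s = 1" by (auto simp: coord_torus_def vec_eq_iff)
    then show ?case using generate.one[of torus_group] by (simp add: \<xi>_one)
  next
    case (insert j Z)
    let ?K = "\<Union>j\<in>insert j Z. \<xi> ` coord_torus {j}"
    define a :: "complex ^ 'n" where "a = (\<chi> i. if i = j then s $ i else 1)"
    define b :: "complex ^ 'n" where "b = (\<chi> i. if i = j then 1 else s $ i)"
    have a: "a \<in> coord_torus {j}" and b: "b \<in> coord_torus Z" and ab: "s = a * b"
      using insert.prems by (auto simp: a_def b_def coord_torus_def torus_def vec_eq_iff)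
    have "\<xi> b \<in> generate torus_group ?K"
      using insert.IH[OF b] T.mono_generate[of "\<Union>j\<in>Z. \<xi> ` coord_torus {j}" ?K] by blast
    moreover have "\<xi> a \<in> generate torus_group ?K"
      using a by (intro generate.incl) auto
    ultimately have "\<xi> a * \<xi> b \<in> generate torus_group ?K"
      using generate.eng[of "\<xi> a" torus_group ?K "\<xi> b"] by simp
    then show ?case using a b ab \<xi>_mult by (simp add: coord_torus_def)
  qed
  then show "stab (m w) \<subseteq> generate torus_group (\<Union>j\<in>zero_set w. \<xi> ` coord_torus {j})"
    unfolding stab_m[OF assms] by (metis (no_types, lifting) finite image_subset_iff)
qed

context torus_chart
begin

lemma orb_m_cpx_norms: "w \<in> W \<Longrightarrow> orb (m (cpx (norms w))) = orb (m w)"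
  using orb_m_abs_vec[of w] by (simp add: cpx_def norms_def abs_vec_def)

lemma continuous_orb_m: "continuous_map (top_of_set W) Q (\<lambda>w. orb (m w))"
  using continuous_map_compose[OF continuous_m continuous_orb] by (simp add: o_def)

text \<open>The part in a box of the codimension one stratum on which exactly the coordinate
  \<open>j\<close> vanishes.\<close>

definition box_facet :: "complex ^ 'n \<Rightarrow> real \<Rightarrow> 'n \<Rightarrow> 'x set set" where
  "box_facet w0 \<epsilon> j = (\<lambda>w. orb (m w)) ` {w \<in> box_at w0 \<epsilon>. zero_set w = {j}}"

text \<open>In terms of moduli it is convex: one coordinate is zero, the others are positive and
  confined to intervals.\<close>

lemma connectedin_box_facet:
  assumes "box_at w0 \<epsilon> \<subseteq> W"
  shows "connectedin Q (box_facet w0 \<epsilon> j)"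
proof -
  let ?R = "{r \<in> coord_box w0 \<epsilon>. r $ j = 0 \<and> (\<forall>k. k \<noteq> j \<longrightarrow> 0 < r $ k)}"
  have cB: "cpx r \<in> box_at w0 \<epsilon>" "zero_set (cpx r) = {j}" if "r \<in> ?R" for r
    using that by (auto simp: coord_box_def box_at_def cpx_def zero_set_def)
  have nR: "norms w \<in> ?R" if "w \<in> box_at w0 \<epsilon>" "zero_set w = {j}" for w
    using that by (auto simp: coord_box_def box_at_def norms_def zero_set_def)
  have img: "box_facet w0 \<epsilon> j = (\<lambda>r. orb (m (cpx r))) ` ?R"
  proof (intro equalityI subsetI)
    fix q assume "q \<in> box_facet w0 \<epsilon> j"
    then obtain w where w: "w \<in> box_at w0 \<epsilon>" "zero_set w = {j}" "q = orb (m w)" by (auto simp: box_facet_def)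
    then have "q = orb (m (cpx (norms w)))" using orb_m_cpx_norms[of w] assms by auto
    then show "q \<in> (\<lambda>r. orb (m (cpx r))) ` ?R" using nR[OF w(1,2)] by (rule image_eqI)
  next
    fix q assume "q \<in> (\<lambda>r. orb (m (cpx r))) ` ?R"
    then obtain r where r: "r \<in> ?R" "q = orb (m (cpx r))" by blast
    then show "q \<in> box_facet w0 \<epsilon> j" unfolding box_facet_def using cB[OF r(1)] by blast
  qed
  have "convex ?R"
    unfolding convex_def
  proof (intro ballI allI impI)
    fix x y and u v :: real
    assume xy: "x \<in> ?R" "y \<in> ?R" and uv: "0 \<le> u" "0 \<le> v" "u + v = 1"
    have "u *\<^sub>R x + v *\<^sub>R y \<in> coord_box w0 \<epsilon>"
      using convex_coord_box[of w0 \<epsilon>] xy uv unfolding convex_def by blast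
    moreover have "0 < u * x $ k + v * y $ k" if "k \<noteq> j" for k
    proof (cases "u = 0")
      case False
      then have "0 < u * x $ k" "0 \<le> v * y $ k" using xy uv that by (auto simp: less_imp_le)
      then show ?thesis by linarith
    qed (use xy uv that in auto)
    ultimately show "u *\<^sub>R x + v *\<^sub>R y \<in> ?R" using xy by auto
  qed
  then have "connectedin (top_of_set ?R) ?R"
    by (intro connectedin_subtopology[THEN iffD2] conjI connectedin_iff_connected[THEN iffD2] convex_connected) auto
  moreover have "continuous_map (top_of_set ?R) Q (\<lambda>r. orb (m (cpx r)))"
  proof -
    have "continuous_on ?R cpx" unfolding cpx_def by (intro continuous_intros)
    moreover have "cpx ` ?R \<subseteq> W" using cB(1) assms by blast
    ultimately have "continuous_map (top_of_set ?R) (top_of_set W) cpx" by auto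
    from continuous_map_compose[OF this continuous_orb_m] show ?thesis by (simp add: o_def)
  qed
  ultimately show ?thesis
    unfolding img using connectedin_continuous_map_image by blast
qed

text \<open>All vanishing coordinates except \<open>j\<close> can be moved off zero by arbitrarily
  little.\<close>

lemma closure_box_facet:
  assumes B: "box_at w0 \<epsilon> \<subseteq> W" and w: "w \<in> box_at w0 \<epsilon>" "j \<in> zero_set w"
  shows "orb (m w) \<in> Q closure_of box_facet w0 \<epsilon> j"
  unfolding in_closure_of
proof (intro conjI allI impI)
  show "orb (m w) \<in> topspace Q" using w B m_in by (auto simp: topspace_Q)
  fix T assume T: "orb (m w) \<in> T \<and> openin Q T"
  have "openin (top_of_set W) {w \<in> W. orb (m w) \<in> T}"
    using openin_continuous_map_preimage[OF continuous_orb_m] T by fastforce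
  then have "open {w \<in> W. orb (m w) \<in> T}" using open_W openin_open_trans by blast
  then have o: "open (box_at w0 \<epsilon> \<inter> {w \<in> W. orb (m w) \<in> T})" using open_box_at by blast
  obtain w' where "w' \<in> box_at w0 \<epsilon> \<inter> {w \<in> W. orb (m w) \<in> T}" "zero_set w' = {j}"
    using perturb_zeros[OF o, of w "{j}"] w T B by blast
  then show "\<exists>q. q \<in> box_facet w0 \<epsilon> j \<and> q \<in> T" by (auto simp: box_facet_def)
qed

lemma small_box:
  assumes q: "q \<in> dom_orb"
  obtains \<epsilon> where "\<epsilon> > 0" "box_at (rep q) \<epsilon> \<subseteq> W" "\<And>w. w \<in> box_at (rep q) \<epsilon> \<Longrightarrow> zero_set w \<subseteq> zero_set (rep q)"
proof -
  let ?w0 = "rep q"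
  have qT: "q \<in> topspace Q" using q openin_subset[OF openin_dom_orb] by (rule subsetD[rotated])
  obtain e where e: "e > 0" "box_at ?w0 e \<subseteq> W"
    using box_neighbourhood[OF openin_topspace qT q] by metis
  \<comment> \<open>The minimum of \<open>S\<close> is positive. It is at most \<open>e\<close>, so
    the box stays in \<open>W\<close>, and at most every nonzero modulus of the centre, so those
    coordinates cannot become zero.\<close>
  define S where "S = insert e ((\<lambda>i. norm (?w0 $ i)) ` (- zero_set ?w0))"
  have S: "finite S" "S \<noteq> {}" "\<And>x. x \<in> S \<Longrightarrow> x > 0" using e by (auto simp: S_def zero_set_def)
  define \<epsilon> where "\<epsilon> = Min S"
  have "\<epsilon> > 0" using S by (simp add: \<epsilon>_def)
  moreover have "\<epsilon> \<le> e" using S(1) by (simp add: \<epsilon>_def S_def)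
  then have "box_at ?w0 \<epsilon> \<subseteq> box_at ?w0 e" by (auto simp: box_at_def intro: less_le_trans)
  with e(2) have "box_at ?w0 \<epsilon> \<subseteq> W" by (rule order_trans[rotated])
  moreover have "zero_set w \<subseteq> zero_set ?w0" if w: "w \<in> box_at ?w0 \<epsilon>" for w
  proof
    fix i assume i: "i \<in> zero_set w"
    show "i \<in> zero_set ?w0"
    proof (rule ccontr)
      assume "i \<notin> zero_set ?w0"
      then have "\<epsilon> \<le> norm (?w0 $ i)" using S by (simp add: \<epsilon>_def S_def)
      moreover have "\<bar>norm (w $ i) - norm (?w0 $ i)\<bar> < \<epsilon>" using w by (simp add: box_at_def)
      ultimately show False using i by (simp add: zero_set_def)
    qed
  qed
  ultimately show ?thesis using that by blast
qed

end

locale locally_standard_action = torus_action X act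
  for X :: "'x topology" and act :: "complex ^ 'n \<Rightarrow> 'x \<Rightarrow> 'x" +
  fixes \<U> :: "(complex ^ 'n, 'x) orb_chart set"
  assumes smooth: "smooth_torus_action X \<U> act"
    and chart_cover: "p \<in> topspace X \<Longrightarrow> \<exists>c W \<psi> \<xi>. standard_chart X \<U> act c W \<psi> \<xi> \<and> p \<in> chart_image c"
begin

text \<open>Triples are required to come from standard charts of the orbifold, because this ensures
  that any two of them have smooth changes of coordinates.\<close>

definition is_chart :: "(complex ^ 'n) set \<Rightarrow> (complex ^ 'n \<Rightarrow> 'x) \<Rightarrow> (complex ^ 'n \<Rightarrow> complex ^ 'n) \<Rightarrow> bool" where
  "is_chart W m \<xi> \<longleftrightarrow> (\<exists>c \<psi>. standard_chart X \<U> act c W \<psi> \<xi> \<and> m = (\<lambda>w. chart_map c (\<psi> w)))"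

lemma is_chart_torus_chart: "is_chart W m \<xi> \<Longrightarrow> torus_chart X act W m \<xi>"
  unfolding is_chart_def using standard_chart_imp_torus_chart by blast

lemma is_chart_pair: "is_chart W1 m1 \<xi>1 \<Longrightarrow> is_chart W2 m2 \<xi>2 \<Longrightarrow> chart_pair X act W1 m1 \<xi>1 W2 m2 \<xi>2"
  unfolding is_chart_def using standard_charts_imp_chart_pair[OF smooth] by blast

lemma standard_chart_image:
  assumes "standard_chart X \<U> act c W \<psi> \<xi>"
  shows "chart_image c = (\<lambda>w. chart_map c (\<psi> w)) ` W"
proof -
  have "\<psi> ` W = chart_dom c" using assms by (auto simp: standard_chart_def diffeo_def bij_betw_def)
  then show ?thesis by (metis image_image)
qed

lemma is_chart_cover:
  assumes "q \<in> topspace Q"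
  obtains W m \<xi> where "is_chart W m \<xi>" "q \<in> torus_chart.dom_orb act W m"
proof -
  obtain x where x: "x \<in> topspace X" "q = orb x" using assms by (auto simp: topspace_Q)
  obtain c W \<psi> \<xi> where c: "standard_chart X \<U> act c W \<psi> \<xi>" "x \<in> chart_image c"
    using chart_cover[OF x(1)] by blast
  interpret torus_chart X act W "\<lambda>w. chart_map c (\<psi> w)" \<xi> by (rule standard_chart_imp_torus_chart[OF c(1)])
  have "q \<in> dom_orb" using c(2) x standard_chart_image[OF c(1)] by (auto simp: dom_orb_def)
  then show ?thesis using that c(1) unfolding is_chart_def by blast
qed

abbreviation corners :: "('x set set \<times> ('x set \<Rightarrow> real ^ 'n)) set" where
  "corners \<equiv> orbit_corner_charts X \<U> act"

text \<open>Corner charts prescribe their coordinates by moduli on \<open>W\<close>; squared moduli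
  of \<open>rep\<close> show that every standard chart carries such coordinates. So the codimension
  can be counted in \<open>W\<close>.\<close>

lemma stratum_iff:
  "q \<in> stratum corners k \<longleftrightarrow> (\<exists>W m \<xi> w. is_chart W m \<xi> \<and> w \<in> W \<and> q = orb (m w) \<and> card (zero_set w) = k)"
proof
  assume "q \<in> stratum corners k"
  then obtain V \<kappa> where V: "(V, \<kappa>) \<in> corners" "q \<in> V" "card {i. \<kappa> q $ i = 0} = k"
    by (auto simp: stratum_def)
  then obtain c W \<psi> \<xi> where c: "standard_chart X \<U> act c W \<psi> \<xi>" "V = orb ` chart_image c"
    and \<kappa>: "\<forall>w\<in>W. \<kappa> (orb (chart_map c (\<psi> w))) = (\<chi> i. (norm (w $ i))\<^sup>2)"
    by (auto simp: orbit_corner_charts_def)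
  obtain w where w: "w \<in> W" "q = orb (chart_map c (\<psi> w))"
    using V(2) standard_chart_image[OF c(1)] c(2) by auto
  have "{i. \<kappa> q $ i = 0} = zero_set w" using \<kappa> w by (auto simp: zero_set_def)
  then show "\<exists>W m \<xi> w. is_chart W m \<xi> \<and> w \<in> W \<and> q = orb (m w) \<and> card (zero_set w) = k"
    using V(3) c(1) w unfolding is_chart_def
    by (intro exI[of _ W] exI[of _ "\<lambda>w. chart_map c (\<psi> w)"] exI[of _ \<xi>] exI[of _ w]) auto
next
  assume "\<exists>W m \<xi> w. is_chart W m \<xi> \<and> w \<in> W \<and> q = orb (m w) \<and> card (zero_set w) = k"
  then obtain c W \<psi> \<xi> w where c: "standard_chart X \<U> act c W \<psi> \<xi>"
    and w: "w \<in> W" "q = orb (chart_map c (\<psi> w))" "card (zero_set w) = k"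
    unfolding is_chart_def by blast
  interpret torus_chart X act W "\<lambda>w. chart_map c (\<psi> w)" \<xi> by (rule standard_chart_imp_torus_chart[OF c])
  define \<kappa> :: "'x set \<Rightarrow> real ^ 'n" where "\<kappa> q = (\<chi> i. (norm (rep q $ i))\<^sup>2)" for q
  have \<kappa>: "\<kappa> (orb (chart_map c (\<psi> w))) = (\<chi> i. (norm (w $ i))\<^sup>2)" if "w \<in> W" for w
    using rep_orb_m[OF that] by (simp add: \<kappa>_def abs_vec_def)
  have "(orb ` chart_image c, \<kappa>) \<in> corners"
    unfolding orbit_corner_charts_def using c \<kappa> by blast
  moreover have "q \<in> orb ` chart_image c" using w standard_chart_image[OF c] by auto
  moreover have "{i. \<kappa> q $ i = 0} = zero_set w" using \<kappa>[OF w(1)] w(2) by (auto simp: zero_set_def)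
  ultimately show "q \<in> stratum corners k"
    using w(3) unfolding stratum_def by (auto intro!: bexI[of _ "(orb ` chart_image c, \<kappa>)"])
qed

text \<open>The number of vanishing coordinates is the dimension of the isotropy Lie algebra, which
  does not depend on the chart.\<close>

lemma card_zero_set_unique:
  assumes "is_chart W1 m1 \<xi>1" "is_chart W2 m2 \<xi>2" "w1 \<in> W1" "w2 \<in> W2" "orb (m1 w1) = orb (m2 w2)"
  shows "card (zero_set w1) = card (zero_set w2)"
proof -
  interpret c1: torus_chart X act W1 m1 \<xi>1 by (rule is_chart_torus_chart[OF assms(1)])
  interpret c2: torus_chart X act W2 m2 \<xi>2 by (rule is_chart_torus_chart[OF assms(2)])
  have "stab (m1 w1) = stab (m2 w2)"
    by (rule stab_orb[OF c1.m_in[OF assms(3)] c2.m_in[OF assms(4)] assms(5)])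
  then have "c1.lie_map ` coord_space (zero_set w1) = c2.lie_map ` coord_space (zero_set w2)"
    using c1.lie_algebra_stab[OF assms(3)] c2.lie_algebra_stab[OF assms(4)] by (simp add: coord_space_def)
  then show ?thesis
    by (rule card_eq_if_linear_images_eq[OF c1.lie_map(1) c1.inj_lie_map c2.lie_map(1) c2.inj_lie_map])
qed

lemma stratum_chart_iff:
  assumes "is_chart W m \<xi>" "w \<in> W"
  shows "orb (m w) \<in> stratum corners k \<longleftrightarrow> card (zero_set w) = k"
  unfolding stratum_iff using assms card_zero_set_unique by metis

lemma local_model:
  assumes "q \<in> topspace Q"
  obtains W m \<xi> w0 \<epsilon> where "is_chart W m \<xi>" "w0 \<in> W" "orb (m w0) = q" "\<epsilon> > 0" "box_at w0 \<epsilon> \<subseteq> W"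
    "\<And>w. w \<in> box_at w0 \<epsilon> \<Longrightarrow> zero_set w \<subseteq> zero_set w0"
proof -
  obtain W m \<xi> where c: "is_chart W m \<xi>" and q: "q \<in> torus_chart.dom_orb act W m"
    using is_chart_cover[OF assms] .
  interpret torus_chart X act W m \<xi> by (rule is_chart_torus_chart[OF c])
  obtain \<epsilon> where "\<epsilon> > 0" "box_at (rep q) \<epsilon> \<subseteq> W" "\<And>w. w \<in> box_at (rep q) \<epsilon> \<Longrightarrow> zero_set w \<subseteq> zero_set (rep q)"
    using small_box[OF q] by metis
  then show ?thesis using that c rep(1,2)[OF q] by metis
qed

lemma facetE:
  assumes "F \<in> faces Q corners k"
  obtains C where "C \<in> connected_components_of (subtopology Q (stratum corners k))" "F = Q closure_of C"
    "C \<subseteq> stratum corners k" "C \<subseteq> topspace Q"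
proof -
  obtain C where C: "C \<in> connected_components_of (subtopology Q (stratum corners k))" "F = Q closure_of C"
    using assms by (auto simp: faces_def)
  have "C \<subseteq> topspace (subtopology Q (stratum corners k))" by (rule connected_components_of_subset[OF C(1)])
  then show ?thesis using that C by auto
qed

lemma box_facet_subset_stratum:
  assumes c: "is_chart W m \<xi>" and B: "box_at w0 \<epsilon> \<subseteq> W"
  shows "torus_chart.box_facet act m w0 \<epsilon> j \<subseteq> stratum corners 1"
proof -
  interpret torus_chart X act W m \<xi> by (rule is_chart_torus_chart[OF c])
  show ?thesis using stratum_chart_iff[OF c] B by (auto simp: box_facet_def)
qed

text \<open>A facet is the closure of a component \<open>C\<close> of the codimension one stratum,
  so \<open>C\<close> itself meets the open box, at a point with one vanishing coordinate
  \<open>j\<close>. The corresponding box facet is connected and lies in the stratum, hence in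
  \<open>C\<close>.\<close>

lemma facet_contains_box_facet:
  assumes c: "is_chart W m \<xi>" and B: "box_at w0 \<epsilon> \<subseteq> W"
    and Z: "\<And>w. w \<in> box_at w0 \<epsilon> \<Longrightarrow> zero_set w \<subseteq> zero_set w0"
    and F: "F \<in> facets Q corners" and w: "w \<in> box_at w0 \<epsilon>" "orb (m w) \<in> F"
  shows "\<exists>j\<in>zero_set w0. torus_chart.box_facet act m w0 \<epsilon> j \<subseteq> F"
proof -
  interpret torus_chart X act W m \<xi> by (rule is_chart_torus_chart[OF c])
  obtain C where C: "C \<in> connected_components_of (subtopology Q (stratum corners 1))" "F = Q closure_of C"
    "C \<subseteq> stratum corners 1" "C \<subseteq> topspace Q"
    using facetE[OF F] .
  have "openin Q ((\<lambda>w. orb (m w)) ` box_at w0 \<epsilon>)" by (rule open_orb_m[OF open_box_at B])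
  moreover have "orb (m w) \<in> (\<lambda>w. orb (m w)) ` box_at w0 \<epsilon>" using w(1) by (rule imageI)
  moreover have "orb (m w) \<in> Q closure_of C" using w(2) by (simp only: C(2))
  ultimately obtain y where y: "y \<in> C" "y \<in> (\<lambda>w. orb (m w)) ` box_at w0 \<epsilon>"
    unfolding in_closure_of by metis
  then obtain w' where w': "w' \<in> box_at w0 \<epsilon>" "y = orb (m w')" by blast
  then have "card (zero_set w') = 1" using y(1) C(3) stratum_chart_iff[OF c] B by blast
  then obtain j where j: "zero_set w' = {j}" using card_1_singletonE by blast
  have yj: "y \<in> box_facet w0 \<epsilon> j" using w' j by (auto simp: box_facet_def)
  have "connectedin (subtopology Q (stratum corners 1)) (box_facet w0 \<epsilon> j)"
    using connectedin_box_facet[OF B] box_facet_subset_stratum[OF c B] by (simp add: connectedin_subtopology)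
  moreover have "\<not> disjnt C (box_facet w0 \<epsilon> j)" using y(1) yj by (auto simp: disjnt_def)
  ultimately have "box_facet w0 \<epsilon> j \<subseteq> C" using connected_components_of_maximal[OF C(1)] by blast
  also have "C \<subseteq> F" unfolding C(2) by (rule closure_of_subset[OF C(4)])
  finally show ?thesis using j Z[OF w'(1)] by blast
qed

lemma box_facet_in_facet:
  assumes c: "is_chart W m \<xi>" and B: "box_at w0 \<epsilon> \<subseteq> W" "\<epsilon> > 0" and j: "j \<in> zero_set w0"
  shows "\<exists>F\<in>facets Q corners. torus_chart.box_facet act m w0 \<epsilon> j \<subseteq> F"
    and "torus_chart.box_facet act m w0 \<epsilon> j \<noteq> {}"
proof -
  interpret torus_chart X act W m \<xi> by (rule is_chart_torus_chart[OF c])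
  have "w0 \<in> box_at w0 \<epsilon>" using B(2) by (simp add: box_at_def)
  then obtain w where "w \<in> box_at w0 \<epsilon>" "zero_set w = {j}"
    using perturb_zeros[OF open_box_at, of w0 w0 \<epsilon> "{j}"] j by blast
  then show ne: "box_facet w0 \<epsilon> j \<noteq> {}" by (auto simp: box_facet_def)
  have "connectedin (subtopology Q (stratum corners 1)) (box_facet w0 \<epsilon> j)"
    using connectedin_box_facet[OF B(1)] box_facet_subset_stratum[OF c B(1)] by (simp add: connectedin_subtopology)
  moreover from this have "subtopology Q (stratum corners 1) \<noteq> trivial_topology"
    using ne connectedin_subset_topspace by fastforce
  ultimately obtain C where C: "C \<in> connected_components_of (subtopology Q (stratum corners 1))" "box_facet w0 \<epsilon> j \<subseteq> C"
    using exists_connected_component_of_superset by blast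
  have "C \<subseteq> topspace Q" using connected_components_of_subset[OF C(1)] by auto
  then have "box_facet w0 \<epsilon> j \<subseteq> Q closure_of C" using C(2) closure_of_subset by blast
  then show "\<exists>F\<in>facets Q corners. box_facet w0 \<epsilon> j \<subseteq> F" using C(1) unfolding faces_def by blast
qed

lemma closedin_facet: "F \<in> faces Q corners k \<Longrightarrow> closedin Q F"
  by (auto simp: faces_def)

lemma stratum_unique:
  assumes "q \<in> stratum corners k" "q \<in> stratum corners l"
  shows "k = l"
  using assms stratum_chart_iff unfolding stratum_iff[of q k] by blast

text \<open>A component of a stratum is closed in that stratum, so its closure adds only points of
  other strata. Since a point has just one codimension, its component and its face are
  determined.\<close>

lemma face_of_point_eq:
  assumes C: "C \<in> connected_components_of (subtopology Q (stratum corners k))" and q: "q \<in> C"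
  shows "face_of_point Q corners q = Q closure_of C"
  unfolding face_of_point_def
proof (rule the_equality)
  have sub: "C \<subseteq> topspace Q" "C \<subseteq> stratum corners k"
    using connected_components_of_subset[OF C] by auto
  then have "q \<in> Q closure_of C" using q closure_of_subset by blast
  then show "\<exists>k. Q closure_of C \<in> faces Q corners k \<and> q \<in> rel_int_face corners k (Q closure_of C)"
    using C q sub by (auto simp: faces_def rel_int_face_def intro!: exI[of _ k])
next
  fix F assume "\<exists>k. F \<in> faces Q corners k \<and> q \<in> rel_int_face corners k F"
  then obtain l where l: "F \<in> faces Q corners l" "q \<in> F" "q \<in> stratum corners l" by (auto simp: rel_int_face_def)
  have "q \<in> stratum corners k" using connected_components_of_subset[OF C] q by auto
  then have "l = k" using l(3) stratum_unique by blast
  obtain C' where C': "C' \<in> connected_components_of (subtopology Q (stratum corners k))" "F = Q closure_of C'"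
    using facetE[OF l(1)] \<open>l = k\<close> by blast
  have "closedin (subtopology Q (stratum corners k)) C'" by (rule closedin_connected_components_of[OF C'(1)])
  then obtain T where T: "closedin Q T" "C' = T \<inter> stratum corners k" unfolding closedin_subtopology by blast
  have "Q closure_of C' \<subseteq> T" using T by (intro closure_of_minimal) auto
  then have "q \<in> C'" using l(2,3) T(2) C'(2) \<open>l = k\<close> by blast
  then have "C' = C"
    using C C'(1) q pairwise_disjoint_connected_components_of[of "subtopology Q (stratum corners k)"]
    by (metis disjnt_iff pairwiseD)
  then show "F = Q closure_of C" using C'(2) by simp
qed

text \<open>Within a connected component of a stratum, the points of a given facet form an open and closed set.\<close>

lemma face_of_point_subset_iff:
  assumes q: "q \<in> topspace Q" and F: "F \<in> facets Q corners"
  shows "face_of_point Q corners q \<subseteq> F \<longleftrightarrow> q \<in> F"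
proof -
  obtain k where k: "q \<in> stratum corners k"
    using is_chart_cover[OF q] stratum_iff torus_chart.dom_orb_def[OF is_chart_torus_chart]
    by (metis (no_types, lifting) imageE)
  let ?S = "subtopology Q (stratum corners k)"
  have "q \<in> topspace ?S" using q k by simp
  then obtain C where C: "C \<in> connected_components_of ?S" "q \<in> C"
    by (metis UnionE Union_connected_components_of)
  have sub: "C \<subseteq> topspace Q" "C \<subseteq> stratum corners k"
    using connected_components_of_subset[OF C(1)] by auto
  note face = face_of_point_eq[OF C]
  show ?thesis
  proof
    assume "face_of_point Q corners q \<subseteq> F"
    then show "q \<in> F" using face closure_of_subset[OF sub(1)] C(2) by blast
  next
    assume qF: "q \<in> F"
    have conn: "connectedin Q C"
      using connectedin_connected_components_of[OF C(1)] by (simp add: connectedin_subtopology)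
    have "openin (subtopology Q C) (C \<inter> F)"
    proof (subst openin_subopen, intro ballI)
      fix p assume p: "p \<in> C \<inter> F"
      then have pQ: "p \<in> topspace Q" using sub by blast
      obtain W m \<xi> w0 \<epsilon> where c: "is_chart W m \<xi>" and w0: "w0 \<in> W" "orb (m w0) = p" and \<epsilon>: "\<epsilon> > 0"
        and B: "box_at w0 \<epsilon> \<subseteq> W" and Z: "\<And>w. w \<in> box_at w0 \<epsilon> \<Longrightarrow> zero_set w \<subseteq> zero_set w0"
        using local_model[OF pQ] by metis
      interpret torus_chart X act W m \<xi> by (rule is_chart_torus_chart[OF c])
      have w0B: "w0 \<in> box_at w0 \<epsilon>" using \<epsilon> by (simp add: box_at_def)
      obtain j where j: "j \<in> zero_set w0" "box_facet w0 \<epsilon> j \<subseteq> F"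
        using facet_contains_box_facet[OF c B Z F w0B] p w0(2) by blast
      have card0: "card (zero_set w0) = k"
        using stratum_chart_iff[OF c w0(1)] w0(2) p sub(2) by blast
      let ?B = "(\<lambda>w. orb (m w)) ` box_at w0 \<epsilon>"
      have "C \<inter> ?B \<subseteq> C \<inter> F"
      proof
        fix r assume r: "r \<in> C \<inter> ?B"
        then obtain w where w: "w \<in> box_at w0 \<epsilon>" "r = orb (m w)" by blast
        then have "card (zero_set w) = k" using stratum_chart_iff[OF c, of w] B r sub(2) by blast
        \<comment> \<open>Both sets have \<open>k\<close> elements and one contains the other. So
          the coordinate \<open>j\<close> vanishes at every point of \<open>C\<close> in the box,
          which puts these points into the closure of the box facet.\<close>
        then have "zero_set w = zero_set w0" using Z[OF w(1)] card0 by (intro card_subset_eq) auto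
        then have "r \<in> Q closure_of box_facet w0 \<epsilon> j" using closure_box_facet[OF B w(1)] j(1) w(2) by simp
        also have "\<dots> \<subseteq> F" by (rule closure_of_minimal[OF j(2) closedin_facet[OF F]])
        finally show "r \<in> C \<inter> F" using r by blast
      qed
      moreover have "openin (subtopology Q C) (C \<inter> ?B)"
        using open_orb_m[OF open_box_at B] openin_subtopology_Int2 by blast
      moreover have "p \<in> C \<inter> ?B" using p w0 w0B by blast
      ultimately show "\<exists>T. openin (subtopology Q C) T \<and> p \<in> T \<and> T \<subseteq> C \<inter> F" by blast
    qed
    moreover have "closedin (subtopology Q C) (C \<inter> F)"
      using closedin_facet[OF F] closedin_subtopology_Int_closed by blast
    moreover have "connected_space (subtopology Q C)" using conn by (simp add: connectedin_def)
    moreover have "C \<inter> F \<noteq> {}" using qF C(2) by blast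
    ultimately have "C \<inter> F = topspace (subtopology Q C)"
      using connected_space_clopen_in by metis
    then have "C \<subseteq> F" using sub(1) by auto
    then show "face_of_point Q corners q \<subseteq> F"
      unfolding face using closure_of_minimal closedin_facet[OF F] by blast
  qed
qed

text \<open>Each facet through the orbit contains a box facet of a coordinate vanishing at
  \<open>w0\<close>, and each such box facet lies in a facet through the orbit. The isotropy group
  along a box facet identifies the circle of the facet with the image of a coordinate circle, so
  both families have the same union and generate the same group.\<close>

lemma face_torus_eq_stabilizer:
  fixes \<Lambda> :: "'x set set \<Rightarrow> int ^ 'n"
  assumes \<Lambda>: "\<And>F x. F \<in> facets Q corners \<Longrightarrow> x \<in> topspace X \<Longrightarrow> orb x \<in> rel_int_face corners 1 F \<Longrightarrow>
      circle_subgroup (\<Lambda> F) = stab x"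
    and x: "x \<in> topspace X"
  shows "face_torus Q corners \<Lambda> (face_of_point Q corners (orb x)) = stab x"
proof -
  let ?q = "orb x"
  have q: "?q \<in> topspace Q" using x by (simp add: topspace_Q)
  obtain W m \<xi> w0 \<epsilon> where c: "is_chart W m \<xi>" and w0: "w0 \<in> W" "orb (m w0) = ?q" and \<epsilon>: "\<epsilon> > 0"
    and B: "box_at w0 \<epsilon> \<subseteq> W" and Z: "\<And>w. w \<in> box_at w0 \<epsilon> \<Longrightarrow> zero_set w \<subseteq> zero_set w0"
    using local_model[OF q] by metis
  interpret torus_chart X act W m \<xi> by (rule is_chart_torus_chart[OF c])
  have w0B: "w0 \<in> box_at w0 \<epsilon>" using \<epsilon> by (simp add: box_at_def)
  have circle: "circle_subgroup (\<Lambda> F) = \<xi> ` coord_torus {j}"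
    if F: "F \<in> facets Q corners" and j: "j \<in> zero_set w0" "box_facet w0 \<epsilon> j \<subseteq> F" for F j
  proof -
    obtain w where w: "w \<in> box_at w0 \<epsilon>" "zero_set w = {j}"
      using box_facet_in_facet(2)[OF c B \<epsilon> j(1)] by (auto simp: box_facet_def)
    have "orb (m w) \<in> box_facet w0 \<epsilon> j" using w by (auto simp: box_facet_def)
    then have "orb (m w) \<in> rel_int_face corners 1 F"
      using j(2) box_facet_subset_stratum[OF c B] by (auto simp: rel_int_face_def)
    then have "circle_subgroup (\<Lambda> F) = stab (m w)" using \<Lambda>[OF F] m_in w(1) B by blast
    then show ?thesis using stab_m[of w] w B by auto
  qed
  have "(\<Union>F\<in>{F \<in> facets Q corners. ?q \<in> F}. circle_subgroup (\<Lambda> F)) = (\<Union>j\<in>zero_set w0. \<xi> ` coord_torus {j})"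
  proof (intro equalityI subsetI)
    fix t assume "t \<in> (\<Union>F\<in>{F \<in> facets Q corners. ?q \<in> F}. circle_subgroup (\<Lambda> F))"
    then obtain F where F: "F \<in> facets Q corners" "?q \<in> F" "t \<in> circle_subgroup (\<Lambda> F)" by blast
    have "orb (m w0) \<in> F" using F(2) by (simp only: w0(2))
    from facet_contains_box_facet[OF c B Z F(1) w0B this]
    obtain j where j: "j \<in> zero_set w0" "box_facet w0 \<epsilon> j \<subseteq> F" by metis
    have "t \<in> \<xi> ` coord_torus {j}" using F(3) by (simp only: circle[OF F(1) j])
    then show "t \<in> (\<Union>j\<in>zero_set w0. \<xi> ` coord_torus {j})" by (rule UN_I[OF j(1)])
  next
    fix t assume "t \<in> (\<Union>j\<in>zero_set w0. \<xi> ` coord_torus {j})"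
    then obtain j where j: "j \<in> zero_set w0" "t \<in> \<xi> ` coord_torus {j}" by blast
    obtain F where F: "F \<in> facets Q corners" "box_facet w0 \<epsilon> j \<subseteq> F"
      using box_facet_in_facet(1)[OF c B \<epsilon> j(1)] by blast
    have "?q \<in> Q closure_of box_facet w0 \<epsilon> j" using closure_box_facet[OF B w0B j(1)] w0(2) by simp
    then have "?q \<in> F" using closure_of_minimal[OF F(2) closedin_facet[OF F(1)]] by (rule subsetD[rotated])
    then have "F \<in> {F \<in> facets Q corners. ?q \<in> F}" using F(1) by simp
    moreover have "t \<in> circle_subgroup (\<Lambda> F)" using j(2) by (simp only: circle[OF F(1) j(1) F(2)])
    ultimately show "t \<in> (\<Union>F\<in>{F \<in> facets Q corners. ?q \<in> F}. circle_subgroup (\<Lambda> F))"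
      by (rule UN_I)
  qed
  moreover have "{F \<in> facets Q corners. face_of_point Q corners ?q \<subseteq> F} = {F \<in> facets Q corners. ?q \<in> F}"
    using face_of_point_subset_iff[OF q] by blast
  ultimately have "face_torus Q corners \<Lambda> (face_of_point Q corners ?q) = stab (m w0)"
    using generate_coord_tori[OF w0(1)] by (simp add: face_torus_def)
  also have "\<dots> = stab x" by (rule stab_orb[OF m_in[OF w0(1)] x w0(2)])
  finally show ?thesis .
qed

end

section \<open>Correction of the local sections and construction of the homeomorphism\<close>

section \<open>A global section\<close>

lemma continuous_map_vec_mult:
  fixes f g :: "'a \<Rightarrow> complex ^ 'n"
  assumes "continuous_map X euclidean f" "continuous_map X euclidean g"
  shows "continuous_map X euclidean (\<lambda>x. f x * g x)"
proof -
  have "continuous_map X (prod_topology euclidean euclidean) (\<lambda>x. (f x, g x))"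
    by (rule continuous_map_pairedI[OF assms])
  moreover have "continuous_map (prod_topology euclidean euclidean) euclidean (\<lambda>z. fst z * snd z :: complex ^ 'n)"
    by (auto intro!: continuous_on_vec_mult continuous_intros)
  ultimately have "continuous_map X euclidean ((\<lambda>z. fst z * snd z) \<circ> (\<lambda>x. (f x, g x)))"
    by (rule continuous_map_compose)
  then show ?thesis by (simp add: o_def)
qed

lemma continuous_map_vec_lambda:
  fixes f :: "'n::finite \<Rightarrow> 'a \<Rightarrow> complex"
  assumes "\<And>i. continuous_map X euclidean (f i)"
  shows "continuous_map X euclidean (\<lambda>x. \<chi> i. f i x)"
proof -
  have "(\<chi> i. f i x) = (\<Sum>i\<in>UNIV. axis i (f i x))" for x
    by (simp add: vec_eq_iff axis_def)
  moreover have "continuous_map X euclidean (\<lambda>x. axis i (f i x) :: complex ^ 'n)" for i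
  proof -
    have "continuous_on UNIV (axis i :: complex \<Rightarrow> complex ^ 'n)"
      unfolding axis_def
    proof (rule continuous_on_vec_lambda)
      show "continuous_on UNIV (\<lambda>z :: complex. if j = i then z else 0)" for j
        by (cases "j = i") auto
    qed
    then have "continuous_map X euclidean (axis i \<circ> f i :: 'a \<Rightarrow> complex ^ 'n)"
      by (intro continuous_map_compose[OF assms]) auto
    then show ?thesis by (simp add: o_def)
  qed
  ultimately show ?thesis by (simp add: continuous_map_sum)
qed

lemma continuous_map_torus_inverse:
  assumes "continuous_map X (top_of_set torus) f"
  shows "continuous_map X (top_of_set torus) (\<lambda>x. torus_inverse (f x))"
proof -
  have "continuous_map (top_of_set torus) (top_of_set torus) torus_inverse"
    using torus_inverse torus_nonzero
    by (auto simp: torus_inverse_def[abs_def] intro!: continuous_intros)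
  from continuous_map_compose[OF assms this] show ?thesis by (simp add: o_def)
qed

context locally_standard_action
begin

lemma contractible_chart_neighbourhood:
  assumes "q \<in> topspace Q"
  shows "\<exists>W m \<xi> U. is_chart W m \<xi> \<and> openin Q U \<and> q \<in> U \<and> U \<subseteq> torus_chart.dom_orb act W m \<and>
    contractible_space (subtopology Q U)"
proof -
  obtain W m \<xi> w0 \<epsilon> where c: "is_chart W m \<xi>" and w0: "w0 \<in> W" "orb (m w0) = q" and \<epsilon>: "\<epsilon> > 0"
    and B: "box_at w0 \<epsilon> \<subseteq> W"
    using local_model[OF assms] by metis
  interpret torus_chart X act W m \<xi> by (rule is_chart_torus_chart[OF c])
  have "w0 \<in> box_at w0 \<epsilon>" using \<epsilon> by (simp add: box_at_def)
  then have "q \<in> (\<lambda>w. orb (m w)) ` box_at w0 \<epsilon>" using w0(2) by blast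
  moreover have "(\<lambda>w. orb (m w)) ` box_at w0 \<epsilon> \<subseteq> dom_orb" unfolding dom_orb_def using B by (rule image_mono)
  ultimately show ?thesis
    using c open_orb_m[OF open_box_at B] contractible_box[OF B] by metis
qed

theorem global_section:
  assumes cpt: "compact_space X" and Haus: "Hausdorff_space Q"
    and H2: "trivial_group (cohomology_group 2 Q (int_vec_group :: (int ^ 'n) monoid))"
  shows "\<exists>\<sigma>. continuous_map Q X \<sigma> \<and> (\<forall>q\<in>topspace Q. orb (\<sigma> q) = q)"
proof -
  let ?I = "topspace Q"
  define good where "good q W m \<xi> U \<longleftrightarrow> is_chart W m \<xi> \<and> openin Q U \<and> q \<in> U \<and> U \<subseteq> torus_chart.dom_orb act W m \<and>
    contractible_space (subtopology Q U)" for q W m \<xi> U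
  have "\<exists>W m \<xi> U. good q W m \<xi> U" if "q \<in> ?I" for q
    using contractible_chart_neighbourhood[OF that] unfolding good_def .
  then obtain W m \<xi> U where "\<And>q. q \<in> ?I \<Longrightarrow> good q (W q) (m q) (\<xi> q) (U q)" by metis
  then have c: "\<And>q. q \<in> ?I \<Longrightarrow> is_chart (W q) (m q) (\<xi> q)" and opU: "\<And>q. q \<in> ?I \<Longrightarrow> openin Q (U q)"
    and qU: "\<And>q. q \<in> ?I \<Longrightarrow> q \<in> U q" and UD: "\<And>q. q \<in> ?I \<Longrightarrow> U q \<subseteq> torus_chart.dom_orb act (W q) (m q)"
    and contr: "\<And>q. q \<in> ?I \<Longrightarrow> contractible_space (subtopology Q (U q))"
    unfolding good_def by blast+
  define D where "D q = torus_chart.dom_orb act (W q) (m q)" for q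
  define s where "s q = torus_chart.local_section act (W q) (m q)" for q
  have chart: "torus_chart X act (W q) (m q) (\<xi> q)" if "q \<in> ?I" for q
    using is_chart_torus_chart[OF c[OF that]] .
  have opD: "openin Q (D q)" if "q \<in> ?I" for q
    unfolding D_def by (rule torus_chart.openin_dom_orb[OF chart[OF that]])
  have s: "continuous_map (subtopology Q (D q)) X (s q)" if "q \<in> ?I" for q
    unfolding D_def s_def by (rule torus_chart.continuous_local_section[OF chart[OF that]])
  have sX: "s i q \<in> topspace X" "orb (s i q) = q" if "i \<in> ?I" "q \<in> D i" for i q
    using torus_chart.local_section_in[OF chart[OF that(1)]] torus_chart.orb_local_section[OF chart[OF that(1)]] that(2)
    by (auto simp: D_def s_def)
  have UD': "U q \<subseteq> D q" if "q \<in> ?I" for q using UD[OF that] by (simp add: D_def)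
  have "\<exists>t. continuous_map (subtopology Q (D i \<inter> D j)) euclidean t \<and>
      (\<forall>q\<in>D i \<inter> D j. t q \<in> torus \<and> s i q = act (t q) (s j q))" if "i \<in> ?I" "j \<in> ?I" for i j
    unfolding D_def s_def by (rule chart_pair.transition_exists[OF is_chart_pair[OF c[OF that(1)] c[OF that(2)]]])
  then obtain t where t: "\<And>i j. i \<in> ?I \<Longrightarrow> j \<in> ?I \<Longrightarrow> continuous_map (subtopology Q (D i \<inter> D j)) euclidean (t i j) \<and>
      (\<forall>q\<in>D i \<inter> D j. t i j q \<in> torus \<and> s i q = act (t i j q) (s j q))"
    by metis
  have tT: "t i j q \<in> torus" and ts: "s i q = act (t i j q) (s j q)"
    if "i \<in> ?I" "j \<in> ?I" "q \<in> D i" "q \<in> D j" for i j q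
    using t[OF that(1,2)] that(3,4) by blast+
  \<comment> \<open>Both sides translate the section \<open>s k\<close> to \<open>s i\<close>, and
    translations between sections are unique.\<close>
  have cocycle: "t i k p = t i j p * t j k p"
    if ijk: "i \<in> ?I" "j \<in> ?I" "k \<in> ?I" and p: "p \<in> D i \<inter> D j \<inter> D k" for i j k p
  proof (rule translation_unique[of "D i \<inter> D j \<inter> D k" _ _ "s k"])
    let ?O = "D i \<inter> D j \<inter> D k"
    show "openin Q ?O" using opD ijk by (intro openin_Int) auto
    show "continuous_map (subtopology Q ?O) euclidean (t i k)"
      using t[OF ijk(1,3)] continuous_map_from_subtopology_mono[of Q "D i \<inter> D k" _ _ ?O] by blast
    show "continuous_map (subtopology Q ?O) euclidean (\<lambda>p. t i j p * t j k p)"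
      using t[OF ijk(1,2)] continuous_map_from_subtopology_mono[of Q "D i \<inter> D j" _ _ ?O]
        t[OF ijk(2,3)] continuous_map_from_subtopology_mono[of Q "D j \<inter> D k" _ _ ?O]
      by (intro continuous_map_vec_mult) blast+
    show "\<exists>x\<in>topspace X. orb x \<in> G \<and> stab x = {1}" if "openin Q G" "G \<noteq> {}" "G \<subseteq> ?O" for G
      using torus_chart.free_orbit_dense[OF chart[OF ijk(1)] that(1,2)] that(3) unfolding D_def by blast
    show "s k q \<in> topspace X \<and> orb (s k q) = q" if "q \<in> ?O" for q
      using sX[OF ijk(3)] that by blast
    show "t i k q \<in> torus \<and> t i j q * t j k q \<in> torus \<and> act (t i k q) (s k q) = act (t i j q * t j k q) (s k q)"
      if q: "q \<in> ?O" for q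
    proof -
      have "act (t i j q * t j k q) (s k q) = act (t i j q) (act (t j k q) (s k q))"
        using tT[of i j q] tT[of j k q] sX(1)[of k q] ijk q by (intro act_mult) auto
      also have "\<dots> = s i q" using ts[of i j q] ts[of j k q] ijk q by auto
      finally show ?thesis
        using tT[of i j q] tT[of j k q] tT[of i k q] ts[of i k q] ijk q torus_mult by auto
    qed
  qed (use p in auto)
  have "compactin Q (orb ` topspace X)"
    using image_compactin[OF _ continuous_orb] cpt by (simp add: compact_space_def)
  then have cptQ: "compact_space Q" by (simp add: compact_space_def topspace_Q)
  have lpc: "locally_path_connected_space Q"
  proof (rule locally_path_connected_Q)
    fix x assume "x \<in> topspace X"
    then obtain e W \<psi> \<xi> where e: "standard_chart X \<U> act e W \<psi> \<xi>" "x \<in> chart_image e" using chart_cover by blast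
    then have "x \<in> (\<lambda>w. chart_map e (\<psi> w)) ` W" using standard_chart_image by blast
    then show "\<exists>W m \<xi>. torus_chart X act W m \<xi> \<and> x \<in> m ` W" using standard_chart_imp_torus_chart[OF e(1)] by blast
  qed
  have inI: "q \<in> ?I" if "i \<in> ?I" "q \<in> U i" for i q using opU that openin_subset by blast
  define trivialises where "trivialises k g \<longleftrightarrow> (\<forall>q\<in>?I. norm (g q :: complex) = 1) \<and>
      (\<forall>i\<in>?I. continuous_map (subtopology Q (U i)) euclidean (\<lambda>q. g q * (t i q q $ k)))" for k g
  have "\<exists>g. trivialises k g" for k
  proof -
    \<comment> \<open>Every point is also an index, namely of the chart chosen around it. So
      \<open>t i q q\<close> compares the section \<open>s i\<close> at \<open>q\<close> with that
      of the chart of \<open>q\<close>: discontinuous in \<open>q\<close>, but by the cocycle rule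
      with quotients equal to the transition functions.\<close>
    interpret circle_cocycle Q ?I U "\<lambda>i q. t i q q $ k"
    proof
      show "?I \<subseteq> (\<Union>i\<in>?I. U i)" using qU by blast
      show "norm (t i q q $ k) = 1" if "i \<in> ?I" "q \<in> U i" for i q
      proof -
        have "q \<in> ?I" by (rule inI[OF that])
        then have "t i q q \<in> torus" using tT[of i q q] that UD' qU by blast
        then show ?thesis by (simp add: torus_def)
      qed
      fix i j assume ij: "i \<in> ?I" "j \<in> ?I"
      have "continuous_map (subtopology Q (D i \<inter> D j)) euclidean (\<lambda>q. t i j q $ k)"
      proof -
        have "continuous_map euclidean euclidean (\<lambda>v :: complex ^ 'n. v $ k)" by (auto intro!: continuous_intros)
        from continuous_map_compose[OF conjunct1[OF t[OF ij]] this] show ?thesis by (simp add: o_def)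
      qed
      then have *: "continuous_map (subtopology Q (U i \<inter> U j)) euclidean (\<lambda>q. t i j q $ k)"
        using UD'[OF ij(1)] UD'[OF ij(2)] continuous_map_from_subtopology_mono by (metis Int_mono)
      show "continuous_map (subtopology Q (U i \<inter> U j)) euclidean (\<lambda>q. t i q q $ k / t j q q $ k)"
      proof (rule continuous_map_eq[OF *])
        fix q assume q: "q \<in> topspace (subtopology Q (U i \<inter> U j))"
        then have qI: "q \<in> ?I" by simp
        have qD: "q \<in> D i" "q \<in> D j" "q \<in> D q" using q UD' ij qU[OF qI] qI by auto
        have "t i q q = t i j q * t j q q" using cocycle[OF ij qI] qD by blast
        moreover have "t j q q $ k \<noteq> 0" using torus_nonzero tT[OF ij(2) qI qD(2,3)] by blast
        ultimately show "t i j q $ k = t i q q $ k / t j q q $ k" by simp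
      qed
    qed (use opU in auto)
    show ?thesis unfolding trivialises_def by (rule global_trivialisation[OF cptQ Haus lpc contr H2])
  qed
  then obtain g where triv: "\<And>k. trivialises k (g k)" by metis
  have g: "norm (g k q) = 1" if "q \<in> ?I" for k q using triv that unfolding trivialises_def by blast
  have gc: "continuous_map (subtopology Q (U i)) euclidean (\<lambda>q. g k q * (t i q q $ k))" if "i \<in> ?I" for i k
    using triv that unfolding trivialises_def by blast
  define G where "G q = (\<chi> k. g k q)" for q
  have G: "G q \<in> torus" if "q \<in> ?I" for q using g that by (simp add: G_def torus_def)
  define \<sigma> where "\<sigma> q = act (torus_inverse (G q)) (s q q)" for q
  \<comment> \<open>The definition of \<open>\<sigma>\<close> uses a different chart at each point.
    Over \<open>U i\<close> it is rewritten with the single section \<open>s i\<close>, whose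
    translation involves the continuous product \<open>G q * t i q q\<close>.\<close>
  have local: "\<sigma> q = act (torus_inverse (G q * t i q q)) (s i q)" if i: "i \<in> ?I" and q: "q \<in> U i" for i q
  proof -
    have qI: "q \<in> ?I" by (rule inI[OF i q])
    have D: "q \<in> D i" "q \<in> D q" using UD' i q qU qI by auto
    have T: "t i q q \<in> torus" by (rule tT[OF i qI D])
    have "torus_inverse (G q * t i q q) * t i q q = torus_inverse (G q)"
      using torus_nonzero[OF T] by (simp add: torus_inverse_def vec_eq_iff)
    moreover have "act (torus_inverse (G q * t i q q)) (s i q) = act (torus_inverse (G q * t i q q) * t i q q) (s q q)"
      using ts[OF i qI D] sX(1)[OF qI D(2)] T torus_inverse[OF torus_mult[OF G[OF qI] T]] by (simp add: act_mult)
    ultimately show ?thesis by (simp add: \<sigma>_def)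
  qed
  have "continuous_map Q X \<sigma>"
  proof (rule continuous_map_locally)
    fix i assume i: "i \<in> ?I"
    have "continuous_map (subtopology Q (U i)) euclidean (\<lambda>q. \<chi> k. g k q * (t i q q $ k))"
      by (rule continuous_map_vec_lambda, rule gc[OF i])
    then have "continuous_map (subtopology Q (U i)) euclidean (\<lambda>q. G q * t i q q)"
      by (rule continuous_map_eq) (simp add: G_def vec_eq_iff)
    moreover have "G q * t i q q \<in> torus" if "q \<in> U i" for q
      using torus_mult[OF G[OF inI[OF i that]] tT[OF i inI[OF i that]]] UD' i that qU[OF inI[OF i that]] inI[OF i that] by blast
    ultimately have "continuous_map (subtopology Q (U i)) (top_of_set torus) (\<lambda>q. G q * t i q q)"
      by (auto simp: continuous_map_in_subtopology)
    then have "continuous_map (subtopology Q (U i)) (top_of_set torus) (\<lambda>q. torus_inverse (G q * t i q q))"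
      by (rule continuous_map_torus_inverse)
    moreover have "continuous_map (subtopology Q (U i)) X (s i)"
      using s[OF i] UD'[OF i] continuous_map_from_subtopology_mono by blast
    ultimately have "continuous_map (subtopology Q (U i)) X (\<lambda>q. act (torus_inverse (G q * t i q q)) (s i q))"
      by (rule continuous_map_act)
    then have "continuous_map (subtopology Q (U i)) X \<sigma>"
      by (rule continuous_map_eq) (simp add: local[OF i])
    then show "\<exists>T. openin Q T \<and> i \<in> T \<and> continuous_map (subtopology Q T) X \<sigma>" using opU[OF i] qU[OF i] by blast
  qed
  moreover have "orb (\<sigma> q) = q" if q: "q \<in> ?I" for q
  proof -
    have D: "q \<in> D q" using UD' q qU by blast
    show ?thesis using orb_act[OF sX(1)[OF q D] torus_inverse[OF G[OF q]]] sX(2)[OF q D] by (simp add: \<sigma>_def)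
  qed
  ultimately show ?thesis by blast
qed

end

section \<open>The equivariant homeomorphism\<close>

lemma (in torus_action) homeomorphism_of_section:
  assumes cpt: "compact_space X" and Haus: "Hausdorff_space X"
    and \<sigma>: "continuous_map Q X \<sigma>" "\<And>q. q \<in> topspace Q \<Longrightarrow> orb (\<sigma> q) = q"
    and FT: "\<And>x. x \<in> topspace X \<Longrightarrow> face_torus Q \<A> \<Lambda> (face_of_point Q \<A> (orb x)) = stab x"
  shows "\<exists>f. homeomorphic_map (model_space Q \<A> \<Lambda>) X f \<and>
           (\<forall>t\<in>torus. \<forall>z\<in>topspace (model_space Q \<A> \<Lambda>). f (model_act t z) = act t (f z)) \<and>
           (\<forall>z\<in>topspace (model_space Q \<A> \<Lambda>). orb (f z) = model_pr1 z)"
proof -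
  let ?P = "prod_topology Q (top_of_set (torus :: (complex ^ 'n) set))"
  define cls where "cls z = model_rel Q \<A> \<Lambda> `` {z}" for z
  define h where "h z = act (snd z) (\<sigma> (fst z))" for z
  define f where "f C = h (SOME z. z \<in> C)" for C
  have \<sigma>X: "\<sigma> q \<in> topspace X" if "q \<in> topspace Q" for q using \<sigma>(1) that by (auto simp: continuous_map_def)
  \<comment> \<open>Because the face torus is the isotropy group, an equivalence class is exactly a
    fibre of \<open>h\<close>. This gives both that \<open>f\<close> is well defined and that it is
    injective.\<close>
  have cls: "cls (x, t) = {(x, s) |s. s \<in> torus \<and> act s (\<sigma> x) = act t (\<sigma> x)}" if "x \<in> topspace Q" "t \<in> torus" for x t
  proof -
    have "face_torus Q \<A> \<Lambda> (face_of_point Q \<A> x) = stab (\<sigma> x)"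
      using FT[OF \<sigma>X[OF that(1)]] \<sigma>(2)[OF that(1)] by simp
    then have "inv\<^bsub>torus_group\<^esub> t * s \<in> face_torus Q \<A> \<Lambda> (face_of_point Q \<A> x) \<longleftrightarrow> act s (\<sigma> x) = act t (\<sigma> x)"
      if "s \<in> torus" for s
      using act_eq_iff[OF \<sigma>X[OF \<open>x \<in> topspace Q\<close>] \<open>t \<in> torus\<close> that] inv_torus_group[OF \<open>t \<in> torus\<close>]
      by (simp only: eq_commute)
    then show ?thesis using that unfolding cls_def model_rel_def by blast
  qed
  \<comment> \<open>Stated for arbitrary nonempty sets, so that it also evaluates \<open>f\<close>
    on \<open>model_act t C\<close> without identifying that set as a class.\<close>
  have f_const: "f C = p" if "C \<noteq> {}" "\<And>z. z \<in> C \<Longrightarrow> h z = p" for C p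
    unfolding f_def using that someI_ex[of "\<lambda>z. z \<in> C"] by blast
  have f_cls: "f (cls (x, t)) = act t (\<sigma> x)" if "x \<in> topspace Q" "t \<in> torus" for x t
    by (rule f_const) (use that in \<open>auto simp: cls[OF that] h_def\<close>)
  have M: "model_space Q \<A> \<Lambda> = quotient_topology ?P cls" by (simp add: model_space_def cls_def[abs_def])
  have topM: "topspace (model_space Q \<A> \<Lambda>) = cls ` (topspace Q \<times> torus)"
    by (simp add: M topspace_quotient_topology)
  have q: "quotient_map ?P (model_space Q \<A> \<Lambda>) cls" unfolding M by (rule quotient_map_quotient_topology)
  have "continuous_map ?P X h"
    unfolding h_def
  proof (rule continuous_map_act)
    show "continuous_map ?P (top_of_set torus) snd" by (rule continuous_map_snd)
    show "continuous_map ?P X (\<lambda>z. \<sigma> (fst z))"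
      using continuous_map_compose[OF continuous_map_fst \<sigma>(1)] by (simp add: o_def)
  qed
  then have "continuous_map ?P X (f \<circ> cls)"
    by (rule continuous_map_eq) (auto simp: f_cls h_def)
  then have contf: "continuous_map (model_space Q \<A> \<Lambda>) X f"
    using continuous_compose_quotient_map_eq[OF q] by blast
  have cptQ: "compact_space Q"
    using image_compactin[OF _ continuous_orb, of "topspace X"] cpt by (simp add: compact_space_def topspace_Q)
  have "compact_space (top_of_set (torus :: (complex ^ 'n) set))"
    using compact_torus by (simp add: compact_space_def compactin_subtopology)
  then have "compact_space ?P" using cptQ unfolding compact_space_prod_topology by blast
  then have cptM: "compact_space (model_space Q \<A> \<Lambda>)"
    using image_compactin[OF _ quotient_imp_continuous_map[OF q], of "topspace ?P"] quotient_imp_surjective_map[OF q]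
    by (simp add: compact_space_def)
  have inj: "inj_on f (topspace (model_space Q \<A> \<Lambda>))"
  proof (rule inj_onI)
    fix C C' assume "C \<in> topspace (model_space Q \<A> \<Lambda>)" "C' \<in> topspace (model_space Q \<A> \<Lambda>)" and eq: "f C = f C'"
    then obtain x t y s where C: "C = cls (x, t)" "x \<in> topspace Q" "t \<in> torus" and C': "C' = cls (y, s)" "y \<in> topspace Q" "s \<in> torus"
      unfolding topM by blast
    have e: "act t (\<sigma> x) = act s (\<sigma> y)" using eq f_cls C C' by simp
    have "x = orb (act t (\<sigma> x))" using orb_act[OF \<sigma>X[OF C(2)] C(3)] \<sigma>(2)[OF C(2)] by simp
    also have "\<dots> = y" using orb_act[OF \<sigma>X[OF C'(2)] C'(3)] \<sigma>(2)[OF C'(2)] e by simp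
    finally show "C = C'" using e C C' by (simp add: cls)
  qed
  have surj: "f ` topspace (model_space Q \<A> \<Lambda>) = topspace X"
  proof (intro equalityI subsetI)
    fix p assume "p \<in> f ` topspace (model_space Q \<A> \<Lambda>)"
    then show "p \<in> topspace X" using contf by (auto simp: continuous_map_def)
  next
    fix p assume p: "p \<in> topspace X"
    then have oQ: "orb p \<in> topspace Q" by (simp add: topspace_Q)
    obtain t where t: "t \<in> torus" "p = act t (\<sigma> (orb p))"
      using orb_eq_iff[OF \<sigma>X[OF oQ] p] \<sigma>(2)[OF oQ] by blast
    then have "p = f (cls (orb p, t))" using f_cls[OF oQ t(1)] by simp
    then show "p \<in> f ` topspace (model_space Q \<A> \<Lambda>)" unfolding topM using oQ t(1) by blast
  qed
  have "homeomorphic_map (model_space Q \<A> \<Lambda>) X f"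
    by (rule continuous_imp_homeomorphic_map[OF contf cptM Haus surj inj])
  moreover have "f (model_act t C) = act t (f C)" if t: "t \<in> torus" and CM: "C \<in> topspace (model_space Q \<A> \<Lambda>)" for t C
  proof -
    obtain x s where C: "C = cls (x, s)" "x \<in> topspace Q" "s \<in> torus" using CM unfolding topM by blast
    have ne: "model_act t C \<noteq> {}" using C by (auto simp: model_act_def cls)
    have "h z = act t (act s (\<sigma> x))" if "z \<in> model_act t C" for z
    proof -
      obtain r where r: "z = (x, t * r)" "r \<in> torus" "act r (\<sigma> x) = act s (\<sigma> x)"
        using \<open>z \<in> model_act t C\<close> C by (auto simp: model_act_def cls)
      then show ?thesis using act_mult[OF t r(2) \<sigma>X[OF C(2)]] by (simp add: h_def)
    qed
    then show ?thesis using f_const[OF ne] f_cls[OF C(2,3)] C(1) by simp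
  qed
  moreover have "orb (f C) = model_pr1 C" if CM: "C \<in> topspace (model_space Q \<A> \<Lambda>)" for C
  proof -
    obtain x s where C: "C = cls (x, s)" "x \<in> topspace Q" "s \<in> torus" using CM unfolding topM by blast
    have "fst ` C = {x}" using C by (auto simp: cls image_iff)
    then show ?thesis
      using f_cls[OF C(2,3)] orb_act[OF \<sigma>X[OF C(2)] C(3)] \<sigma>(2)[OF C(2)] C(1) by (simp add: model_pr1_def)
  qed
  ultimately show ?thesis by blast
qed

theorem theorem4p5:
  fixes X :: "'x topology"
    and \<U> :: "(complex ^ 'n, 'x) orb_chart set"
    and act :: "complex ^ 'n \<Rightarrow> 'x \<Rightarrow> 'x"
    and ori :: "'x set set \<Rightarrow> (complex ^ 'n, 'x) orb_chart \<Rightarrow> complex ^ 'n \<Rightarrow> (complex ^ 'n) list \<Rightarrow> real"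
    and Q :: "'x set topology"
    and \<pi> :: "'x \<Rightarrow> 'x set"
    and \<A> :: "('x set set \<times> ('x set \<Rightarrow> real ^ 'n)) set"
    and \<Lambda> :: "'x set set \<Rightarrow> int ^ 'n"
  defines "Q \<equiv> orbit_space X act"
    and "\<pi> \<equiv> orbit torus_group act"
    and "\<A> \<equiv> orbit_corner_charts X \<U> act"
  assumes "locally_standard_torus_orbifold X \<U> act ori"
    and "CW_complex Q"
    and "trivial_group (cohomology_group 2 Q (int_vec_group :: (int ^ 'n) monoid))"
    and "characteristic_function Q \<A> \<Lambda>"
    and "\<And>F x. F \<in> facets Q \<A> \<Longrightarrow> x \<in> topspace X \<Longrightarrow> \<pi> x \<in> rel_int_face \<A> 1 F \<Longrightarrow>
           circle_subgroup (\<Lambda> F) = stabilizer torus_group act x"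
  shows "\<exists>f. homeomorphic_map (model_space Q \<A> \<Lambda>) X f \<and>
           (\<forall>t\<in>torus. \<forall>z\<in>topspace (model_space Q \<A> \<Lambda>). f (model_act t z) = act t (f z)) \<and>
           (\<forall>z\<in>topspace (model_space Q \<A> \<Lambda>). \<pi> (f z) = model_pr1 z)"
proof -
  have smooth: "smooth_torus_action X \<U> act" and X: "compact_space X" "Hausdorff_space X"
    and charts: "\<forall>p\<in>topspace X. \<exists>c W \<psi> \<xi>. standard_chart X \<U> act c W \<psi> \<xi> \<and> p \<in> chart_image c"
    using assms(4) by (auto simp: locally_standard_torus_orbifold_def torus_orbifold_def closed_oriented_orbifold_def)
  interpret locally_standard_action X act \<U>
  proof (rule locally_standard_action.intro)
    show "torus_action X act"
      by (rule torus_action.intro) (use smooth in \<open>simp_all add: smooth_torus_action_def\<close>)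
    show "locally_standard_action_axioms X act \<U>"
      by (rule locally_standard_action_axioms.intro) (use smooth charts in auto)
  qed
  \<comment> \<open>Hausdorffness of the orbit space, on which the partition of unity relies, is
    part of the CW structure.\<close>
  have Haus: "Hausdorff_space (orbit_space X act)" using assms(5) unfolding CW_complex_def Q_def by (rule conjunct1)
  obtain \<sigma> where \<sigma>: "continuous_map (orbit_space X act) X \<sigma> \<and> (\<forall>q\<in>topspace (orbit_space X act). orb (\<sigma> q) = q)"
    using global_section[OF X(1) Haus assms(6)[unfolded Q_def]] by (rule exE)
  show ?thesis
    unfolding Q_def \<pi>_def \<A>_def
  proof (rule homeomorphism_of_section[OF X conjunct1[OF \<sigma>]])
    show "orb (\<sigma> q) = q" if "q \<in> topspace (orbit_space X act)" for q
      using conjunct2[OF \<sigma>] that by (rule bspec)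
    show "face_torus (orbit_space X act) corners \<Lambda> (face_of_point (orbit_space X act) corners (orb x)) = stab x"
      if "x \<in> topspace X" for x
      by (rule face_torus_eq_stabilizer[OF assms(8)[unfolded Q_def \<pi>_def \<A>_def] that])
  qed
qed

end
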